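(* Let $\mathcal{H}_A,\mathcal{H}_B,\mathcal{H}_C$ be finite-dimensional Hilbert spaces, let $\rho_{ABC}$ be a pure state on $\mathcal{H}_A\otimes\mathcal{H}_B\otimes\mathcal{H}_C$, and let $Z=\{Z_j\}_{j=1}^N$ be a type of information about $A$. Then (i) $H(Z|C)=\min_{\sigma_{AB}} D\big(\rho_{AB}\,\big\|\,\sum_j Z_j\sigma_{AB}Z_j\big)$; (ii) $H_Q(Z|C)=\min_{\sigma_{AB}} D_{\mathrm{HS}}\big(\rho_{AB},\sum_j Z_j\sigma_{AB}Z_j\big)$; (iii) $p_{\mathrm{guess}}(Z|C)=\max_{\sigma_{AB}} F\big(\rho_{AB},\sum_j Z_j\sigma_{AB}Z_j\big)$, where the minima/maximum range over all density operators $\sigma_{AB}$ on $\mathcal{H}_A\otimes\mathcal{H}_B$, $\rho_{AB}=\mathrm{Tr}_C\rho_{ABC}$, and $Z_j$ acts as $Z_j\otimes I_B$.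
   Context: A type of information $Z=\{Z_j\}_{j=1}^N$ about $A$ is a set of mutually orthogonal projectors on $\mathcal{H}_A$ with $\sum_j Z_j=I_A$. Let $M_Z$ be a register with orthonormal basis $\{|j\rangle\}_{j=1}^N$ and $V_Z=\sum_j |j\rangle_{M_Z}\otimes Z_j$ (identity on $B,C$); set $\tilde\rho_{M_ZABC}=V_Z\rho_{ABC}V_Z^\dagger$. Its marginal is $\tilde\rho_{M_ZC}=\sum_j p_j|j\rangle\langle j|\otimes\rho_{C,j}$ with $p_j=\mathrm{Tr}(Z_j\rho_A)$ and $p_j\rho_{C,j}=\mathrm{Tr}_A[(Z_j\otimes I_C)\rho_{AC}]$. Definitions: $H(\rho)=-\mathrm{Tr}(\rho\log_2\rho)$; $H(Z|C)=H(\tilde\rho_{M_ZC})-H(\rho_C)$; $H_Q(Z|C)=\mathrm{Tr}(\rho_C^2)-\mathrm{Tr}(\tilde\rho_{M_ZC}^2)$; $p_{\mathrm{guess}}(Z|C)=\max_{Q}\sum_j p_j\mathrm{Tr}(Q_j\rho_{C,j})$, maximum over POVMs $Q=\{Q_j\}_{j=1}^N$ on $\mathcal{H}_C$. Relative entropy $D(\rho\|\sigma)=-H(\rho)-\mathrm{Tr}(\rho\log_2\sigma)$, Hilbert–Schmidt distance $D_{\mathrm{HS}}(\rho,\sigma)=\mathrm{Tr}[(\rho-\sigma)^2]$, fidelity $F(\rho,\sigma)=[\mathrm{Tr}(\sqrt{\rho}\sigma\sqrt{\rho})^{1/2}]^2$. *)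

theory Defs
  imports Complex_Main "HOL-Library.Extended_Real" "Jordan_Normal_Form.Matrix"
begin

text \<open>Hilbert spaces C^d, operators as complex d x d matrices (Jordan_Normal_Form).
  Tensor product of operators = Kronecker product, with composite index
  (i,k) of C^m (x) C^n mapped to i*n + k.\<close>

definition mtrace :: "complex mat \<Rightarrow> complex" where
  "mtrace A = (\<Sum>i<dim_row A. A $$ (i,i))"

definition adj :: "complex mat \<Rightarrow> complex mat" where
  "adj A = mat (dim_col A) (dim_row A) (\<lambda>(i,j). cnj (A $$ (j,i)))"

definition kron :: "complex mat \<Rightarrow> complex mat \<Rightarrow> complex mat" where
  "kron A B = mat (dim_row A * dim_row B) (dim_col A * dim_col B)
     (\<lambda>(i,j). A $$ (i div dim_row B, j div dim_col B) * B $$ (i mod dim_row B, j mod dim_col B))"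

text \<open>Partial trace over the middle factor of C^d1 (x) C^d2 (x) C^d3.
  Tracing out the first (last) factor of a bipartite system is the case d1 = 1 (d3 = 1).\<close>
definition ptrace_mid :: "nat \<Rightarrow> nat \<Rightarrow> nat \<Rightarrow> complex mat \<Rightarrow> complex mat" where
  "ptrace_mid d1 d2 d3 M = mat (d1 * d3) (d1 * d3)
     (\<lambda>(i,j). \<Sum>k<d2. M $$ ((i div d3 * d2 + k) * d3 + i mod d3, (j div d3 * d2 + k) * d3 + j mod d3))"

definition msum :: "nat \<Rightarrow> complex mat list \<Rightarrow> complex mat" where
  "msum n Ms = mat n n (\<lambda>(i,j). \<Sum>M\<leftarrow>Ms. M $$ (i,j))"

definition hermitian :: "nat \<Rightarrow> complex mat \<Rightarrow> bool" where
  "hermitian n A \<longleftrightarrow> A \<in> carrier_mat n n \<and> adj A = A"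

definition psd :: "nat \<Rightarrow> complex mat \<Rightarrow> bool" where
  "psd n A \<longleftrightarrow> hermitian n A \<and>
     (\<forall>v \<in> carrier_vec n. Im (conjugate v \<bullet> (A *\<^sub>v v)) = 0 \<and> Re (conjugate v \<bullet> (A *\<^sub>v v)) \<ge> 0)"

definition density :: "nat \<Rightarrow> complex mat \<Rightarrow> bool" where
  "density n A \<longleftrightarrow> psd n A \<and> mtrace A = 1"

definition projector :: "nat \<Rightarrow> complex mat \<Rightarrow> bool" where
  "projector n P \<longleftrightarrow> hermitian n P \<and> P * P = P"

definition outer :: "complex vec \<Rightarrow> complex vec \<Rightarrow> complex mat" where
  "outer u v = mat (dim_vec u) (dim_vec v) (\<lambda>(i,j). u $ i * cnj (v $ j))"

definition pure_state :: "nat \<Rightarrow> complex mat \<Rightarrow> bool" where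
  "pure_state n \<rho> \<longleftrightarrow> (\<exists>\<psi> \<in> carrier_vec n. (\<Sum>i<n. (cmod (\<psi> $ i))\<^sup>2) = 1 \<and> \<rho> = outer \<psi> \<psi>)"

definition type_info :: "nat \<Rightarrow> complex mat list \<Rightarrow> bool" where
  "type_info dA Z \<longleftrightarrow> (\<forall>j < length Z. projector dA (Z ! j))
     \<and> (\<forall>j < length Z. \<forall>k < length Z. j \<noteq> k \<longrightarrow> Z ! j * Z ! k = 0\<^sub>m dA dA)
     \<and> msum dA Z = 1\<^sub>m dA"

definition diagm :: "complex list \<Rightarrow> complex mat" where
  "diagm l = mat (length l) (length l) (\<lambda>(i,j). if i = j then l ! i else 0)"

text \<open>A spectral decomposition A = U diag(l) U^dagger, U unitary, l real (exists for Hermitian A).\<close>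
definition spec_decomp :: "complex mat \<Rightarrow> complex mat \<times> real list" where
  "spec_decomp A = (SOME (U, l). U \<in> carrier_mat (dim_row A) (dim_row A) \<and> U * adj U = 1\<^sub>m (dim_row A)
      \<and> adj U * U = 1\<^sub>m (dim_row A) \<and> length l = dim_row A
      \<and> A = U * diagm (map complex_of_real l) * adj U)"

text \<open>f(A) for Hermitian A (independent of the chosen decomposition).\<close>
definition matfun :: "(real \<Rightarrow> real) \<Rightarrow> complex mat \<Rightarrow> complex mat" where
  "matfun f A = (case spec_decomp A of (U, l) \<Rightarrow> U * diagm (map (\<lambda>x. complex_of_real (f x)) l) * adj U)"

text \<open>Matrix logarithm base 2; on the kernel it is set to 0 (Isabelle: log 2 0 = 0),
  which is the usual support convention.\<close>
definition log2m :: "complex mat \<Rightarrow> complex mat" where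
  "log2m A = matfun (log 2) A"

definition sqrtm :: "complex mat \<Rightarrow> complex mat" where
  "sqrtm A = matfun sqrt A"

definition vN_entropy :: "complex mat \<Rightarrow> real" where
  "vN_entropy \<rho> = - Re (mtrace (\<rho> * log2m \<rho>))"

text \<open>Support inclusion supp rho \<subseteq> supp sigma, i.e. ker sigma \<subseteq> ker rho.\<close>
definition supp_le :: "complex mat \<Rightarrow> complex mat \<Rightarrow> bool" where
  "supp_le \<rho> \<sigma> \<longleftrightarrow> (\<forall>v \<in> carrier_vec (dim_col \<sigma>). \<sigma> *\<^sub>v v = 0\<^sub>v (dim_row \<sigma>) \<longrightarrow> \<rho> *\<^sub>v v = 0\<^sub>v (dim_row \<rho>))"

definition rel_entropy :: "complex mat \<Rightarrow> complex mat \<Rightarrow> ereal" where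
  "rel_entropy \<rho> \<sigma> = (if supp_le \<rho> \<sigma>
      then ereal (- vN_entropy \<rho> - Re (mtrace (\<rho> * log2m \<sigma>))) else \<infinity>)"

definition hs_dist :: "complex mat \<Rightarrow> complex mat \<Rightarrow> real" where
  "hs_dist \<rho> \<sigma> = Re (mtrace ((\<rho> - \<sigma>) * (\<rho> - \<sigma>)))"

definition fidelity :: "complex mat \<Rightarrow> complex mat \<Rightarrow> real" where
  "fidelity \<rho> \<sigma> = (Re (mtrace (sqrtm (sqrtm \<rho> * \<sigma> * sqrtm \<rho>))))\<^sup>2"

definition ket :: "nat \<Rightarrow> nat \<Rightarrow> complex mat" where
  "ket N j = mat N 1 (\<lambda>(i,_). if i = j then 1 else 0)"

definition V_Z :: "nat \<Rightarrow> nat \<Rightarrow> nat \<Rightarrow> complex mat list \<Rightarrow> complex mat" where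
  "V_Z dA dB dC Z = (let N = length Z in
     mat (N * dA * dB * dC) (dA * dB * dC) (\<lambda>(i,j). \<Sum>k<N.
        kron (kron (kron (ket N k) (Z ! k)) (1\<^sub>m dB)) (1\<^sub>m dC) $$ (i,j)))"

definition rho_MZC :: "nat \<Rightarrow> nat \<Rightarrow> nat \<Rightarrow> complex mat list \<Rightarrow> complex mat \<Rightarrow> complex mat" where
  "rho_MZC dA dB dC Z \<rho> = ptrace_mid (length Z) (dA * dB) dC (V_Z dA dB dC Z * \<rho> * adj (V_Z dA dB dC Z))"

definition rho_C :: "nat \<Rightarrow> nat \<Rightarrow> nat \<Rightarrow> complex mat \<Rightarrow> complex mat" where
  "rho_C dA dB dC \<rho> = ptrace_mid 1 (dA * dB) dC \<rho>"

definition rho_AB :: "nat \<Rightarrow> nat \<Rightarrow> nat \<Rightarrow> complex mat \<Rightarrow> complex mat" where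
  "rho_AB dA dB dC \<rho> = ptrace_mid (dA * dB) dC 1 \<rho>"

definition rho_AC :: "nat \<Rightarrow> nat \<Rightarrow> nat \<Rightarrow> complex mat \<Rightarrow> complex mat" where
  "rho_AC dA dB dC \<rho> = ptrace_mid dA dB dC \<rho>"

definition cond_entropy :: "nat \<Rightarrow> nat \<Rightarrow> nat \<Rightarrow> complex mat list \<Rightarrow> complex mat \<Rightarrow> real" where
  "cond_entropy dA dB dC Z \<rho> = vN_entropy (rho_MZC dA dB dC Z \<rho>) - vN_entropy (rho_C dA dB dC \<rho>)"

definition cond_entropy_Q :: "nat \<Rightarrow> nat \<Rightarrow> nat \<Rightarrow> complex mat list \<Rightarrow> complex mat \<Rightarrow> real" where
  "cond_entropy_Q dA dB dC Z \<rho> =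
     Re (mtrace (rho_C dA dB dC \<rho> * rho_C dA dB dC \<rho>))
     - Re (mtrace (rho_MZC dA dB dC Z \<rho> * rho_MZC dA dB dC Z \<rho>))"

definition weighted_cond_state :: "nat \<Rightarrow> nat \<Rightarrow> nat \<Rightarrow> complex mat list \<Rightarrow> complex mat \<Rightarrow> nat \<Rightarrow> complex mat" where
  "weighted_cond_state dA dB dC Z \<rho> j = ptrace_mid 1 dA dC (kron (Z ! j) (1\<^sub>m dC) * rho_AC dA dB dC \<rho>)"

definition povm :: "nat \<Rightarrow> nat \<Rightarrow> complex mat list \<Rightarrow> bool" where
  "povm N d Q \<longleftrightarrow> length Q = N \<and> (\<forall>j < N. psd d (Q ! j)) \<and> msum d Q = 1\<^sub>m d"

text \<open>p_guess(Z|C) = max_Q sum_j p_j Tr(Q_j rho_{C,j}) (the maximum is attained; written as Sup).\<close>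
definition p_guess :: "nat \<Rightarrow> nat \<Rightarrow> nat \<Rightarrow> complex mat list \<Rightarrow> complex mat \<Rightarrow> real" where
  "p_guess dA dB dC Z \<rho> = Sup {(\<Sum>j < length Z. Re (mtrace (Q ! j * weighted_cond_state dA dB dC Z \<rho> j)))
        | Q. povm (length Z) dC Q}"

definition pinch :: "nat \<Rightarrow> nat \<Rightarrow> complex mat list \<Rightarrow> complex mat \<Rightarrow> complex mat" where
  "pinch dA dB Z \<sigma> = msum (dA * dB) (map (\<lambda>Zj. kron Zj (1\<^sub>m dB) * \<sigma> * kron Zj (1\<^sub>m dB)) Z)"

end

theory Submission
  imports Defs "Jordan_Normal_Form.Spectral_Radius" "Jordan_Normal_Form.Schur_Decomposition"
begin

text \<open>
  Write the pure state as a coefficient matrix X with respect to the cut AB|C, let P_j be Z_j extended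
  to AB by the identity, and let Y be the row of blocks P_j X. Then rho_AB = X X*, rho_C is the transpose
  of X* X, the state of M_Z and C is the transpose of Y* Y, and Y Y* is the pinching of rho_AB.
  Since f(Y Y*) Y = Y f(Y* Y), the quantities on the C side become quantities of rho_AB and its pinching.

  For (i), the logarithm of a pinched state commutes with every P_j, so rho_AB may be replaced by its pinching
  in Tr (rho_AB log tau), and Klein's inequality shows that the pinching of rho_AB is optimal. Part (ii) is
  Pythagoras for the Hilbert-Schmidt inner product.

  For (iii), the square root of F(X X*, Y Y*) is the trace norm of X* Y. If K is a contraction attaining this norm for
  X* sqrt(tau), with tau the pinching of sigma, Cauchy-Schwarz bounds F by the guessing probability of the
  sub-POVM K* P_j K. Conversely a POVM R gives the state proportional to the sum of the
  P_j X R_j X* P_j, whose fidelity with X X* is at least the guessing probability of R.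
\<close>

section \<open>Complex matrices and the spectral theorem\<close>

text \<open>The C side and the AB side carry Gram matrices of different sizes, so a trace crosses
  over only with a factor of the matrix in front: a bare f would also count f(0) on the surplus zero
  eigenvalues. Entropy and purity already have this shape; the square root gets it by writing sqrt x
  as x * (1 / sqrt x). With log 2 0 = 0 and 1 / 0 = 0 these functions act on supports, so no state
  has to be invertible. In exchange, Klein's inequality needs a separate argument on the kernel, and
  finiteness of the relative entropy at the optimum has to be proved.

  The construction for (iii) bounds the fidelity below by the score of one given POVM only. For a
  genuine maximum an optimal POVM must exist, which compactness in the finitely many matrix entries
  provides. In the upper bound, K times the adjoint of X is pinched before Cauchy-Schwarz: this
  keeps the trace and leaves exactly the diagonal blocks that make up the guessing score. The
  transposes on the C side arise because the partial trace conjugates the other index; they preserve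
  spectra and send POVMs to POVMs.\<close>

lemma mat_mult_assoc:
  fixes A B C :: "complex mat"
  assumes "dim_col A = dim_row B" "dim_col B = dim_row C"
  shows "A * B * C = A * (B * C)"
  using assms by (intro assoc_mult_mat) auto

text \<open>Gives entries of products as explicit sums over \<open>..<\<close>. Calculations with it
  delete \<open>index_mult_mat(1)\<close>, which would rewrite entries to scalar products
  instead.\<close>

lemma index_mat_mult:
  fixes A B :: "complex mat"
  assumes "i < dim_row A" "j < dim_col B" "dim_col A = dim_row B"
  shows "(A * B) $$ (i,j) = (\<Sum>k<dim_row B. A $$ (i,k) * B $$ (k,j))"
  using assms by (simp add: scalar_prod_def lessThan_atLeast0)

lemma dim_adj [simp]: "dim_row (adj A) = dim_col A" "dim_col (adj A) = dim_row A"
  by (simp_all add: adj_def)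

lemma index_adj [simp]: "i < dim_col A \<Longrightarrow> j < dim_row A \<Longrightarrow> adj A $$ (i,j) = cnj (A $$ (j,i))"
  by (simp add: adj_def)

lemma adj_adj [simp]: "adj (adj A) = A"
  by (intro eq_matI) auto

lemma adj_one [simp]: "adj (1\<^sub>m n) = 1\<^sub>m n"
  by (intro eq_matI) auto

lemma adj_mult: "dim_col A = dim_row B \<Longrightarrow> adj (A * B) = adj B * adj A"
  by (intro eq_matI) (auto simp: index_mat_mult mult.commute simp del: index_mult_mat(1))

lemma adj_minus: "dim_row A = dim_row B \<Longrightarrow> dim_col A = dim_col B \<Longrightarrow> adj (A - B) = adj A - adj B"
  by (intro eq_matI) auto

lemma transpose_mat_mult:
  fixes A B :: "complex mat"
  shows "dim_col A = dim_row B \<Longrightarrow> (A * B)\<^sup>T = B\<^sup>T * A\<^sup>T"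
  by (rule transpose_mult) auto

lemma adj_transpose: "adj (A\<^sup>T) = (adj A)\<^sup>T"
  by (intro eq_matI) auto

lemma left_distrib_minus_mat:
  fixes A B C :: "complex mat"
  assumes "dim_col A = dim_row B" "dim_row B = dim_row C" "dim_col B = dim_col C"
  shows "A * (B - C) = A * B - A * C"
  using assms by (intro mult_minus_distrib_mat) auto

lemma right_distrib_minus_mat:
  fixes A B C :: "complex mat"
  assumes "dim_col A = dim_row C" "dim_row A = dim_row B" "dim_col A = dim_col B"
  shows "(A - B) * C = A * C - B * C"
  using assms by (intro minus_mult_distrib_mat) auto

lemma mat_one_mult [simp]:
  fixes A :: "complex mat"
  shows "dim_row A = n \<Longrightarrow> 1\<^sub>m n * A = A" "dim_col A = n \<Longrightarrow> A * 1\<^sub>m n = A"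
  by (auto intro: left_mult_one_mat' right_mult_one_mat')

lemma mtrace_mult:
  assumes "dim_col A = dim_row B" "dim_col B = dim_row A"
  shows "mtrace (A * B) = (\<Sum>i<dim_row A. \<Sum>k<dim_row B. A $$ (i,k) * B $$ (k,i))"
  using assms by (simp add: mtrace_def index_mat_mult del: index_mult_mat(1))

lemma mtrace_mult_comm:
  assumes "dim_col A = dim_row B" "dim_col B = dim_row A"
  shows "mtrace (A * B) = mtrace (B * A)"
  using assms by (subst (1 2) mtrace_mult) (auto simp: mult.commute intro: sum.swap)

lemma mtrace_minus:
  "dim_row A = dim_row B \<Longrightarrow> dim_col A = dim_row A \<Longrightarrow> dim_col B = dim_row B \<Longrightarrow>
    mtrace (A - B) = mtrace A - mtrace B"
  by (simp add: mtrace_def sum_subtractf)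

lemma mtrace_add:
  "dim_row A = dim_row B \<Longrightarrow> dim_col A = dim_row A \<Longrightarrow> dim_col B = dim_row B \<Longrightarrow>
    mtrace (A + B) = mtrace A + mtrace B"
  by (simp add: mtrace_def sum.distrib)

lemma mtrace_smult: "dim_col A = dim_row A \<Longrightarrow> mtrace (c \<cdot>\<^sub>m A) = c * mtrace A"
  by (simp add: mtrace_def sum_distrib_left)

lemma mtrace_transpose: "dim_col A = dim_row A \<Longrightarrow> mtrace (A\<^sup>T) = mtrace A"
  by (simp add: mtrace_def)

section \<open>Diagonal matrices\<close>

lemma dim_diagm [simp]: "dim_row (diagm l) = length l" "dim_col (diagm l) = length l"
  by (simp_all add: diagm_def)

lemma index_diagm [simp]:
  "i < length l \<Longrightarrow> j < length l \<Longrightarrow> diagm l $$ (i,j) = (if i = j then l ! i else 0)"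
  by (simp add: diagm_def)

lemma index_mult_diagm:
  assumes "i < dim_row A" "j < length l" "dim_col A = length l"
  shows "(A * diagm l) $$ (i,j) = A $$ (i,j) * l ! j"
proof -
  have "(A * diagm l) $$ (i,j) = (\<Sum>k<length l. A $$ (i,k) * diagm l $$ (k,j))"
    using assms by (subst index_mat_mult) auto
  also have "\<dots> = (\<Sum>k<length l. if k = j then A $$ (i,k) * l ! k else 0)"
    using assms by (intro sum.cong) auto
  finally show ?thesis using assms by simp
qed

lemma index_diagm_mult:
  assumes "i < length l" "j < dim_col A" "dim_row A = length l"
  shows "(diagm l * A) $$ (i,j) = l ! i * A $$ (i,j)"
proof -
  have "(diagm l * A) $$ (i,j) = (\<Sum>k<length l. diagm l $$ (i,k) * A $$ (k,j))"
    using assms by (subst index_mat_mult) auto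
  also have "\<dots> = (\<Sum>k<length l. if k = i then l ! k * A $$ (k,j) else 0)"
    using assms by (intro sum.cong) auto
  finally show ?thesis using assms by simp
qed

lemma adj_diagm_of_real: "adj (diagm (map (\<lambda>x. complex_of_real (f x)) l)) = diagm (map (\<lambda>x. complex_of_real (f x)) l)"
  by (intro eq_matI) auto

section \<open>Hermitian matrices and their diagonalisation\<close>

lemma hermitianD:
  assumes "hermitian n A"
  shows "dim_row A = n" "dim_col A = n" "adj A = A"
  using assms by (auto simp: hermitian_def)

lemma hermitianI: "dim_row A = n \<Longrightarrow> dim_col A = n \<Longrightarrow> adj A = A \<Longrightarrow> hermitian n A"
  by (auto simp: hermitian_def)

text \<open>Gram-Schmidt applied to a completed basis leaves its first vector unchanged and yields
  orthogonal, not yet normalised vectors; dividing each by its norm gives the columns of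
  \<open>W\<close>. The factor \<open>c\<close> stays unspecified because only the line spanned by
  \<open>v\<close> matters later.\<close>

lemma unitary_extension:
  fixes v :: "complex vec"
  assumes v: "v \<in> carrier_vec n" "v \<noteq> 0\<^sub>v n" and n: "n > 0"
  obtains W c where "dim_row W = n" "dim_col W = n" "adj W * W = 1\<^sub>m n" "W * adj W = 1\<^sub>m n"
    "col W 0 = c \<cdot>\<^sub>v v"
proof -
  interpret cof_vec_space n "TYPE(complex)" .
  define b where "b = basis_completion v"
  define ws where "ws = gram_schmidt n b"
  note b = basis_completion[OF v, folded b_def]
  have ws: "set ws \<subseteq> carrier_vec n" "corthogonal ws" "length ws = n"
    using gram_schmidt_result[OF b(2,4,5) ws_def] b by auto
  obtain vs where bv: "b = v # vs" using b n by (cases b) auto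
  have ws0: "ws ! 0 = v"
  proof -
    have "ws \<noteq> []" using ws(3) n by auto
    moreover have "hd ws = v" unfolding ws_def bv by (rule gram_schmidt_hd[OF v(1)])
    ultimately show ?thesis by (simp add: hd_conv_nth)
  qed
  define s where "s j = sqrt (\<Sum>k<n. (cmod (ws ! j $ k))\<^sup>2)" for j
  have dimw: "dim_vec (ws ! j) = n" if "j < n" for j
    using ws that by (metis carrier_vecD nth_mem subsetD)
  have ip: "ws ! i \<bullet>c ws ! j = (\<Sum>k<n. ws ! i $ k * cnj (ws ! j $ k))" if "i < n" "j < n" for i j
    using dimw that by (auto simp: scalar_prod_def lessThan_atLeast0)
  have ss: "ws ! j \<bullet>c ws ! j = complex_of_real ((s j)\<^sup>2)" if "j < n" for j
    unfolding ip[OF that that] s_def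
    by (subst real_sqrt_pow2) (auto simp: sum_nonneg complex_norm_square[symmetric])
  \<comment> \<open>Orthogonality in the sense of \<open>corthogonal\<close> includes that no vector
    has inner product zero with itself.\<close>
  have s0: "s j \<noteq> 0" if "j < n" for j
    using ss[OF that] corthogonalD[OF ws(2), of j j] that ws(3) by auto
  define W where "W = mat n n (\<lambda>(i,j). ws ! j $ i / complex_of_real (s j))"
  have dW: "dim_row W = n" "dim_col W = n" by (auto simp: W_def)
  have "adj W * W = 1\<^sub>m n"
  proof (rule eq_matI)
    fix i j assume "i < dim_row (1\<^sub>m n :: complex mat)" "j < dim_col (1\<^sub>m n :: complex mat)"
    hence ij: "i < n" "j < n" by auto
    have "(adj W * W) $$ (i,j) = (\<Sum>k<n. cnj (ws ! i $ k / complex_of_real (s i)) * (ws ! j $ k / complex_of_real (s j)))"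
      using ij by (subst index_mat_mult) (auto simp: dW, simp add: W_def)
    also have "\<dots> = (ws ! j \<bullet>c ws ! i) / complex_of_real (s i * s j)"
      using ij by (simp add: ip sum_divide_distrib mult.commute)
    also have "\<dots> = (if i = j then 1 else 0)"
    proof (cases "i = j")
      case True
      thus ?thesis using ss[OF ij(2)] s0[OF ij(2)] by (simp add: power2_eq_square)
    next
      case False
      hence "ws ! j \<bullet>c ws ! i = 0" using ij corthogonalD[OF ws(2), of j i] ws(3) by simp
      thus ?thesis using False by simp
    qed
    finally show "(adj W * W) $$ (i,j) = 1\<^sub>m n $$ (i,j)" using ij by simp
  qed (auto simp: dW)
  moreover from this have "W * adj W = 1\<^sub>m n"
    by (rule mat_mult_left_right_inverse[rotated 2]) (simp_all add: dW carrier_matI)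
  moreover have "col W 0 = (1 / complex_of_real (s 0)) \<cdot>\<^sub>v v"
    using n ws0 v by (intro eq_vecI) (auto simp: W_def)
  ultimately show ?thesis using that dW by blast
qed

text \<open>Deflation: a unit eigenvector is extended to an orthonormal basis, which splits off a 1 x 1 block.\<close>

theorem hermitian_spectral_decomposition:
  assumes "hermitian n A"
  shows "\<exists>U l. dim_row U = n \<and> dim_col U = n \<and> U * adj U = 1\<^sub>m n \<and> adj U * U = 1\<^sub>m n \<and> length l = n
    \<and> A = U * diagm (map complex_of_real l) * adj U"
  using assms
proof (induction n arbitrary: A)
  case 0
  then show ?case
    by (intro exI[of _ "1\<^sub>m 0"] exI[of _ "[]"]) (auto simp: hermitian_def)
next
  case (Suc n)
  note A = hermitianD[OF Suc.prems]
  have "spectrum A \<noteq> {}"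
    using spectrum_non_empty[of A "Suc n"] A by auto
  then obtain e v where ev: "eigenvector A v e"
    unfolding spectrum_def eigenvalue_def by auto
  hence v: "v \<in> carrier_vec (Suc n)" "v \<noteq> 0\<^sub>v (Suc n)" "A *\<^sub>v v = e \<cdot>\<^sub>v v"
    using A by (auto simp: eigenvector_def)
  obtain W c where W: "dim_row W = Suc n" "dim_col W = Suc n" "adj W * W = 1\<^sub>m (Suc n)" "W * adj W = 1\<^sub>m (Suc n)"
    and W0: "col W 0 = c \<cdot>\<^sub>v v"
    using unitary_extension[OF v(1,2)] by blast
  have AW0: "col (A * W) 0 = e \<cdot>\<^sub>v col W 0"
  proof -
    have "col (A * W) 0 = A *\<^sub>v col W 0"
      using A W by (intro col_mult2[of _ "Suc n" "Suc n" _ "Suc n"]) auto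
    also have "\<dots> = c \<cdot>\<^sub>v (A *\<^sub>v v)"
      unfolding W0 using A v(1) by (intro mult_mat_vec[of _ "Suc n" "Suc n"]) auto
    finally show ?thesis using v W0 by (simp add: smult_smult_assoc mult.commute)
  qed
  define B where "B = adj W * (A * W)"
  have dB: "dim_row B = Suc n" "dim_col B = Suc n" by (auto simp: B_def W)
  have adjB: "adj B = B"
    unfolding B_def using A W by (simp add: adj_mult mat_mult_assoc)
  have cB: "B $$ (i,j) = cnj (B $$ (j,i))" if "i < Suc n" "j < Suc n" for i j
    using arg_cong[OF adjB, of "\<lambda>M. M $$ (i,j)"] that dB by simp
  have B0: "B $$ (i,0) = (if i = 0 then e else 0)" if i: "i < Suc n" for i
  proof -
    have AWk: "(A * W) $$ (k,0) = e * W $$ (k,0)" if "k < Suc n" for k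
      using arg_cong[OF AW0, of "\<lambda>x. x $ k"] that A W by simp
    have "B $$ (i,0) = (\<Sum>k<Suc n. adj W $$ (i,k) * (A * W) $$ (k,0))"
      unfolding B_def using i A W by (subst index_mat_mult) auto
    also have "\<dots> = (\<Sum>k<Suc n. adj W $$ (i,k) * (e * W $$ (k,0)))"
      using AWk by (intro sum.cong) auto
    also have "\<dots> = e * (\<Sum>k<Suc n. adj W $$ (i,k) * W $$ (k,0))"
      unfolding sum_distrib_left by (intro sum.cong) auto
    also have "\<dots> = e * (adj W * W) $$ (i,0)"
      using i W by (subst index_mat_mult) auto
    finally show ?thesis using W i by simp
  qed
  \<comment> \<open>The eigenvalue is now a diagonal entry of the Hermitian matrix \<open>B\<close>,
    hence real. The first row of \<open>B\<close> is then the conjugate of its first column.\<close>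
  have "cnj e = e"
    using cB[of 0 0] unfolding B0[OF zero_less_Suc] by simp
  hence e: "complex_of_real (Re e) = e"
    by (simp add: complex_eq_iff)
  have B0': "B $$ (0,j) = (if j = 0 then e else 0)" if "j < Suc n" for j
    using B0[OF that] \<open>cnj e = e\<close> unfolding cB[OF zero_less_Suc that] by auto
  define B' where "B' = mat n n (\<lambda>(i,j). B $$ (Suc i, Suc j))"
  have "hermitian n B'"
    by (intro hermitianI eq_matI) (auto simp: B'_def cB[symmetric])
  from Suc.IH[OF this] obtain U' l where U': "dim_row U' = n" "dim_col U' = n" "U' * adj U' = 1\<^sub>m n"
    "adj U' * U' = 1\<^sub>m n" "length l = n" and B'U: "B' = U' * diagm (map complex_of_real l) * adj U'"
    by blast
  \<comment> \<open>The block sum of the 1 x 1 identity and \<open>U'\<close>: it fixes the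
    eigenvector already split off and diagonalises the remaining block.\<close>
  define M where "M = mat (Suc n) (Suc n)
     (\<lambda>(i,j). if i = 0 \<or> j = 0 then (if i = j then 1 else 0) else U' $$ (i - 1, j - 1))"
  have dM: "dim_row M = Suc n" "dim_col M = Suc n" by (auto simp: M_def)
  have MM: "adj M * M = 1\<^sub>m (Suc n)"
  proof (rule eq_matI)
    fix i j assume "i < dim_row (1\<^sub>m (Suc n) :: complex mat)" "j < dim_col (1\<^sub>m (Suc n) :: complex mat)"
    hence ij: "i < Suc n" "j < Suc n" by auto
    have "(adj M * M) $$ (i,j) = (\<Sum>k<Suc n. cnj (M $$ (k,i)) * M $$ (k,j))"
      using ij by (subst index_mat_mult) (auto simp: dM)
    also have "\<dots> = (if i = 0 \<or> j = 0 then (if i = j then 1 else 0) else (adj U' * U') $$ (i - 1, j - 1))"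
      using ij U'(1,2) by (cases i; cases j)
        (auto simp: M_def sum.lessThan_Suc_shift index_mat_mult
          simp del: index_mult_mat(1) sum.lessThan_Suc)
    also have "\<dots> = 1\<^sub>m (Suc n) $$ (i,j)"
      using ij U' by (cases i; cases j) auto
    finally show "(adj M * M) $$ (i,j) = 1\<^sub>m (Suc n) $$ (i,j)" .
  qed (auto simp: dM)
  have MM': "M * adj M = 1\<^sub>m (Suc n)"
    by (rule mat_mult_left_right_inverse[OF _ _ MM]) (simp_all add: dM carrier_matI)
  define D where "D = diagm (map complex_of_real (Re e # l))"
  have dD: "dim_row D = Suc n" "dim_col D = Suc n" by (auto simp: D_def U')
  have BM: "B = M * D * adj M"
  proof (rule eq_matI)
    fix i j assume "i < dim_row (M * D * adj M)" "j < dim_col (M * D * adj M)"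
    hence ij: "i < Suc n" "j < Suc n" by (auto simp: dM)
    have "(M * D * adj M) $$ (i,j) = (\<Sum>k<Suc n. (M * D) $$ (i,k) * cnj (M $$ (j,k)))"
      using ij by (subst index_mat_mult) (auto simp: dM dD)
    also have "\<dots> = (\<Sum>k<Suc n. M $$ (i,k) * map complex_of_real (Re e # l) ! k * cnj (M $$ (j,k)))"
      unfolding D_def using ij U' by (intro sum.cong) (auto simp: dM index_mult_diagm simp del: index_mult_mat(1) list.map)
    also have "\<dots> = B $$ (i,j)"
    proof (cases "i = 0 \<or> j = 0")
      case True
      thus ?thesis using ij e
        by (auto simp: M_def sum.lessThan_Suc_shift B0 B0' simp del: sum.lessThan_Suc)
    next
      case False
      then obtain i' j' where ij': "i = Suc i'" "j = Suc j'" "i' < n" "j' < n"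
        using ij by (metis Suc_less_eq not0_implies_Suc)
      have "B' $$ (i',j') = (\<Sum>k<n. (U' * diagm (map complex_of_real l)) $$ (i',k) * cnj (U' $$ (j',k)))"
        unfolding B'U using ij' U' by (subst index_mat_mult) auto
      also have "\<dots> = (\<Sum>k<n. U' $$ (i',k) * complex_of_real (l ! k) * cnj (U' $$ (j',k)))"
        using ij' U' by (intro sum.cong) (auto simp: index_mult_diagm simp del: index_mult_mat(1))
      finally show ?thesis using ij' U'
        by (auto simp: M_def sum.lessThan_Suc_shift B'_def simp del: sum.lessThan_Suc)
    qed
    finally show "B $$ (i,j) = (M * D * adj M) $$ (i,j)" by simp
  qed (auto simp: dB dM)
  have "A = W * (adj W * (A * W)) * adj W"
  proof -
    have "W * (adj W * (A * W)) * adj W = (W * adj W) * A * (W * adj W)"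
      using A W(1,2) by (simp add: mat_mult_assoc)
    thus ?thesis using A W by simp
  qed
  hence "A = W * (M * D * adj M) * adj W"
    unfolding B_def[symmetric] BM .
  hence "A = (W * M) * D * adj (W * M)"
    using W(1,2) dM dD by (simp add: mat_mult_assoc adj_mult)
  moreover have "(W * M) * adj (W * M) = 1\<^sub>m (Suc n)"
  proof -
    have "(W * M) * adj (W * M) = W * (M * adj M) * adj W"
      using W(1,2) dM by (simp add: mat_mult_assoc adj_mult)
    thus ?thesis using W MM' by simp
  qed
  moreover have "adj (W * M) * (W * M) = 1\<^sub>m (Suc n)"
  proof -
    have "adj (W * M) * (W * M) = adj M * (adj W * W) * M"
      using W(1,2) dM by (simp add: mat_mult_assoc adj_mult)
    thus ?thesis using W MM dM by simp
  qed
  ultimately show ?case unfolding D_def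
    using W dM U' by (intro exI[of _ "W * M"] exI[of _ "Re e # l"]) auto
qed

section \<open>Functional calculus and positive matrices\<close>

text \<open>\<open>spec_decomp\<close> depends on the matrix alone, so one pair (U, l) serves every
  f simultaneously. Products and differences of functions of the same matrix thereby reduce to
  diagonal matrices.\<close>

lemma matfun_spectral:
  assumes "hermitian n A"
  obtains U l where "dim_row U = n" "dim_col U = n" "U * adj U = 1\<^sub>m n" "adj U * U = 1\<^sub>m n" "length l = n"
    "A = U * diagm (map complex_of_real l) * adj U"
    "\<And>f. matfun f A = U * diagm (map (\<lambda>x. complex_of_real (f x)) l) * adj U"
proof -
  let ?P = "\<lambda>(U, l). U \<in> carrier_mat (dim_row A) (dim_row A) \<and> U * adj U = 1\<^sub>m (dim_row A)
      \<and> adj U * U = 1\<^sub>m (dim_row A) \<and> length l = dim_row A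
      \<and> A = U * diagm (map complex_of_real l) * adj U"
  have "\<exists>x. ?P x"
    using hermitian_spectral_decomposition[OF assms] hermitianD[OF assms] by auto
  hence "?P (spec_decomp A)"
    unfolding spec_decomp_def by (rule someI_ex)
  moreover obtain U l where "spec_decomp A = (U, l)" by force
  ultimately show ?thesis
    using that[of U l] hermitianD[OF assms] by (auto simp: matfun_def)
qed

lemma matfun_hermitian: "hermitian n A \<Longrightarrow> hermitian n (matfun f A)"
  by (elim matfun_spectral, intro hermitianI) (auto simp: adj_mult mat_mult_assoc adj_diagm_of_real)

lemma matfun_dim [simp]: 
  assumes "hermitian n A" 
  shows "dim_row (matfun f A) = n" "dim_col (matfun f A) = n" "adj (matfun f A) = matfun f A"
  using hermitianD[OF matfun_hermitian[OF assms]] by auto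

lemma matfun_id:
  assumes "hermitian n A"
  shows "matfun (\<lambda>x. x) A = A"
  using assms
proof (rule matfun_spectral)
  fix U l
  assume A: "A = U * diagm (map complex_of_real l) * adj U"
    and f: "\<And>f. matfun f A = U * diagm (map (\<lambda>x. complex_of_real (f x)) l) * adj U"
  show ?thesis unfolding f by (rule A[symmetric])
qed

lemma matfun_mult:
  assumes "hermitian n A"
  shows "matfun f A * matfun g A = matfun (\<lambda>x. f x * g x) A"
proof -
  obtain U l where U: "dim_row U = n" "dim_col U = n" "U * adj U = 1\<^sub>m n" "adj U * U = 1\<^sub>m n" "length l = n"
    and f: "\<And>f. matfun f A = U * diagm (map (\<lambda>x. complex_of_real (f x)) l) * adj U"
    by (rule matfun_spectral[OF assms]) blast
  let ?D = "\<lambda>f. diagm (map (\<lambda>x. complex_of_real (f x)) l)"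
  have "matfun f A * matfun g A = U * ?D f * (adj U * U) * ?D g * adj U"
    unfolding f using U(1,2,5) by (simp add: mat_mult_assoc)
  also have "\<dots> = U * (?D f * ?D g) * adj U"
    using U by (simp add: mat_mult_assoc)
  also have "?D f * ?D g = ?D (\<lambda>x. f x * g x)"
    by (intro eq_matI) (auto simp: index_mult_diagm simp del: index_mult_mat(1))
  finally show ?thesis unfolding f .
qed

lemma matfun_minus:
  assumes "hermitian n A"
  shows "matfun f A - matfun g A = matfun (\<lambda>x. f x - g x) A"
proof -
  obtain U l where U: "dim_row U = n" "dim_col U = n" "length l = n"
    and f: "\<And>f. matfun f A = U * diagm (map (\<lambda>x. complex_of_real (f x)) l) * adj U"
    by (rule matfun_spectral[OF assms]) blast
  let ?D = "\<lambda>f. diagm (map (\<lambda>x. complex_of_real (f x)) l)"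
  have "?D (\<lambda>x. f x - g x) = ?D f - ?D g"
    by (intro eq_matI) auto
  thus ?thesis unfolding f
    using U by (simp add: left_distrib_minus_mat right_distrib_minus_mat)
qed

lemma matfun_one:
  assumes "hermitian n A"
  shows "matfun (\<lambda>x. 1) A = 1\<^sub>m n"
proof -
  obtain U l where U: "dim_row U = n" "dim_col U = n" "U * adj U = 1\<^sub>m n" "length l = n"
    and f: "\<And>f. matfun f A = U * diagm (map (\<lambda>x. complex_of_real (f x)) l) * adj U"
    by (rule matfun_spectral[OF assms]) blast
  have "diagm (map (\<lambda>x. complex_of_real 1) l) = 1\<^sub>m n"
    using U by (intro eq_matI) auto
  thus ?thesis unfolding f using U by simp
qed

text \<open>Entrywise the hypothesis is (l_i - m_j) G_ij = 0. Either the entry vanishes or the two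
  eigenvalues agree, and in both cases any f may be applied to them; f needs neither continuity nor
  a polynomial approximation.\<close>

lemma diagm_intertwine:
  assumes G: "diagm (map complex_of_real l) * G = G * diagm (map complex_of_real m)"
    and d: "dim_row G = length l" "dim_col G = length m"
  shows "diagm (map (\<lambda>x. complex_of_real (f x)) l) * G = G * diagm (map (\<lambda>x. complex_of_real (f x)) m)"
proof (rule eq_matI)
  fix i j assume "i < dim_row (G * diagm (map (\<lambda>x. complex_of_real (f x)) m))"
    "j < dim_col (G * diagm (map (\<lambda>x. complex_of_real (f x)) m))"
  hence ij: "i < length l" "j < length m" using d by auto
  have "complex_of_real (l ! i) * G $$ (i,j) = G $$ (i,j) * complex_of_real (m ! j)"
    using arg_cong[OF G, of "\<lambda>M. M $$ (i,j)"] ij d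
    by (simp add: index_mult_diagm index_diagm_mult del: index_mult_mat(1))
  hence "G $$ (i,j) = 0 \<or> l ! i = m ! j" by auto
  thus "(diagm (map (\<lambda>x. complex_of_real (f x)) l) * G) $$ (i,j) = (G * diagm (map (\<lambda>x. complex_of_real (f x)) m)) $$ (i,j)"
    using ij d by (auto simp: index_mult_diagm index_diagm_mult simp del: index_mult_mat(1))
qed (use d in auto)

text \<open>In eigenbases of A and B the hypothesis says that the matrix element of M between
  eigenvalues a and b vanishes unless a = b.\<close>

lemma intertwine_spectral:
  assumes U: "dim_row U = n" "dim_col U = n" "U * adj U = 1\<^sub>m n" "adj U * U = 1\<^sub>m n" "length l = n"
    and V: "dim_row V = m" "dim_col V = m" "V * adj V = 1\<^sub>m m" "adj V * V = 1\<^sub>m m" "length k = m"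
    and M: "dim_row M = n" "dim_col M = m"
    and eq: "U * diagm (map complex_of_real l) * adj U * M = M * (V * diagm (map complex_of_real k) * adj V)"
  shows "U * diagm (map (\<lambda>x. complex_of_real (f x)) l) * adj U * M
    = M * (V * diagm (map (\<lambda>x. complex_of_real (f x)) k) * adj V)"
proof -
  let ?L = "\<lambda>f. diagm (map (\<lambda>x. complex_of_real (f x)) l)"
  let ?K = "\<lambda>f. diagm (map (\<lambda>x. complex_of_real (f x)) k)"
  let ?LL = "diagm (map complex_of_real l)" and ?KK = "diagm (map complex_of_real k)"
  \<comment> \<open>\<open>M\<close> expressed in the two eigenbases, where both operators become
    diagonal.\<close>
  define G where "G = adj U * M * V"
  have dG: "dim_row G = n" "dim_col G = m" by (auto simp: G_def U V)
  have "?LL * G = adj U * U * ?LL * (adj U * M * V)"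
    using U by (simp add: G_def)
  also have "\<dots> = adj U * (U * ?LL * adj U * M) * V"
    using U(1,2,5) V(1,2,5) M by (simp add: mat_mult_assoc)
  also have "\<dots> = adj U * M * V * ?KK * (adj V * V)"
    unfolding eq using U(1,2,5) V(1,2,5) M by (simp add: mat_mult_assoc)
  also have "\<dots> = G * ?KK"
    using V U by (simp add: G_def)
  finally have G: "?L f * G = G * ?K f"
    by (rule diagm_intertwine) (simp_all add: dG U V)
  have "U * ?L f * adj U * M = U * ?L f * (adj U * M * (V * adj V))"
    using U(1,2,5) V M by (simp add: mat_mult_assoc)
  also have "\<dots> = U * (?L f * G) * adj V"
    using U(1,2,5) V(1,2,5) M by (simp add: mat_mult_assoc G_def)
  also have "\<dots> = (U * adj U) * M * (V * ?K f * adj V)"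
    unfolding G using U(1,2,5) V(1,2,5) M by (simp add: mat_mult_assoc G_def)
  also have "\<dots> = M * (V * ?K f * adj V)"
    using U M by simp
  finally show ?thesis .
qed

text \<open>\<open>M\<close> may be rectangular. With \<open>M\<close> a projector this says that
  functions of a matrix keep its commutation relations; with \<open>M = Y\<close> it moves f between
  the two Gram matrices of \<open>Y\<close>.\<close>

lemma matfun_intertwine:
  assumes A: "hermitian n A" and B: "hermitian m B" and M: "dim_row M = n" "dim_col M = m"
    and eq: "A * M = M * B"
  shows "matfun f A * M = M * matfun f B"
proof -
  obtain U l where U: "dim_row U = n" "dim_col U = n" "U * adj U = 1\<^sub>m n" "adj U * U = 1\<^sub>m n" "length l = n"
    and AU: "A = U * diagm (map complex_of_real l) * adj U"
    and f: "\<And>f. matfun f A = U * diagm (map (\<lambda>x. complex_of_real (f x)) l) * adj U"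
    by (rule matfun_spectral[OF A]) blast
  obtain V k where V: "dim_row V = m" "dim_col V = m" "V * adj V = 1\<^sub>m m" "adj V * V = 1\<^sub>m m" "length k = m"
    and BV: "B = V * diagm (map complex_of_real k) * adj V"
    and g: "\<And>f. matfun f B = V * diagm (map (\<lambda>x. complex_of_real (f x)) k) * adj V"
    by (rule matfun_spectral[OF B]) blast
  show ?thesis
    unfolding f g by (rule intertwine_spectral[OF U V M eq[unfolded AU BV]])
qed

text \<open>Independence of the chosen decomposition: the identity intertwines any two
  diagonalisations of the same matrix, so it intertwines the two versions of f as well.\<close>

lemma matfun_eqI:
  assumes U: "dim_row U = n" "dim_col U = n" "U * adj U = 1\<^sub>m n" "adj U * U = 1\<^sub>m n" "length l = n"
  shows "matfun f (U * diagm (map complex_of_real l) * adj U)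
    = U * diagm (map (\<lambda>x. complex_of_real (f x)) l) * adj U"
proof -
  let ?A = "U * diagm (map complex_of_real l) * adj U"
  have h: "hermitian n ?A"
    using U by (intro hermitianI) (auto simp: adj_mult mat_mult_assoc adj_diagm_of_real[of "\<lambda>x. x"])
  obtain V k where V: "dim_row V = n" "dim_col V = n" "V * adj V = 1\<^sub>m n" "adj V * V = 1\<^sub>m n" "length k = n"
    and AV: "?A = V * diagm (map complex_of_real k) * adj V"
    and g: "\<And>f. matfun f ?A = V * diagm (map (\<lambda>x. complex_of_real (f x)) k) * adj V"
    by (rule matfun_spectral[OF h]) blast
  have "U * diagm (map (\<lambda>x. complex_of_real (f x)) l) * adj U * 1\<^sub>m n = 
    1\<^sub>m n * (V * diagm (map (\<lambda>x. complex_of_real (f x)) k) * adj V)"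
    by (rule intertwine_spectral[OF U V]) (use AV U V in auto)
  thus ?thesis unfolding g using U V by simp
qed

text \<open>The entrywise conjugate of \<open>U\<close> diagonalises the transpose, with the same
  eigenvalue list.\<close>

lemma matfun_transpose:
  assumes "hermitian n A"
  shows "matfun f (A\<^sup>T) = (matfun f A)\<^sup>T"
proof -
  obtain U l where U: "dim_row U = n" "dim_col U = n" "U * adj U = 1\<^sub>m n" "adj U * U = 1\<^sub>m n" "length l = n"
    and AU: "A = U * diagm (map complex_of_real l) * adj U"
    and f: "\<And>f. matfun f A = U * diagm (map (\<lambda>x. complex_of_real (f x)) l) * adj U"
    by (rule matfun_spectral[OF assms]) blast
  define V where "V = (adj U)\<^sup>T"
  have aV: "adj V = U\<^sup>T" by (simp add: V_def adj_transpose)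
  have V: "dim_row V = n" "dim_col V = n" "V * adj V = 1\<^sub>m n" "adj V * V = 1\<^sub>m n"
    using U unfolding aV by (auto simp: V_def transpose_mat_mult[symmetric])
  have T: "(U * diagm (map (\<lambda>x. complex_of_real (f x)) l) * adj U)\<^sup>T
    = V * diagm (map (\<lambda>x. complex_of_real (f x)) l) * adj V" for f
  proof -
    have "(diagm (map (\<lambda>x. complex_of_real (f x)) l))\<^sup>T = diagm (map (\<lambda>x. complex_of_real (f x)) l)"
      by (intro eq_matI) auto
    thus ?thesis unfolding aV using U by (simp add: transpose_mat_mult V_def mat_mult_assoc)
  qed
  have "A\<^sup>T = V * diagm (map complex_of_real l) * adj V"
    unfolding AU using T[of "\<lambda>x. x"] by simp
  thus ?thesis unfolding f T by (simp add: matfun_eqI[OF V U(5)])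
qed

section \<open>Positive semidefinite matrices\<close>

lemma quadratic_form:
  assumes "dim_row A = n" "dim_col A = n" "v \<in> carrier_vec n"
  shows "conjugate v \<bullet> (A *\<^sub>v v) = (\<Sum>a<n. \<Sum>b<n. cnj (v $ a) * A $$ (a,b) * v $ b)"
  using assms by (auto simp: scalar_prod_def lessThan_atLeast0 sum_distrib_left mult.assoc intro!: sum.cong)

lemma quadratic_form_adj_mult:
  assumes "dim_col B = n" "v \<in> carrier_vec n"
  shows "conjugate v \<bullet> ((adj B * B) *\<^sub>v v)
    = complex_of_real (\<Sum>k<dim_row B. (cmod (\<Sum>b<n. B $$ (k,b) * v $ b))\<^sup>2)"
proof -
  have "conjugate v \<bullet> ((adj B * B) *\<^sub>v v)
    = (\<Sum>a<n. \<Sum>b<n. cnj (v $ a) * (\<Sum>k<dim_row B. cnj (B $$ (k,a)) * B $$ (k,b)) * v $ b)"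
    using assms by (subst quadratic_form) (auto simp: index_mat_mult simp del: index_mult_mat(1))
  also have "\<dots> = (\<Sum>a<n. \<Sum>b<n. \<Sum>k<dim_row B. cnj (B $$ (k,a) * v $ a) * (B $$ (k,b) * v $ b))"
    by (simp add: sum_distrib_left sum_distrib_right mult_ac)
  also have "\<dots> = (\<Sum>a<n. \<Sum>k<dim_row B. \<Sum>b<n. cnj (B $$ (k,a) * v $ a) * (B $$ (k,b) * v $ b))"
    by (intro sum.cong refl sum.swap)
  also have "\<dots> = (\<Sum>k<dim_row B. \<Sum>a<n. \<Sum>b<n. cnj (B $$ (k,a) * v $ a) * (B $$ (k,b) * v $ b))"
    by (rule sum.swap)
  also have "\<dots> = (\<Sum>k<dim_row B. cnj (\<Sum>b<n. B $$ (k,b) * v $ b) * (\<Sum>b<n. B $$ (k,b) * v $ b))"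
    by (simp add: sum_product)
  also have "\<dots> = complex_of_real (\<Sum>k<dim_row B. (cmod (\<Sum>b<n. B $$ (k,b) * v $ b))\<^sup>2)"
    by (simp add: complex_norm_square mult.commute del: of_real_power)
  finally show ?thesis .
qed

lemma psd_adj_mult: "dim_col B = n \<Longrightarrow> psd n (adj B * B)"
  unfolding psd_def
  by (auto simp: quadratic_form_adj_mult adj_mult sum_nonneg intro!: hermitianI)

lemma psd_hermitian: "psd n A \<Longrightarrow> hermitian n A"
  by (simp add: psd_def)

text \<open>The eigenvalue \<open>l ! i\<close> is the value of the quadratic form of
  \<open>A\<close> at the i-th column of \<open>U\<close>.\<close>

lemma psd_eigenvalue_nonneg:
  assumes A: "psd n A" and U: "dim_row U = n" "dim_col U = n" "adj U * U = 1\<^sub>m n" "length l = n"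
    and AU: "A = U * diagm (map complex_of_real l) * adj U" and i: "i < n"
  shows "l ! i \<ge> 0"
proof -
  note dA = hermitianD[OF psd_hermitian[OF A]]
  have "adj U * A * U = (adj U * U) * diagm (map complex_of_real l) * (adj U * U)"
    unfolding AU using U(1,2,4) by (simp add: mat_mult_assoc)
  hence "adj U * A * U = diagm (map complex_of_real l)"
    using U by simp
  hence "complex_of_real (l ! i) = (adj U * (A * U)) $$ (i,i)"
    using i U dA by (simp add: mat_mult_assoc)
  also have "\<dots> = (\<Sum>a<n. \<Sum>b<n. cnj (U $$ (a,i)) * A $$ (a,b) * U $$ (b,i))"
    using i U dA by (simp add: index_mat_mult sum_distrib_left mult.assoc del: index_mult_mat(1))
  also have "\<dots> = conjugate (col U i) \<bullet> (A *\<^sub>v col U i)"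
    using i U dA by (subst quadratic_form) (auto intro!: sum.cong)
  finally have "complex_of_real (l ! i) = conjugate (col U i) \<bullet> (A *\<^sub>v col U i)" .
  moreover have "col U i \<in> carrier_vec n" using U by (intro carrier_vecI) simp
  hence "Re (conjugate (col U i) \<bullet> (A *\<^sub>v col U i)) \<ge> 0"
    using A unfolding psd_def by blast
  ultimately show ?thesis by (metis Re_complex_of_real)
qed

text \<open>Allows scalar identities that hold only for non-negative arguments, such as sqrt x *
  sqrt x = x; for negative x the left side is |x|.\<close>

lemma matfun_cong_psd:
  assumes A: "psd n A" and fg: "\<And>x. x \<ge> 0 \<Longrightarrow> f x = g x"
  shows "matfun f A = matfun g A"
proof -
  obtain U l where U: "dim_row U = n" "dim_col U = n" "adj U * U = 1\<^sub>m n" "length l = n"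
    and AU: "A = U * diagm (map complex_of_real l) * adj U"
    and f: "\<And>f. matfun f A = U * diagm (map (\<lambda>x. complex_of_real (f x)) l) * adj U"
    by (rule matfun_spectral[OF psd_hermitian[OF A]]) blast
  have "f (l ! i) = g (l ! i)" if "i < n" for i
    using psd_eigenvalue_nonneg[OF A U AU that] fg by blast
  hence "map (\<lambda>x. complex_of_real (f x)) l = map (\<lambda>x. complex_of_real (g x)) l"
    using U by (intro nth_equalityI) auto
  thus ?thesis unfolding f by (simp only:)
qed

lemma sqrtm_hermitian: "psd n A \<Longrightarrow> hermitian n (sqrtm A)"
  unfolding sqrtm_def by (intro matfun_hermitian psd_hermitian)

lemma sqrtm_mult_self: "psd n A \<Longrightarrow> sqrtm A * sqrtm A = A"
  unfolding sqrtm_def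
  using matfun_mult[of n A sqrt sqrt] matfun_cong_psd[of n A "\<lambda>x. sqrt x * sqrt x" "\<lambda>x. x"] matfun_id[of n A]
  by (simp add: psd_hermitian)

lemma psd_factor:
  assumes "psd n A"
  obtains B where "dim_row B = n" "dim_col B = n" "A = adj B * B"
  using that[of "sqrtm A"] sqrtm_mult_self[OF assms] hermitianD[OF sqrtm_hermitian[OF assms]] by auto

lemma psd_matfun:
  assumes A: "hermitian n A" and f: "\<And>x. f x \<ge> 0"
  shows "psd n (matfun f A)"
proof -
  have "matfun f A = adj (matfun (\<lambda>x. sqrt (f x)) A) * matfun (\<lambda>x. sqrt (f x)) A"
    using A f by (simp add: matfun_mult)
  thus ?thesis using psd_adj_mult[of "matfun (\<lambda>x. sqrt (f x)) A" n] A by simp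
qed

lemma psd_transpose:
  assumes "psd n A"
  shows "psd n (A\<^sup>T)"
proof -
  obtain B where B: "dim_row B = n" "dim_col B = n" "A = adj B * B"
    using psd_factor[OF assms] .
  have "A\<^sup>T = adj ((adj B)\<^sup>T) * (adj B)\<^sup>T"
    using B by (simp add: transpose_mat_mult adj_transpose)
  thus ?thesis using psd_adj_mult[of "(adj B)\<^sup>T" n] B by simp
qed

lemma psd_add:
  assumes "psd n A" "psd n B"
  shows "psd n (A + B)"
proof -
  note A = hermitianD[OF psd_hermitian[OF assms(1)]] and B = hermitianD[OF psd_hermitian[OF assms(2)]]
  have "adj (A + B) = adj A + adj B" using A(1,2) B(1,2) by (intro eq_matI) auto
  hence "hermitian n (A + B)" using A B by (intro hermitianI) auto
  moreover have "conjugate v \<bullet> ((A + B) *\<^sub>v v) = conjugate v \<bullet> (A *\<^sub>v v) + conjugate v \<bullet> (B *\<^sub>v v)"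
    if "v \<in> carrier_vec n" for v
    using that A B by (simp add: quadratic_form distrib_left distrib_right sum.distrib)
  ultimately show ?thesis using assms by (auto simp: psd_def)
qed

section \<open>Hilbert-Schmidt norm and Cauchy-Schwarz\<close>

lemma mtrace_adj_mult:
  "mtrace (adj A * A) = complex_of_real (\<Sum>i<dim_col A. \<Sum>k<dim_row A. (cmod (A $$ (k,i)))\<^sup>2)"
  by (simp add: mtrace_mult complex_norm_square mult.commute del: of_real_power)

lemma mtrace_adj_mult_nonneg: "Re (mtrace (adj A * A)) \<ge> 0"
  unfolding mtrace_adj_mult by (simp add: sum_nonneg)

lemma adj_mult_trace_zero:
  assumes "mtrace (adj A * A) = 0"
  shows "A = 0\<^sub>m (dim_row A) (dim_col A)"
proof -
  have "(\<Sum>i<dim_col A. \<Sum>k<dim_row A. (cmod (A $$ (k,i)))\<^sup>2) = 0"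
    using assms unfolding mtrace_adj_mult by (simp only: of_real_eq_0_iff)
  hence "\<forall>i\<in>{..<dim_col A}. \<forall>k\<in>{..<dim_row A}. (cmod (A $$ (k,i)))\<^sup>2 = 0"
    by (simp add: sum_nonneg_eq_0_iff sum_nonneg)
  thus ?thesis by (intro eq_matI) auto
qed

text \<open>Factoring both matrices and cycling the trace turns it into the squared Hilbert-Schmidt
  norm of \<open>T * adj S\<close>.\<close>

lemma mtrace_psd_mult_nonneg:
  assumes "psd n A" "psd n B"
  shows "Re (mtrace (A * B)) \<ge> 0"
proof -
  obtain S where S: "dim_row S = n" "dim_col S = n" "A = adj S * S" using psd_factor[OF assms(1)] .
  obtain T where T: "dim_row T = n" "dim_col T = n" "B = adj T * T" using psd_factor[OF assms(2)] .
  have "mtrace (A * B) = mtrace (adj S * (S * adj T * T))"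
    using S T by (simp add: mat_mult_assoc)
  also have "\<dots> = mtrace ((S * adj T * T) * adj S)"
    using S T by (intro mtrace_mult_comm) auto
  also have "\<dots> = mtrace (adj (T * adj S) * (T * adj S))"
    using S T by (simp add: mat_mult_assoc adj_mult)
  finally show ?thesis using mtrace_adj_mult_nonneg by metis
qed

lemma cauchy_schwarz_sum:
  fixes f g :: "'a \<Rightarrow> real"
  shows "(\<Sum>i\<in>I. f i * g i)\<^sup>2 \<le> (\<Sum>i\<in>I. (f i)\<^sup>2) * (\<Sum>i\<in>I. (g i)\<^sup>2)"
proof (cases "finite I")
  case True
  define a b c where "a = (\<Sum>i\<in>I. (f i)\<^sup>2)" and "b = (\<Sum>i\<in>I. (g i)\<^sup>2)" and "c = (\<Sum>i\<in>I. f i * g i)"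
  have a: "a \<ge> 0" by (simp add: a_def sum_nonneg)
  \<comment> \<open>The vector a g - c f is a times the component of g orthogonal to f, so its
    squared length is a (a b - c^2).\<close>
  have "0 \<le> (\<Sum>i\<in>I. (a * g i - c * f i)\<^sup>2)"
    by (simp add: sum_nonneg)
  also have "\<dots> = (\<Sum>i\<in>I. a\<^sup>2 * (g i)\<^sup>2 - 2 * a * c * (f i * g i) + c\<^sup>2 * (f i)\<^sup>2)"
    by (intro sum.cong) (auto simp: power2_eq_square algebra_simps)
  also have "\<dots> = a\<^sup>2 * b - 2 * a * c * c + c\<^sup>2 * a"
    unfolding sum.distrib sum_subtractf sum_distrib_left[symmetric] a_def b_def c_def ..
  also have "\<dots> = a * (a * b - c\<^sup>2)"
    by (simp add: power2_eq_square algebra_simps)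
  finally have *: "0 \<le> a * (a * b - c\<^sup>2)" .
  have "c\<^sup>2 \<le> a * b"
  proof (cases "a = 0")
    case True
    hence "\<forall>i\<in>I. f i = 0" using \<open>finite I\<close> by (simp add: a_def sum_nonneg_eq_0_iff)
    hence "c = 0" by (simp add: c_def)
    thus ?thesis using True by simp
  next
    case False
    thus ?thesis using * a by (simp add: zero_le_mult_iff)
  qed
  thus ?thesis by (simp add: a_def b_def c_def)
qed simp

lemma mtrace_cauchy_schwarz:
  assumes "dim_row A = dim_row B" "dim_col A = dim_col B"
  shows "(Re (mtrace (adj A * B)))\<^sup>2 \<le> Re (mtrace (adj A * A)) * Re (mtrace (adj B * B))"
proof -
  let ?I = "{..<dim_col B} \<times> {..<dim_row B}"
  have tr: "mtrace (adj A * B) = (\<Sum>(i,k)\<in>?I. cnj (A $$ (k,i)) * B $$ (k,i))"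
    using assms by (simp add: mtrace_mult sum.cartesian_product)
  have "cmod (mtrace (adj A * B)) \<le> (\<Sum>(i,k)\<in>?I. cmod (A $$ (k,i)) * cmod (B $$ (k,i)))"
    unfolding tr by (rule sum_norm_le) (auto simp: norm_mult)
  hence "\<bar>Re (mtrace (adj A * B))\<bar> \<le> (\<Sum>(i,k)\<in>?I. cmod (A $$ (k,i)) * cmod (B $$ (k,i)))"
    using abs_Re_le_cmod order_trans by blast
  hence "(Re (mtrace (adj A * B)))\<^sup>2 \<le> (\<Sum>(i,k)\<in>?I. cmod (A $$ (k,i)) * cmod (B $$ (k,i)))\<^sup>2"
    using abs_le_square_iff by fastforce
  also have "\<dots> \<le> (\<Sum>(i,k)\<in>?I. (cmod (A $$ (k,i)))\<^sup>2) * (\<Sum>(i,k)\<in>?I. (cmod (B $$ (k,i)))\<^sup>2)"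
    using cauchy_schwarz_sum[of "\<lambda>(i,k). cmod (A $$ (k,i))" "\<lambda>(i,k). cmod (B $$ (k,i))" ?I]
    by (simp add: case_prod_unfold)
  also have "\<dots> = Re (mtrace (adj A * A)) * Re (mtrace (adj B * B))"
    unfolding mtrace_adj_mult using assms by (simp add: sum.cartesian_product)
  finally show ?thesis .
qed

section \<open>Klein's inequality, entropy and fidelity\<close>

text \<open>The weights \<open>w i k\<close> are the squared overlaps between the eigenvectors of
  \<open>A\<close> and those of \<open>B\<close>. Since \<open>p\<close>, \<open>q\<close> and
  \<open>w\<close> do not depend on f and g, trace inequalities between functions of two
  non-commuting matrices reduce to scalar inequalities tested against one non-negative
  kernel.\<close>

lemma mtrace_matfun_mult:
  assumes A: "hermitian n A" and B: "hermitian n B"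
  obtains p q :: "nat \<Rightarrow> real" and w :: "nat \<Rightarrow> nat \<Rightarrow> real"
  where "\<And>i k. w i k \<ge> 0"
    and "\<And>f g. mtrace (matfun f A * matfun g B) = complex_of_real (\<Sum>i<n. \<Sum>k<n. f (p i) * g (q k) * w i k)"
    and "\<And>i. psd n A \<Longrightarrow> i < n \<Longrightarrow> p i \<ge> 0" and "\<And>k. psd n B \<Longrightarrow> k < n \<Longrightarrow> q k \<ge> 0"
proof -
  obtain U l where U: "dim_row U = n" "dim_col U = n" "U * adj U = 1\<^sub>m n" "adj U * U = 1\<^sub>m n" "length l = n"
    and AU: "A = U * diagm (map complex_of_real l) * adj U"
    and f: "\<And>f. matfun f A = U * diagm (map (\<lambda>x. complex_of_real (f x)) l) * adj U"
    by (rule matfun_spectral[OF A]) blast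
  obtain V k where V: "dim_row V = n" "dim_col V = n" "V * adj V = 1\<^sub>m n" "adj V * V = 1\<^sub>m n" "length k = n"
    and BV: "B = V * diagm (map complex_of_real k) * adj V"
    and g: "\<And>f. matfun f B = V * diagm (map (\<lambda>x. complex_of_real (f x)) k) * adj V"
    by (rule matfun_spectral[OF B]) blast
  define G where "G = adj U * V"
  have dG: "dim_row G = n" "dim_col G = n" by (auto simp: G_def U V)
  let ?L = "\<lambda>f. diagm (map (\<lambda>x. complex_of_real (f x)) l)"
  let ?K = "\<lambda>f. diagm (map (\<lambda>x. complex_of_real (f x)) k)"
  have tr: "mtrace (matfun f A * matfun g B)
    = complex_of_real (\<Sum>i<n. \<Sum>j<n. f (l ! i) * g (k ! j) * (cmod (G $$ (i,j)))\<^sup>2)" for f g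
  proof -
    have "mtrace (matfun f A * matfun g B) = mtrace (U * (?L f * (adj U * V) * (?K g * adj V)))"
      unfolding f g using U(1,2,5) V(1,2,5) by (simp add: mat_mult_assoc)
    also have "\<dots> = mtrace ((?L f * (adj U * V) * (?K g * adj V)) * U)"
      using U(1,2,5) V(1,2,5) by (intro mtrace_mult_comm) auto
    also have "\<dots> = mtrace ((?L f * G) * (?K g * adj G))"
      using U(1,2,5) V(1,2,5) by (simp add: mat_mult_assoc G_def adj_mult)
    also have "\<dots> = (\<Sum>i<n. \<Sum>j<n. complex_of_real (f (l ! i)) * G $$ (i,j) * (complex_of_real (g (k ! j)) * cnj (G $$ (i,j))))"
      using U(1,2,5) V(1,2,5) dG
      by (subst mtrace_mult) (auto simp: index_diagm_mult intro!: sum.cong simp del: index_mult_mat(1))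
    also have "\<dots> = complex_of_real (\<Sum>i<n. \<Sum>j<n. f (l ! i) * g (k ! j) * (cmod (G $$ (i,j)))\<^sup>2)"
      by (simp add: complex_norm_square mult_ac del: of_real_power)
    finally show ?thesis .
  qed
  show ?thesis
    by (rule that[of "\<lambda>i j. (cmod (G $$ (i,j)))\<^sup>2" "\<lambda>i. l ! i" "\<lambda>j. k ! j"])
      (use tr psd_eigenvalue_nonneg[OF _ U(1,2,4,5) AU] psd_eigenvalue_nonneg[OF _ V(1,2,4,5) BV] in auto)
qed

lemma supp_le_mult_zero:
  assumes "supp_le A B" and dims: "dim_row A = n" "dim_col A = n" "dim_row B = n" "dim_col B = n" "dim_row M = n"
    and BM: "B * M = 0\<^sub>m n (dim_col M)"
  shows "A * M = 0\<^sub>m n (dim_col M)"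
proof (rule mat_col_eqI)
  fix j assume "j < dim_col (0\<^sub>m n (dim_col M) :: complex mat)"
  hence j: "j < dim_col M" by simp
  have cm: "col (C * M) j = C *\<^sub>v col M j" if "dim_row C = n" "dim_col C = n" for C :: "complex mat"
    using that j dims by (intro col_mult2[of _ n n _ "dim_col M"]) auto
  have "B *\<^sub>v col M j = 0\<^sub>v n"
    using cm[of B] dims j unfolding BM by simp
  moreover have "col M j \<in> carrier_vec n" using dims by (intro carrier_vecI) simp
  ultimately have "A *\<^sub>v col M j = 0\<^sub>v n"
    using assms(1) unfolding supp_le_def dims by blast
  thus "col (A * M) j = col (0\<^sub>m n (dim_col M)) j"
    using cm[of A] dims j by simp
qed (use dims in auto)

text \<open>The scalar form of Klein's inequality, from ln t \<le> t - 1 at t = q / p. At p = 0 both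
  logarithmic terms vanish and the claim is just q \<ge> 0.\<close>

lemma log_ratio_ge:
  fixes p q :: real
  assumes "p \<ge> 0" "q > 0"
  shows "p * log 2 p - p * log 2 q \<ge> (p - q) / ln 2"
proof -
  have "p * ln p - p * ln q \<ge> p - q"
  proof (cases "p = 0")
    case False
    hence p: "p > 0" using assms by simp
    have "ln (q / p) \<le> q / p - 1" using p assms by (intro ln_le_minus_one) auto
    hence "p * ln (q / p) \<le> p * (q / p - 1)" using p by (intro mult_left_mono) auto
    thus ?thesis using p assms by (simp add: ln_div right_diff_distrib)
  qed (use assms in auto)
  hence "(p - q) / ln 2 \<le> (p * ln p - p * ln q) / ln 2"
    by (intro divide_right_mono) auto
  thus ?thesis by (simp add: log_def diff_divide_distrib)
qed

text \<open>Summing the scalar bound against the eigenvector overlaps leaves (Tr A - Tr B) / ln 2 =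
  0 as lower bound for the difference. The scalar bound requires q > 0; the support hypothesis takes
  care of the zero eigenvalues of \<open>B\<close>.\<close>

theorem klein_inequality:
  assumes A: "psd n A" and B: "psd n B" and tr: "mtrace A = mtrace B" and supp: "supp_le A B"
  shows "Re (mtrace (A * log2m B)) \<le> Re (mtrace (A * log2m A))"
proof -
  note hA = psd_hermitian[OF A] and hB = psd_hermitian[OF B]
  note dA = hermitianD[OF hA] and dB = hermitianD[OF hB]
  obtain p q w where w: "\<And>i k. w i k \<ge> (0::real)"
    and T: "\<And>f g. mtrace (matfun f A * matfun g B) = complex_of_real (\<Sum>i<n. \<Sum>k<n. f (p i) * g (q k) * w i k)"
    and p: "\<And>i. i < n \<Longrightarrow> p i \<ge> 0" and q: "\<And>k. k < n \<Longrightarrow> q k \<ge> 0"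
    by (rule mtrace_matfun_mult[OF hA hB]) (use A B in blast)
  have trA: "Re (mtrace A) = (\<Sum>i<n. \<Sum>k<n. p i * w i k)"
    using T[of "\<lambda>x. x" "\<lambda>x. 1"] dA by (simp add: matfun_id[OF hA] matfun_one[OF hB])
  have trB: "Re (mtrace B) = (\<Sum>i<n. \<Sum>k<n. q k * w i k)"
    using T[of "\<lambda>x. 1" "\<lambda>x. x"] dB by (simp add: matfun_id[OF hB] matfun_one[OF hA])
  have "A * log2m A = matfun (\<lambda>x. x * log 2 x) A"
    using matfun_mult[OF hA, of "\<lambda>x. x" "log 2"] by (simp add: log2m_def matfun_id[OF hA])
  hence eA: "Re (mtrace (A * log2m A)) = (\<Sum>i<n. \<Sum>k<n. p i * log 2 (p i) * w i k)"
    using T[of "\<lambda>x. x * log 2 x" "\<lambda>x. 1"] hA by (simp add: matfun_one[OF hB])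
  have eB: "Re (mtrace (A * log2m B)) = (\<Sum>i<n. \<Sum>k<n. p i * log 2 (q k) * w i k)"
    using T[of "\<lambda>x. x" "log 2"] by (simp add: matfun_id[OF hA] log2m_def)
  \<comment> \<open>\<open>matfun ?z B\<close> is the projector onto the kernel of \<open>B\<close>.
    Support inclusion makes \<open>A\<close> annihilate it, and the trace formula then gives p_i
    w_ik = 0 whenever q_k = 0. The terms in which log 2 0 occurs therefore vanish.\<close>
  let ?z = "\<lambda>x::real. if x = 0 then 1 else 0::real"
  have "B * matfun ?z B = matfun (\<lambda>x. 0) B"
    using matfun_mult[OF hB, of "\<lambda>x. x" ?z] by (simp add: matfun_id[OF hB] if_distrib cong: if_cong)
  also have "\<dots> = B - B"
    using matfun_minus[OF hB, of "\<lambda>x. x" "\<lambda>x. x"] by (simp add: matfun_id[OF hB])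
  also have "\<dots> = 0\<^sub>m n n"
    using dB(1,2) by (intro eq_matI) auto
  finally have "A * matfun ?z B = 0\<^sub>m n n"
    using supp_le_mult_zero[OF supp dA(1,2) dB(1,2), of "matfun ?z B"] hB by simp
  hence "mtrace (matfun (\<lambda>x. x) A * matfun ?z B) = 0"
    by (simp add: matfun_id[OF hA] mtrace_def)
  hence "(\<Sum>i<n. \<Sum>k<n. p i * ?z (q k) * w i k) = 0"
    unfolding T by (simp only: of_real_eq_0_iff)
  hence z: "\<forall>i\<in>{..<n}. \<forall>k\<in>{..<n}. p i * ?z (q k) * w i k = 0"
    using p w by (subst (asm) sum_nonneg_eq_0_iff) (auto intro!: sum_nonneg simp: sum_nonneg_eq_0_iff)
  have "(p i - q k) / ln 2 * w i k \<le> (p i * log 2 (p i) - p i * log 2 (q k)) * w i k"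
    if ik: "i < n" "k < n" for i k
  proof (cases "q k = 0")
    case True
    moreover have "p i * ?z (q k) * w i k = 0" using z ik by blast
    ultimately have "p i * w i k = 0" by simp
    thus ?thesis using True by auto
  next
    case False
    hence "q k > 0" using q ik by (simp add: order_less_le)
    thus ?thesis using log_ratio_ge[OF p[OF ik(1)]] w by (intro mult_right_mono) auto
  qed
  hence "(\<Sum>i<n. \<Sum>k<n. (p i - q k) / ln 2 * w i k)
      \<le> (\<Sum>i<n. \<Sum>k<n. (p i * log 2 (p i) - p i * log 2 (q k)) * w i k)"
    by (intro sum_mono) auto
  also have "\<dots> = Re (mtrace (A * log2m A)) - Re (mtrace (A * log2m B))"
    unfolding eA eB by (simp add: sum_subtractf left_diff_distrib)
  also have "(\<Sum>i<n. \<Sum>k<n. (p i - q k) / ln 2 * w i k)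
      = ((\<Sum>i<n. \<Sum>k<n. p i * w i k) - (\<Sum>i<n. \<Sum>k<n. q k * w i k)) / ln 2"
    by (simp add: sum_subtractf[symmetric] left_diff_distrib sum_divide_distrib)
  also have "\<dots> = 0" using trA trB tr by simp
  finally show ?thesis by simp
qed

section \<open>Passing between the two Gram matrices of a factor\<close>

lemma psd_mult_adj: "dim_row Y = n \<Longrightarrow> psd n (Y * adj Y)"
  using psd_adj_mult[of "adj Y" n] by simp

lemma matfun_mult_adj_swap:
  "matfun f (Y * adj Y) * Y = Y * matfun f (adj Y * Y)"
  by (rule matfun_intertwine[OF psd_hermitian[OF psd_mult_adj] psd_hermitian[OF psd_adj_mult]])
    (auto simp: mat_mult_assoc)

text \<open>The two matrices share their non-zero spectrum but differ in the multiplicity of the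
  eigenvalue 0. The leading factor suppresses f(0), which is why the traces agree for every
  f.\<close>

lemma mtrace_matfun_swap:
  "mtrace (adj Y * Y * matfun f (adj Y * Y)) = mtrace (Y * adj Y * matfun f (Y * adj Y))"
proof -
  have h: "hermitian (dim_row Y) (Y * adj Y)" "hermitian (dim_col Y) (adj Y * Y)"
    using psd_mult_adj[OF refl, of Y] psd_adj_mult[OF refl, of Y] by (auto intro: psd_hermitian)
  have "mtrace (adj Y * Y * matfun f (adj Y * Y)) = mtrace (adj Y * (matfun f (Y * adj Y) * Y))"
    using h by (simp add: mat_mult_assoc matfun_mult_adj_swap)
  also have "\<dots> = mtrace (matfun f (Y * adj Y) * Y * adj Y)"
    using h by (intro mtrace_mult_comm) auto
  also have "\<dots> = mtrace (matfun f (Y * adj Y) * (Y * adj Y))"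
    using h by (simp add: mat_mult_assoc)
  also have "\<dots> = mtrace (Y * adj Y * matfun f (Y * adj Y))"
    using h by (intro mtrace_mult_comm) auto
  finally show ?thesis .
qed

lemma vN_entropy_swap: "vN_entropy (adj Y * Y) = vN_entropy (Y * adj Y)"
  unfolding vN_entropy_def log2m_def mtrace_matfun_swap ..

lemma vN_entropy_transpose:
  assumes "hermitian n A"
  shows "vN_entropy (A\<^sup>T) = vN_entropy A"
proof -
  note A = hermitianD[OF assms] and L = matfun_dim[OF assms]
  have "mtrace (A\<^sup>T * log2m (A\<^sup>T)) = mtrace ((log2m A * A)\<^sup>T)"
    using A L by (simp add: log2m_def matfun_transpose[OF assms] transpose_mat_mult)
  also have "\<dots> = mtrace (log2m A * A)"
    using A L by (intro mtrace_transpose) (auto simp: log2m_def)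
  also have "\<dots> = mtrace (A * log2m A)"
    using A L by (intro mtrace_mult_comm) (auto simp: log2m_def)
  finally show ?thesis by (simp add: vN_entropy_def)
qed

text \<open>Puts the square root into the form with a leading factor that
  \<open>mtrace_matfun_swap\<close> accepts. At x = 0 both sides are 0 because 1 / sqrt 0 is
  0.\<close>

lemma sqrtm_eq_mult:
  assumes "psd n A"
  shows "sqrtm A = A * matfun (\<lambda>x. 1 / sqrt x) A"
proof -
  have h: "hermitian n A" using assms by (rule psd_hermitian)
  have "A * matfun (\<lambda>x. 1 / sqrt x) A = matfun (\<lambda>x. x * (1 / sqrt x)) A"
    using matfun_mult[OF h, of "\<lambda>x. x" "\<lambda>x. 1 / sqrt x"] by (simp add: matfun_id[OF h])
  also have "\<dots> = sqrtm A"
    unfolding sqrtm_def by (rule matfun_cong_psd[OF assms]) (simp add: real_div_sqrt)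
  finally show ?thesis by simp
qed

lemma mtrace_sqrtm_swap: "mtrace (sqrtm (adj C * C)) = mtrace (sqrtm (C * adj C))"
  unfolding sqrtm_eq_mult[OF psd_adj_mult[OF refl]] sqrtm_eq_mult[OF psd_mult_adj[OF refl]]
  by (rule mtrace_matfun_swap)

text \<open>With S the square root of \<open>X * adj X\<close>, the operator inside the fidelity is
  one Gram matrix of \<open>adj Y * S\<close>. In the other one S occurs only as
  \<open>S * S\<close>, so the root disappears. \<open>X\<close> and \<open>Y\<close> may have
  different numbers of columns, and any factors of the two states will do.\<close>

lemma fidelity_factor:
  assumes "dim_row X = n" "dim_row Y = n"
  shows "fidelity (X * adj X) (Y * adj Y) = (Re (mtrace (sqrtm (adj (adj X * Y) * (adj X * Y)))))\<^sup>2"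
proof -
  define S where "S = sqrtm (X * adj X)"
  have SS: "S * S = X * adj X"
    unfolding S_def by (rule sqrtm_mult_self[OF psd_mult_adj[OF assms(1)]])
  have S: "dim_row S = n" "dim_col S = n" "adj S = S"
    using hermitianD[OF sqrtm_hermitian[OF psd_mult_adj[OF assms(1)]]] by (auto simp: S_def)
  have "S * (Y * adj Y) * S = adj (adj Y * S) * (adj Y * S)"
    using S assms by (simp add: adj_mult mat_mult_assoc)
  moreover have "(adj Y * S) * adj (adj Y * S) = adj Y * (S * S) * Y"
    using S assms by (simp add: adj_mult mat_mult_assoc)
  moreover have "\<dots> = adj (adj X * Y) * (adj X * Y)"
    unfolding SS using assms by (simp add: adj_mult mat_mult_assoc)
  ultimately show ?thesis
    unfolding fidelity_def S_def[symmetric] using mtrace_sqrtm_swap[of "adj Y * S"] by simp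
qed

text \<open>\<open>K\<close> is the adjoint of the partial isometry in the polar decomposition of
  \<open>C\<close>, written as a function of \<open>adj C * C\<close> times \<open>adj C\<close>. It
  is only a contraction when \<open>C\<close> has a kernel, so the conclusion is positivity of 1 -
  K* K rather than unitarity.\<close>

lemma trace_norm_attained:
  obtains K where "dim_row K = dim_col C" "dim_col K = dim_row C"
    "mtrace (K * C) = mtrace (sqrtm (adj C * C))" "psd (dim_row C) (1\<^sub>m (dim_row C) - adj K * K)"
proof -
  let ?g = "\<lambda>x::real. 1 / sqrt x"
  have h: "hermitian (dim_row C) (C * adj C)" "hermitian (dim_col C) (adj C * C)"
    using psd_mult_adj[OF refl, of C] psd_adj_mult[OF refl, of C] by (auto intro: psd_hermitian)
  define K where "K = matfun ?g (adj C * C) * adj C"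
  have dK: "dim_row K = dim_col C" "dim_col K = dim_row C" using h by (auto simp: K_def)
  have "mtrace (K * C) = mtrace (matfun ?g (adj C * C) * (adj C * C))"
    using h by (simp add: K_def mat_mult_assoc)
  also have "\<dots> = mtrace ((adj C * C) * matfun ?g (adj C * C))"
    using h by (intro mtrace_mult_comm) auto
  finally have tr: "mtrace (K * C) = mtrace (sqrtm (adj C * C))"
    by (simp add: sqrtm_eq_mult[OF psd_adj_mult[OF refl]])
  have "adj K * K = C * (matfun ?g (adj C * C) * matfun ?g (adj C * C)) * adj C"
    using h by (simp add: K_def adj_mult mat_mult_assoc)
  also have "\<dots> = C * matfun (\<lambda>x. ?g x * ?g x) (adj C * C) * adj C"
    using h by (simp add: matfun_mult)
  also have "\<dots> = matfun (\<lambda>x. ?g x * ?g x) (C * adj C) * C * adj C"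
    by (simp add: matfun_mult_adj_swap)
  also have "\<dots> = matfun (\<lambda>x. ?g x * ?g x) (C * adj C) * matfun (\<lambda>x. x) (C * adj C)"
    using h by (simp add: matfun_id mat_mult_assoc)
  also have "\<dots> = matfun (\<lambda>x. ?g x * ?g x * x) (C * adj C)"
    using h by (simp add: matfun_mult)
  finally have "1\<^sub>m (dim_row C) - adj K * K = matfun (\<lambda>x. 1 - ?g x * ?g x * x) (C * adj C)"
    using matfun_minus[OF h(1), of "\<lambda>x. 1"] by (simp add: matfun_one[OF h(1)])
  \<comment> \<open>\<open>psd_matfun\<close> asks for non-negativity on the whole real line: the
    function is 0 for x > 0, 1 at x = 0, and 2 for x < 0, where sqrt x * sqrt x = |x|.\<close>
  moreover have "psd (dim_row C) (matfun (\<lambda>x. 1 - ?g x * ?g x * x) (C * adj C))"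
    by (rule psd_matfun[OF h(1)]) (simp add: real_sqrt_mult[symmetric] field_simps split: abs_split)
  ultimately show ?thesis using that[OF dK tr] by simp
qed

text \<open>The trace is evaluated in an eigenbasis of \<open>adj C * C\<close>. There the i-th
  column of \<open>K * C * U\<close> has squared norm \<open>l ! i\<close>, so Cauchy-Schwarz
  against the unit columns of \<open>U\<close> bounds the trace by the sum of the roots of the
  eigenvalues.\<close>

lemma trace_norm_ge_isometry:
  assumes K: "dim_row K = dim_col C" "dim_col K = dim_row C" "adj K * K = 1\<^sub>m (dim_row C)"
  shows "Re (mtrace (K * C)) \<le> Re (mtrace (sqrtm (adj C * C)))"
proof -
  define n where "n = dim_col C"
  have h: "hermitian n (adj C * C)"
    unfolding n_def by (rule psd_hermitian[OF psd_adj_mult[OF refl]])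
  obtain U l where U: "dim_row U = n" "dim_col U = n" "U * adj U = 1\<^sub>m n" "adj U * U = 1\<^sub>m n" "length l = n"
    and AU: "adj C * C = U * diagm (map complex_of_real l) * adj U"
    and f: "\<And>f. matfun f (adj C * C) = U * diagm (map (\<lambda>x. complex_of_real (f x)) l) * adj U"
    by (rule matfun_spectral[OF h]) blast
  define R where "R = K * C * U"
  have R: "dim_row R = n" "dim_col R = n" by (auto simp: R_def K U n_def)
  have "adj R * R = adj U * (adj C * (adj K * K) * C) * U"
    using K(1,2) U(1,2) by (simp add: R_def adj_mult mat_mult_assoc n_def)
  also have "\<dots> = adj U * (adj C * C) * U"
    unfolding K(3) by simp
  also have "\<dots> = (adj U * U) * diagm (map complex_of_real l) * (adj U * U)"
    unfolding AU using U(1,2,5) by (simp add: mat_mult_assoc)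
  also have "\<dots> = diagm (map complex_of_real l)" using U by simp
  finally have RR: "adj R * R = diagm (map complex_of_real l)" .
  have col: "(\<Sum>k<n. (cmod (M $$ (k,i)))\<^sup>2) = Re ((adj M * M) $$ (i,i))"
    if "dim_row M = n" "dim_col M = n" "i < n" for M i
  proof -
    have "(adj M * M) $$ (i,i) = complex_of_real (\<Sum>k<n. (cmod (M $$ (k,i)))\<^sup>2)"
      using that by (simp add: index_mat_mult complex_norm_square mult.commute del: index_mult_mat(1) of_real_power)
    thus ?thesis by simp
  qed
  have "mtrace (K * C) = mtrace (K * C * (U * adj U))"
    using K U by (simp add: n_def)
  also have "\<dots> = mtrace (R * adj U)"
    using K U(1,2) by (simp add: R_def mat_mult_assoc n_def)
  also have "\<dots> = mtrace (adj U * R)"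
    using R U by (intro mtrace_mult_comm) auto
  also have "Re \<dots> = (\<Sum>i<n. Re (\<Sum>k<n. cnj (U $$ (k,i)) * R $$ (k,i)))"
    using R U by (simp add: mtrace_mult)
  also have "\<dots> \<le> (\<Sum>i<n. sqrt (l ! i))"
  proof (rule sum_mono)
    fix i assume "i \<in> {..<n}"
    hence i: "i < n" by simp
    have "(\<Sum>k<n. cmod (U $$ (k,i)) * cmod (R $$ (k,i)))\<^sup>2
        \<le> (\<Sum>k<n. (cmod (U $$ (k,i)))\<^sup>2) * (\<Sum>k<n. (cmod (R $$ (k,i)))\<^sup>2)"
      by (rule cauchy_schwarz_sum)
    also have "\<dots> = l ! i"
      using i U by (simp add: col R RR del: index_mult_mat(1))
    finally have "(\<Sum>k<n. cmod (U $$ (k,i)) * cmod (R $$ (k,i))) \<le> sqrt (l ! i)"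
      by (rule real_le_rsqrt)
    moreover have "Re (\<Sum>k<n. cnj (U $$ (k,i)) * R $$ (k,i)) \<le> cmod (\<Sum>k<n. cnj (U $$ (k,i)) * R $$ (k,i))"
      by (rule complex_Re_le_cmod)
    moreover have "\<dots> \<le> (\<Sum>k<n. cmod (U $$ (k,i)) * cmod (R $$ (k,i)))"
      by (rule sum_norm_le) (simp add: norm_mult)
    ultimately show "Re (\<Sum>k<n. cnj (U $$ (k,i)) * R $$ (k,i)) \<le> sqrt (l ! i)" by linarith
  qed
  also have "\<dots> = Re (mtrace (sqrtm (adj C * C)))"
  proof -
    let ?D = "diagm (map (\<lambda>x. complex_of_real (sqrt x)) l)"
    have "mtrace (sqrtm (adj C * C)) = mtrace (adj U * (U * ?D))"
      unfolding sqrtm_def f using U(1,2,5) by (intro mtrace_mult_comm) auto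
    also have "\<dots> = mtrace (adj U * U * ?D)"
      using U(1,2,5) by (simp add: mat_mult_assoc)
    also have "\<dots> = mtrace ?D" using U by simp
    finally show ?thesis using U by (simp add: mtrace_def)
  qed
  finally show ?thesis .
qed

section \<open>Pinching by a projective measurement\<close>

text \<open>Matrices of all sizes share one type without a common zero, so the dimensions are passed
  explicitly and the empty sum is the zero matrix of that size.\<close>

definition mat_sum :: "nat \<Rightarrow> nat \<Rightarrow> nat \<Rightarrow> (nat \<Rightarrow> complex mat) \<Rightarrow> complex mat" where
  "mat_sum r c N F = mat r c (\<lambda>ij. \<Sum>k<N. F k $$ ij)"

lemma dim_mat_sum [simp]: "dim_row (mat_sum r c N F) = r" "dim_col (mat_sum r c N F) = c"
  by (simp_all add: mat_sum_def)

lemma index_mat_sum [simp]: "i < r \<Longrightarrow> j < c \<Longrightarrow> mat_sum r c N F $$ (i,j) = (\<Sum>k<N. F k $$ (i,j))"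
  by (simp add: mat_sum_def)

lemma mat_sum_cong:
  "(\<And>k. k < N \<Longrightarrow> F k = G k) \<Longrightarrow> mat_sum r c N F = mat_sum r c N G"
  by (intro eq_matI) auto

lemma mult_mat_sum:
  assumes "dim_col A = r" "\<And>k. k < N \<Longrightarrow> dim_row (F k) = r" "\<And>k. k < N \<Longrightarrow> dim_col (F k) = c"
  shows "A * mat_sum r c N F = mat_sum (dim_row A) c N (\<lambda>k. A * F k)"
proof (rule eq_matI)
  fix i j assume "i < dim_row (mat_sum (dim_row A) c N (\<lambda>k. A * F k))" "j < dim_col (mat_sum (dim_row A) c N (\<lambda>k. A * F k))"
  hence ij: "i < dim_row A" "j < c" by auto
  have "(A * mat_sum r c N F) $$ (i,j) = (\<Sum>l<r. \<Sum>k<N. A $$ (i,l) * F k $$ (l,j))"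
    using ij assms by (simp add: index_mat_mult sum_distrib_left del: index_mult_mat(1))
  also have "\<dots> = (\<Sum>k<N. \<Sum>l<r. A $$ (i,l) * F k $$ (l,j))"
    by (rule sum.swap)
  also have "\<dots> = (\<Sum>k<N. (A * F k) $$ (i,j))"
    using ij assms by (intro sum.cong) (auto simp: index_mat_mult simp del: index_mult_mat(1))
  finally show "(A * mat_sum r c N F) $$ (i,j) = mat_sum (dim_row A) c N (\<lambda>k. A * F k) $$ (i,j)"
    using ij by simp
qed (use assms in auto)

lemma adj_mat_sum:
  assumes "\<And>k. k < N \<Longrightarrow> dim_row (F k) = r" "\<And>k. k < N \<Longrightarrow> dim_col (F k) = c"
  shows "adj (mat_sum r c N F) = mat_sum c r N (\<lambda>k. adj (F k))"
  using assms by (intro eq_matI) auto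

lemma mat_sum_mult:
  assumes "dim_row A = c" "\<And>k. k < N \<Longrightarrow> dim_row (F k) = r" "\<And>k. k < N \<Longrightarrow> dim_col (F k) = c"
  shows "mat_sum r c N F * A = mat_sum r (dim_col A) N (\<lambda>k. F k * A)"
proof -
  have "adj (mat_sum r c N F * A) = adj A * mat_sum c r N (\<lambda>k. adj (F k))"
    using assms by (simp add: adj_mult adj_mat_sum)
  also have "\<dots> = mat_sum (dim_col A) r N (\<lambda>k. adj A * adj (F k))"
    using assms by (subst mult_mat_sum) auto
  also have "\<dots> = mat_sum (dim_col A) r N (\<lambda>k. adj (F k * A))"
    using assms by (intro mat_sum_cong) (simp add: adj_mult)
  also have "\<dots> = adj (mat_sum r (dim_col A) N (\<lambda>k. F k * A))"
    using assms by (subst adj_mat_sum) auto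
  finally show ?thesis by (metis adj_adj)
qed

lemma mtrace_mat_sum:
  assumes "\<And>k. k < N \<Longrightarrow> dim_row (F k) = n" "\<And>k. k < N \<Longrightarrow> dim_col (F k) = n"
  shows "mtrace (mat_sum n n N F) = (\<Sum>k<N. mtrace (F k))"
proof -
  have "mtrace (mat_sum n n N F) = (\<Sum>k<N. \<Sum>i<n. F k $$ (i,i))"
    unfolding mtrace_def by (simp add: sum.swap[of _ "{..<N}"])
  thus ?thesis using assms by (simp add: mtrace_def)
qed

lemma psd_mat_sum:
  assumes "\<And>k. k < N \<Longrightarrow> psd n (F k)"
  shows "psd n (mat_sum n n N F)"
  using assms
proof (induction N)
  case 0
  have "mat_sum n n 0 F = adj (0\<^sub>m n n) * 0\<^sub>m n n"
    by (intro eq_matI) auto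
  thus ?case using psd_adj_mult[of "0\<^sub>m n n" n] by simp
next
  case (Suc N)
  have "mat_sum n n (Suc N) F = mat_sum n n N F + F N"
    using hermitianD[OF psd_hermitian[OF Suc.prems[of N]]] by (intro eq_matI) auto
  thus ?case using Suc by (simp add: psd_add)
qed

lemma mat_sum_single:
  assumes "j < N" "dim_row (F j) = r" "dim_col (F j) = c" "\<And>k. k < N \<Longrightarrow> k \<noteq> j \<Longrightarrow> F k = 0\<^sub>m r c"
  shows "mat_sum r c N F = F j"
proof (rule eq_matI)
  fix a b assume ab: "a < dim_row (F j)" "b < dim_col (F j)"
  have "(\<Sum>k<N. F k $$ (a,b)) = (\<Sum>k<N. if k = j then F j $$ (a,b) else 0)"
    using assms ab by (intro sum.cong) auto
  thus "mat_sum r c N F $$ (a,b) = F j $$ (a,b)"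
    using assms ab by simp
qed (use assms in auto)

lemma msum_eq_mat_sum: "msum n Ms = mat_sum n n (length Ms) (\<lambda>j. Ms ! j)"
  by (intro eq_matI) (auto simp: msum_def sum_list_sum_nth lessThan_atLeast0)

lemma sum_lessThan_mult:
  fixes f :: "nat \<Rightarrow> nat \<Rightarrow> 'a::comm_monoid_add"
  shows "(\<Sum>q<N * d. f (q div d) (q mod d)) = (\<Sum>j<N. \<Sum>c<d. f j c)"
proof -
  have "(\<Sum>q<N * d. f (q div d) (q mod d)) = (\<Sum>j<N. \<Sum>q\<in>{j * d..<j * d + d}. f (q div d) (q mod d))"
    by (rule sum.nat_group[symmetric])
  also have "\<dots> = (\<Sum>j<N. \<Sum>c<d. f j c)"
  proof (rule sum.cong)
    fix j
    have "(\<Sum>q\<in>{0 + j * d..<d + j * d}. f (q div d) (q mod d)) = (\<Sum>c = 0..<d. f ((c + j * d) div d) ((c + j * d) mod d))"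
      by (rule sum.shift_bounds_nat_ivl)
    also have "\<dots> = (\<Sum>c<d. f j c)"
      unfolding lessThan_atLeast0 by (intro sum.cong) auto
    finally show "(\<Sum>q\<in>{j * d..<j * d + d}. f (q div d) (q mod d)) = (\<Sum>c<d. f j c)"
      by (simp add: add.commute)
  qed simp
  finally show ?thesis .
qed

text \<open>A row of N blocks. Its column index j * d + c follows the convention for tensor
  products, so that the Gram matrix of the columns is an operator on C^N tensor C^d.\<close>

definition hcat :: "nat \<Rightarrow> nat \<Rightarrow> nat \<Rightarrow> (nat \<Rightarrow> complex mat) \<Rightarrow> complex mat" where
  "hcat r d N F = mat r (N * d) (\<lambda>(i,q). F (q div d) $$ (i, q mod d))"

lemma dim_hcat [simp]: "dim_row (hcat r d N F) = r" "dim_col (hcat r d N F) = N * d"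
  by (simp_all add: hcat_def)

lemma hcat_mult_adj_hcat:
  assumes "\<And>j. j < N \<Longrightarrow> dim_row (F j) = r \<and> dim_col (F j) = d"
    and "\<And>j. j < N \<Longrightarrow> dim_row (G j) = s \<and> dim_col (G j) = d"
  shows "hcat r d N F * adj (hcat s d N G) = mat_sum r s N (\<lambda>j. F j * adj (G j))"
proof (rule eq_matI)
  fix i k assume "i < dim_row (mat_sum r s N (\<lambda>j. F j * adj (G j)))" "k < dim_col (mat_sum r s N (\<lambda>j. F j * adj (G j)))"
  hence ik: "i < r" "k < s" by auto
  have "(hcat r d N F * adj (hcat s d N G)) $$ (i,k)
      = (\<Sum>q<N * d. F (q div d) $$ (i, q mod d) * cnj (G (q div d) $$ (k, q mod d)))"
    using ik by (simp add: index_mat_mult del: index_mult_mat(1)) (simp add: hcat_def)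
  also have "\<dots> = (\<Sum>j<N. \<Sum>c<d. F j $$ (i,c) * cnj (G j $$ (k,c)))"
    by (rule sum_lessThan_mult)
  also have "\<dots> = (\<Sum>j<N. (F j * adj (G j)) $$ (i,k))"
    using ik assms by (intro sum.cong) (auto simp: index_mat_mult simp del: index_mult_mat(1))
  finally show "(hcat r d N F * adj (hcat s d N G)) $$ (i,k) = mat_sum r s N (\<lambda>j. F j * adj (G j)) $$ (i,k)"
    using ik by simp
qed auto

lemma hs_dist_expand:
  assumes "dim_row A = n" "dim_col A = n" "dim_row B = n" "dim_col B = n"
  shows "hs_dist A B = Re (mtrace (A * A)) - 2 * Re (mtrace (A * B)) + Re (mtrace (B * B))"
proof -
  have "mtrace (B * A) = mtrace (A * B)" using assms by (intro mtrace_mult_comm) auto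
  thus ?thesis unfolding hs_dist_def
    using assms by (simp add: left_distrib_minus_mat right_distrib_minus_mat mtrace_minus)
qed

lemma hs_dist_nonneg:
  assumes "hermitian m A" "hermitian m B"
  shows "hs_dist A B \<ge> 0"
proof -
  have "adj (A - B) = A - B"
    using hermitianD[OF assms(1)] hermitianD[OF assms(2)] by (simp add: adj_minus)
  thus ?thesis unfolding hs_dist_def using mtrace_adj_mult_nonneg[of "A - B"] by simp
qed

lemma densityD:
  assumes "density n A"
  shows "psd n A" "mtrace A = 1" "hermitian n A" "dim_row A = n" "dim_col A = n" "adj A = A"
  using assms hermitianD[OF psd_hermitian[of n A]] by (auto simp: density_def psd_hermitian)

text \<open>Pinching needs only a complete family of orthogonal projectors on one space; the
  splitting into A and B enters when this is instantiated.\<close>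

locale projective_measurement =
  fixes n N :: nat and P :: "nat \<Rightarrow> complex mat"
  assumes dim_P: "\<And>j. j < N \<Longrightarrow> dim_row (P j) = n" "\<And>j. j < N \<Longrightarrow> dim_col (P j) = n"
    and adj_P: "\<And>j. j < N \<Longrightarrow> adj (P j) = P j"
    and P_idem: "\<And>j. j < N \<Longrightarrow> P j * P j = P j"
    and P_orth: "\<And>j k. j < N \<Longrightarrow> k < N \<Longrightarrow> j \<noteq> k \<Longrightarrow> P j * P k = 0\<^sub>m n n"
    and sum_P: "mat_sum n n N P = 1\<^sub>m n"
begin

definition pin :: "complex mat \<Rightarrow> complex mat" where
  "pin \<sigma> = mat_sum n n N (\<lambda>j. P j * \<sigma> * P j)"

lemma dim_pin [simp]: "dim_row (pin \<sigma>) = n" "dim_col (pin \<sigma>) = n"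
  by (simp_all add: pin_def)

text \<open>Orthogonality removes all blocks but the k-th. The blocks \<open>T j\<close> may vary
  with j, because the state built from a POVM has a different matrix in each block.\<close>

lemma P_block_sum:
  assumes T: "\<And>j. j < N \<Longrightarrow> dim_row (T j) = n" "\<And>j. j < N \<Longrightarrow> dim_col (T j) = n" and k: "k < N"
  shows "P k * mat_sum n n N (\<lambda>j. P j * T j * P j) = P k * T k * P k"
    and "mat_sum n n N (\<lambda>j. P j * T j * P j) * P k = P k * T k * P k"
proof -
  have zero: "P k * (P j * T j * P j) = 0\<^sub>m n n" "P j * T j * P j * P k = 0\<^sub>m n n" if j: "j < N" "j \<noteq> k" for j
  proof -
    have "P k * (P j * T j * P j) = (P k * P j) * (T j * P j)"
      using dim_P j k T by (simp add: mat_mult_assoc)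
    thus "P k * (P j * T j * P j) = 0\<^sub>m n n"
      using P_orth[OF k j(1)] j T dim_P by (simp add: left_mult_zero_mat[of _ n n])
    have "P j * T j * P j * P k = (P j * T j) * (P j * P k)"
      using dim_P j k T by (simp add: mat_mult_assoc)
    thus "P j * T j * P j * P k = 0\<^sub>m n n"
      using P_orth[OF j(1) k] j T dim_P by (simp add: right_mult_zero_mat[of _ n n])
  qed
  have "P k * mat_sum n n N (\<lambda>j. P j * T j * P j) = mat_sum n n N (\<lambda>j. P k * (P j * T j * P j))"
    using dim_P k by (subst mult_mat_sum) auto
  also have "\<dots> = P k * (P k * T k * P k)"
    using zero k dim_P by (intro mat_sum_single) auto
  also have "\<dots> = (P k * P k) * T k * P k"
    using k T dim_P by (simp add: mat_mult_assoc)
  finally show "P k * mat_sum n n N (\<lambda>j. P j * T j * P j) = P k * T k * P k"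
    using P_idem k by simp
  have "mat_sum n n N (\<lambda>j. P j * T j * P j) * P k = mat_sum n n N (\<lambda>j. P j * T j * P j * P k)"
    using dim_P k by (subst mat_sum_mult) auto
  also have "\<dots> = P k * T k * P k * P k"
    using zero k dim_P by (intro mat_sum_single) auto
  also have "\<dots> = P k * T k * (P k * P k)"
    using k T dim_P by (simp add: mat_mult_assoc)
  finally show "mat_sum n n N (\<lambda>j. P j * T j * P j) * P k = P k * T k * P k"
    using P_idem k by simp
qed

lemma block_sum_commute:
  assumes "\<And>j. j < N \<Longrightarrow> dim_row (T j) = n" "\<And>j. j < N \<Longrightarrow> dim_col (T j) = n" "k < N"
  shows "P k * mat_sum n n N (\<lambda>j. P j * T j * P j) = mat_sum n n N (\<lambda>j. P j * T j * P j) * P k"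
  using P_block_sum[OF assms] by simp

lemma pin_commute:
  assumes "dim_row \<sigma> = n" "dim_col \<sigma> = n" "k < N"
  shows "P k * pin \<sigma> = pin \<sigma> * P k"
  unfolding pin_def using assms by (intro block_sum_commute) auto

text \<open>Cycling one projector through the trace and commuting it past \<open>T\<close> merges
  the two copies of \<open>P j\<close>; their sum is the identity. Against observables that commute
  with the measurement, pinching is therefore invisible. All three parts rest on this.\<close>

lemma mtrace_pin_mult:
  assumes M: "dim_row M = n" "dim_col M = n" and T: "dim_row T = n" "dim_col T = n"
    and comm: "\<And>j. j < N \<Longrightarrow> P j * T = T * P j"
  shows "mtrace (pin M * T) = mtrace (M * T)"
proof -
  have "mtrace (pin M * T) = (\<Sum>j<N. mtrace (P j * M * P j * T))"
    unfolding pin_def using M T dim_P by (subst mat_sum_mult) (auto simp: mtrace_mat_sum)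
  also have "\<dots> = (\<Sum>j<N. mtrace (M * T * P j))"
  proof (rule sum.cong)
    fix j assume "j \<in> {..<N}"
    hence j: "j < N" by simp
    have "P j * M * P j * T = P j * (M * (P j * T))"
      using M T dim_P j by (simp add: mat_mult_assoc)
    hence "mtrace (P j * M * P j * T) = mtrace (M * (P j * T) * P j)"
      using M T dim_P j mtrace_mult_comm[of "P j" "M * (P j * T)"] by simp
    also have "M * (P j * T) * P j = M * T * (P j * P j)"
      unfolding comm[OF j] using M T dim_P j by (simp add: mat_mult_assoc)
    finally show "mtrace (P j * M * P j * T) = mtrace (M * T * P j)"
      using P_idem j by simp
  qed simp
  also have "\<dots> = mtrace (M * T * mat_sum n n N P)"
    using M T dim_P by (subst mult_mat_sum) (auto simp: mtrace_mat_sum)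
  finally show ?thesis using T sum_P by simp
qed

lemma pin_of_commuting:
  assumes T: "dim_row T = n" "dim_col T = n" and comm: "\<And>j. j < N \<Longrightarrow> P j * T = T * P j"
  shows "pin T = T"
proof -
  have "pin T = mat_sum n n N (\<lambda>j. T * P j)"
    unfolding pin_def using P_idem dim_P T by (intro mat_sum_cong) (simp add: comm mat_mult_assoc)
  also have "\<dots> = T * mat_sum n n N P"
    using T dim_P by (subst mult_mat_sum) auto
  finally show ?thesis using T sum_P by simp
qed

lemma adj_pin:
  assumes "dim_row M = n" "dim_col M = n"
  shows "adj (pin M) = pin (adj M)"
  unfolding pin_def using dim_P assms
  by (subst adj_mat_sum) (auto simp: adj_mult adj_P mat_mult_assoc intro!: mat_sum_cong)

lemma psd_pin:
  assumes "psd n \<sigma>"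
  shows "psd n (pin \<sigma>)"
  unfolding pin_def
proof (rule psd_mat_sum)
  fix j assume j: "j < N"
  obtain B where B: "dim_row B = n" "dim_col B = n" "\<sigma> = adj B * B" using psd_factor[OF assms] .
  have "P j * \<sigma> * P j = adj (B * P j) * (B * P j)"
    using B dim_P j by (simp add: adj_mult adj_P mat_mult_assoc)
  thus "psd n (P j * \<sigma> * P j)" using psd_adj_mult[of "B * P j" n] dim_P j by simp
qed

lemma mtrace_pin:
  assumes "dim_row M = n" "dim_col M = n"
  shows "mtrace (pin M) = mtrace M"
  using mtrace_pin_mult[OF assms, of "1\<^sub>m n"] assms dim_P by simp

lemma density_pin:
  assumes "density n \<sigma>"
  shows "density n (pin \<sigma>)"
  unfolding density_def
  using psd_pin[OF densityD(1)[OF assms]] mtrace_pin[OF densityD(4,5)[OF assms]] densityD(2)[OF assms] by simp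

lemma matfun_pin_commute:
  assumes "psd n \<sigma>" "j < N"
  shows "P j * matfun f (pin \<sigma>) = matfun f (pin \<sigma>) * P j"
proof -
  have h: "hermitian n (pin \<sigma>)" by (rule psd_hermitian[OF psd_pin[OF assms(1)]])
  show ?thesis
    using hermitianD[OF psd_hermitian[OF assms(1)]] assms dim_P
    by (intro matfun_intertwine[OF h h, symmetric]) (auto simp: pin_commute)
qed

text \<open>Both squared distances have the same cross term, since \<open>pin \<sigma>\<close>
  commutes with the projectors, and the terms in \<open>pin \<sigma>\<close> alone agree
  too.\<close>

lemma pinching_hs_dist:
  assumes \<rho>: "hermitian n \<rho>" and \<sigma>: "hermitian n \<sigma>"
  shows "hs_dist \<rho> (pin \<sigma>) = Re (mtrace (\<rho> * \<rho>)) - Re (mtrace (pin \<rho> * pin \<rho>)) + hs_dist (pin \<rho>) (pin \<sigma>)"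
proof -
  note d\<rho> = hermitianD[OF \<rho>] and d\<sigma> = hermitianD[OF \<sigma>]
  have "mtrace (\<rho> * pin \<sigma>) = mtrace (pin \<rho> * pin \<sigma>)"
    using d\<rho> d\<sigma> by (intro mtrace_pin_mult[symmetric]) (auto simp: pin_commute)
  thus ?thesis
    using hs_dist_expand[of \<rho> n "pin \<sigma>"] hs_dist_expand[of "pin \<rho>" n "pin \<sigma>"] d\<rho> by simp
qed

text \<open>The kernel of \<open>pin \<sigma>\<close> is invariant under each \<open>P j\<close>.
  The support hypothesis thus applies to P_j v in place of v, and every block of
  \<open>pin \<rho>\<close> annihilates v. This supplies the support condition of Klein's inequality
  after \<open>\<rho>\<close> has been replaced by its pinching.\<close>

lemma supp_le_pin:
  assumes \<rho>: "dim_row \<rho> = n" "dim_col \<rho> = n" and \<sigma>: "psd n \<sigma>" and supp: "supp_le \<rho> (pin \<sigma>)"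
  shows "supp_le (pin \<rho>) (pin \<sigma>)"
  unfolding supp_le_def
proof (intro ballI impI)
  note d\<sigma> = hermitianD[OF psd_hermitian[OF \<sigma>]]
  fix v assume "v \<in> carrier_vec (dim_col (pin \<sigma>))" and 0: "pin \<sigma> *\<^sub>v v = 0\<^sub>v (dim_row (pin \<sigma>))"
  hence v: "v \<in> carrier_vec n" by simp
  have assoc: "(A * B) *\<^sub>v u = A *\<^sub>v (B *\<^sub>v u)"
    if "dim_row A = n" "dim_col A = n" "dim_row B = n" "dim_col B = n" "dim_vec u = n" for A B :: "complex mat" and u
    using that by (intro assoc_mult_mat_vec[of _ n n _ n]) (auto intro: carrier_vecI)
  have "(P j * \<rho> * P j) *\<^sub>v v = 0\<^sub>v n" if j: "j < N" for j
  proof -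
    have "pin \<sigma> *\<^sub>v (P j *\<^sub>v v) = P j *\<^sub>v (pin \<sigma> *\<^sub>v v)"
      using assoc[of "pin \<sigma>" "P j" v] assoc[of "P j" "pin \<sigma>" v] v dim_P j pin_commute[OF d\<sigma>(1,2) j] by simp
    also have "\<dots> = 0\<^sub>v n" using 0 dim_P j by (auto intro!: eq_vecI simp: scalar_prod_def)
    finally have "pin \<sigma> *\<^sub>v (P j *\<^sub>v v) = 0\<^sub>v n" .
    moreover have "P j *\<^sub>v v \<in> carrier_vec n" using dim_P j by (intro carrier_vecI) simp
    ultimately have "\<rho> *\<^sub>v (P j *\<^sub>v v) = 0\<^sub>v n"
      using supp unfolding supp_le_def dim_pin \<rho> by blast
    moreover have "(P j * \<rho> * P j) *\<^sub>v v = P j *\<^sub>v (\<rho> *\<^sub>v (P j *\<^sub>v v))"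
      using \<rho> dim_P j v by (simp add: assoc)
    ultimately show ?thesis using dim_P j by (auto intro!: eq_vecI simp: scalar_prod_def)
  qed
  note zero = this
  have z: "(\<Sum>b<n. (P j * \<rho> * P j) $$ (i,b) * v $ b) = 0" if ij: "j < N" "i < n" for i j
  proof -
    have "(\<Sum>b<n. (P j * \<rho> * P j) $$ (i,b) * v $ b) = ((P j * \<rho> * P j) *\<^sub>v v) $ i"
      using ij dim_P v by (simp add: scalar_prod_def lessThan_atLeast0 del: index_mult_mat(1))
    thus ?thesis using zero[OF ij(1)] ij by simp
  qed
  show "pin \<rho> *\<^sub>v v = 0\<^sub>v (dim_row (pin \<rho>))"
  proof (rule eq_vecI)
    fix i assume "i < dim_vec (0\<^sub>v (dim_row (pin \<rho>)) :: complex vec)"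
    hence i: "i < n" by simp
    have "(pin \<rho> *\<^sub>v v) $ i = (\<Sum>b<n. \<Sum>j<N. (P j * \<rho> * P j) $$ (i,b) * v $ b)"
      using i v by (simp add: scalar_prod_def lessThan_atLeast0 pin_def sum_distrib_right del: index_mult_mat(1))
    also have "\<dots> = (\<Sum>j<N. \<Sum>b<n. (P j * \<rho> * P j) $$ (i,b) * v $ b)" by (rule sum.swap)
    also have "\<dots> = 0" using z i by simp
    finally show "(pin \<rho> *\<^sub>v v) $ i = 0\<^sub>v (dim_row (pin \<rho>)) $ i" using i by simp
  qed simp
qed

lemma pin_entropy_ge:
  assumes \<rho>: "density n \<rho>" and \<sigma>: "density n \<sigma>"
  shows "ereal (vN_entropy (pin \<rho>) - vN_entropy \<rho>) \<le> rel_entropy \<rho> (pin \<sigma>)"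
proof (cases "supp_le \<rho> (pin \<sigma>)")
  case True
  note d\<rho> = densityD[OF \<rho>] and d\<sigma> = densityD[OF \<sigma>]
  note p\<sigma> = densityD[OF density_pin[OF \<sigma>]] and p\<rho> = densityD[OF density_pin[OF \<rho>]]
  have "mtrace (\<rho> * log2m (pin \<sigma>)) = mtrace (pin \<rho> * log2m (pin \<sigma>))"
    unfolding log2m_def using d\<rho> p\<sigma>(3) matfun_pin_commute[OF d\<sigma>(1)]
    by (intro mtrace_pin_mult[symmetric]) auto
  moreover have "Re (mtrace (pin \<rho> * log2m (pin \<sigma>))) \<le> Re (mtrace (pin \<rho> * log2m (pin \<rho>)))"
    using p\<rho> p\<sigma> supp_le_pin[OF d\<rho>(4,5) d\<sigma>(1) True] by (intro klein_inequality) auto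
  ultimately show ?thesis using True by (simp add: rel_entropy_def vN_entropy_def)
qed (simp add: rel_entropy_def)

text \<open>The value is finite only if the support of \<open>\<rho>\<close> lies in that of its
  pinching, which is the main work here; the formula then follows because the logarithm commutes
  with the projectors.\<close>

lemma pin_entropy_eq:
  assumes \<rho>: "density n \<rho>"
  shows "rel_entropy \<rho> (pin \<rho>) = ereal (vN_entropy (pin \<rho>) - vN_entropy \<rho>)"
proof -
  note d\<rho> = densityD[OF \<rho>] and p\<rho> = densityD[OF density_pin[OF \<rho>]]
  obtain B where B: "dim_row B = n" "dim_col B = n" "\<rho> = adj B * B" using psd_factor[OF d\<rho>(1)] .
  have "supp_le \<rho> (pin \<rho>)"
    unfolding supp_le_def
  proof (intro ballI impI)
    fix v assume "v \<in> carrier_vec (dim_col (pin \<rho>))" and 0: "pin \<rho> *\<^sub>v v = 0\<^sub>v (dim_row (pin \<rho>))"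
    hence v: "v \<in> carrier_vec n" by simp
    \<comment> \<open>The vector is recast as an n x 1 matrix so that squared norms become
      traces.\<close>
    define M where "M = mat n 1 (\<lambda>(i,_). v $ i)"
    have M: "dim_row M = n" "dim_col M = 1" by (auto simp: M_def)
    have Av: "A *\<^sub>v v = col (A * M) 0" if "dim_row A = n" "dim_col A = n" for A
    proof -
      have c: "col M 0 = v" using v by (intro eq_vecI) (auto simp: M_def)
      have "col (A * M) 0 = A *\<^sub>v col M 0"
        by (rule col_mult2) (use that M in \<open>auto intro: carrier_matI\<close>)
      thus ?thesis unfolding c ..
    qed
    have pM: "pin \<rho> * M = 0\<^sub>m n 1"
    proof (rule mat_col_eqI)
      fix j assume "j < dim_col (0\<^sub>m n 1 :: complex mat)"
      thus "col (pin \<rho> * M) j = col (0\<^sub>m n 1) j" using Av[of "pin \<rho>"] 0 by simp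
    qed (use M in auto)
    \<comment> \<open>The squared norm of B P_j v is the j-th block of \<open>pin \<rho>\<close>
      evaluated at v, hence zero. As the P_j sum to the identity, \<rho> v is the sum of the vectors
      B* B P_j v and vanishes.\<close>
    have BPM: "B * P j * M = 0\<^sub>m n 1" if j: "j < N" for j
    proof -
      have "adj (B * P j * M) * (B * P j * M) = adj M * (P j * \<rho> * P j) * M"
        using B M dim_P j by (simp add: adj_mult adj_P mat_mult_assoc)
      also have "P j * \<rho> * P j = P j * pin \<rho>"
        unfolding pin_def using d\<rho> j by (subst P_block_sum) auto
      also have "adj M * (P j * pin \<rho>) * M = adj M * P j * (pin \<rho> * M)"
        using M dim_P j by (simp add: mat_mult_assoc)
      also have "mtrace \<dots> = 0"
        unfolding pM using M dim_P j by (simp add: mtrace_def)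
      finally have "mtrace (adj (B * P j * M) * (B * P j * M)) = 0" .
      from adj_mult_trace_zero[OF this] show ?thesis using B M by simp
    qed
    have "\<rho> * M = \<rho> * mat_sum n n N P * M"
      using d\<rho> sum_P by simp
    also have "\<dots> = mat_sum n 1 N (\<lambda>j. \<rho> * P j * M)"
      using d\<rho> M dim_P by (subst mult_mat_sum, simp, simp, simp, subst mat_sum_mult) auto
    also have "\<dots> = mat_sum n 1 N (\<lambda>j. 0\<^sub>m n 1)"
    proof (rule mat_sum_cong)
      fix j assume j: "j < N"
      have "\<rho> * P j * M = adj B * (B * P j * M)"
        using B M dim_P j by (simp add: mat_mult_assoc)
      thus "\<rho> * P j * M = 0\<^sub>m n 1"
        unfolding BPM[OF j] using B by (simp add: right_mult_zero_mat[of _ n n])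
    qed
    finally have "\<rho> * M = 0\<^sub>m n 1" by (auto intro!: eq_matI)
    thus "\<rho> *\<^sub>v v = 0\<^sub>v (dim_row \<rho>)" using Av[of \<rho>] d\<rho> by simp
  qed
  moreover have "mtrace (\<rho> * log2m (pin \<rho>)) = mtrace (pin \<rho> * log2m (pin \<rho>))"
    unfolding log2m_def using d\<rho> p\<rho>(3) matfun_pin_commute[OF d\<rho>(1)]
    by (intro mtrace_pin_mult[symmetric]) auto
  ultimately show ?thesis by (simp add: rel_entropy_def vN_entropy_def)
qed

end

section \<open>Optimal measurements and fidelity\<close>

lemma bounded_real_subseq:
  fixes f :: "nat \<Rightarrow> real"
  assumes "\<And>k. \<bar>f k\<bar> \<le> b"
  obtains r L where "strict_mono r" "(\<lambda>k. f (r k)) \<longlonglongrightarrow> L"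
proof -
  obtain r :: "nat \<Rightarrow> nat" where r: "strict_mono r" "monoseq (\<lambda>k. f (r k))"
    using seq_monosub by blast
  have "Bseq (\<lambda>k. f (r k))"
    using assms by (intro BseqI'[of _ b]) auto
  hence "convergent (\<lambda>k. f (r k))" using r by (intro Bseq_monoseq_convergent)
  thus ?thesis using that r by (auto simp: convergent_def)
qed

lemma bounded_complex_subseq:
  fixes f :: "nat \<Rightarrow> complex"
  assumes "\<And>k. cmod (f k) \<le> b"
  obtains r L where "strict_mono r" "(\<lambda>k. f (r k)) \<longlonglongrightarrow> L"
proof -
  have "\<bar>Re (f k)\<bar> \<le> b" for k using abs_Re_le_cmod assms order_trans by blast
  then obtain r x where r: "strict_mono r" "(\<lambda>k. Re (f (r k))) \<longlonglongrightarrow> x"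
    using bounded_real_subseq[of "\<lambda>k. Re (f k)" b] by blast
  have "\<bar>Im (f (r k))\<bar> \<le> b" for k using abs_Im_le_cmod assms order_trans by blast
  then obtain s y where s: "strict_mono s" "(\<lambda>k. Im (f (r (s k)))) \<longlonglongrightarrow> y"
    using bounded_real_subseq[of "\<lambda>k. Im (f (r k))" b] by blast
  have "(\<lambda>k. Re (f (r (s k)))) \<longlonglongrightarrow> x"
    using LIMSEQ_subseq_LIMSEQ[OF r(2) s(1)] by (simp add: o_def)
  hence "(\<lambda>k. f ((r \<circ> s) k)) \<longlonglongrightarrow> Complex x y"
    using s(2) by (simp add: tendsto_complex_iff)
  thus ?thesis using that strict_mono_o[OF r(1) s(1)] by blast
qed

lemma bounded_coordinates_subseq:
  fixes f :: "nat \<Rightarrow> 'i \<Rightarrow> complex"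
  assumes "finite I" "\<And>k i. i \<in> I \<Longrightarrow> cmod (f k i) \<le> b"
  shows "\<exists>r L. strict_mono r \<and> (\<forall>i\<in>I. (\<lambda>k. f (r k) i) \<longlonglongrightarrow> L i)"
  using assms
proof (induction I)
  case empty
  show ?case by (intro exI[of _ id]) (auto simp: strict_mono_def)
next
  case (insert x I)
  then obtain r L where r: "strict_mono r" "\<forall>i\<in>I. (\<lambda>k. f (r k) i) \<longlonglongrightarrow> L i" by blast
  obtain s y where s: "strict_mono s" "(\<lambda>k. f (r (s k)) x) \<longlonglongrightarrow> y"
    using bounded_complex_subseq[of "\<lambda>k. f (r k) x" b] insert.prems by blast
  have "(\<lambda>k. f ((r \<circ> s) k) i) \<longlonglongrightarrow> (L(x := y)) i" if i: "i \<in> insert x I" for i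
  proof (cases "i = x")
    case False
    hence "(\<lambda>k. f (r k) i) \<longlonglongrightarrow> L i" using r i by auto
    from LIMSEQ_subseq_LIMSEQ[OF this s(1)] show ?thesis using False by (simp add: o_def)
  qed (use s in simp)
  thus ?case using strict_mono_o[OF r(1) s(1)] by blast
qed

text \<open>Closedness and continuity are phrased through convergence of the coordinates in
  \<open>I\<close> only. Optimisation over families of matrices then needs no topology on matrices:
  a family is a point indexed by its entries.\<close>

lemma attains_max_bounded_coordinates:
  fixes \<phi> :: "('i \<Rightarrow> complex) \<Rightarrow> real"
  assumes I: "finite I" and ne: "A \<noteq> {}" and bd: "\<And>s i. s \<in> A \<Longrightarrow> i \<in> I \<Longrightarrow> cmod (s i) \<le> b"
    and closed: "\<And>f s. (\<And>m. f m \<in> A) \<Longrightarrow> (\<And>i. i \<in> I \<Longrightarrow> (\<lambda>m. f m i) \<longlonglongrightarrow> s i) \<Longrightarrow> s \<in> A"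
    and cont: "\<And>f s. (\<And>i. i \<in> I \<Longrightarrow> (\<lambda>m. f m i) \<longlonglongrightarrow> s i) \<Longrightarrow> (\<lambda>m. \<phi> (f m)) \<longlonglongrightarrow> \<phi> s"
  shows "\<exists>s\<in>A. \<forall>t\<in>A. \<phi> t \<le> \<phi> s"
proof -
  have sub: "\<exists>r s. strict_mono r \<and> s \<in> A \<and> (\<lambda>m. \<phi> (f (r m))) \<longlonglongrightarrow> \<phi> s" if f: "\<And>m. f m \<in> A" for f :: "nat \<Rightarrow> 'i \<Rightarrow> complex"
  proof -
    obtain r s where r: "strict_mono (r :: nat \<Rightarrow> nat)" "\<forall>i\<in>I. (\<lambda>k. f (r k) i) \<longlonglongrightarrow> s i"
      using bounded_coordinates_subseq[OF I, of f b] bd f by blast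
    thus ?thesis using closed[of "\<lambda>m. f (r m)" s] cont[of "\<lambda>m. f (r m)" s] f by blast
  qed
  have bdd: "bdd_above (\<phi> ` A)"
  proof (rule ccontr)
    assume "\<not> bdd_above (\<phi> ` A)"
    hence "\<forall>m. \<exists>s\<in>A. \<phi> s > real m" by (auto simp: bdd_above_def not_le)
    then obtain f where f: "\<And>m. f m \<in> A" "\<And>m. \<phi> (f m) > real m" by metis
    obtain r s where r: "strict_mono r" "(\<lambda>m. \<phi> (f (r m))) \<longlonglongrightarrow> \<phi> s" using sub[of f] f by blast
    have "Bseq (\<lambda>m. \<phi> (f (r m)))" using r by (intro convergent_imp_Bseq) (auto simp: convergent_def)
    then obtain c where c: "\<And>m. \<bar>\<phi> (f (r m))\<bar> \<le> c" by (auto simp: Bseq_def)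
    obtain m where "c < real m" using reals_Archimedean2 by blast
    moreover have "real m \<le> real (r m)" using seq_suble[OF r(1)] by simp
    ultimately show False using f(2)[of "r m"] c[of m] by linarith
  qed
  define v where "v = Sup (\<phi> ` A)"
  have "\<exists>s\<in>A. v - 1 / real (Suc m) < \<phi> s" for m
    using less_cSup_iff[of "\<phi> ` A" "v - 1 / real (Suc m)"] ne bdd by (auto simp: v_def)
  then obtain f where f: "\<And>m. f m \<in> A" "\<And>m. v - 1 / real (Suc m) < \<phi> (f m)" by metis
  have le: "\<phi> t \<le> v" if "t \<in> A" for t
    unfolding v_def using that bdd by (intro cSup_upper) auto
  have "(\<lambda>m. v - 1 / real (Suc m)) \<longlonglongrightarrow> v - 0"
    by (intro tendsto_diff tendsto_const) (rule LIMSEQ_Suc[OF lim_1_over_n])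
  hence v: "(\<lambda>m. v - 1 / real (Suc m)) \<longlonglongrightarrow> v" by (simp only: diff_zero)
  have lim: "(\<lambda>m. \<phi> (f m)) \<longlonglongrightarrow> v"
  proof (rule tendsto_sandwich[OF _ _ v tendsto_const])
    show "\<forall>\<^sub>F m in sequentially. v - 1 / real (Suc m) \<le> \<phi> (f m)"
      using f(2) by (intro always_eventually allI less_imp_le)
    show "\<forall>\<^sub>F m in sequentially. \<phi> (f m) \<le> v"
      using le[OF f(1)] by (intro always_eventually allI)
  qed
  obtain r s where r: "strict_mono r" "s \<in> A" "(\<lambda>m. \<phi> (f (r m))) \<longlonglongrightarrow> \<phi> s" using sub[of f] f by blast
  have "(\<lambda>m. \<phi> (f (r m))) \<longlonglongrightarrow> v" using LIMSEQ_subseq_LIMSEQ[OF lim r(1)] by (simp add: o_def)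
  hence "\<phi> s = v" using r(3) LIMSEQ_unique by blast
  thus ?thesis using r(2) le by blast
qed

definition resolution :: "nat \<Rightarrow> nat \<Rightarrow> (nat \<Rightarrow> complex mat) \<Rightarrow> bool" where
  "resolution N d R \<longleftrightarrow> (\<forall>j<N. psd d (R j)) \<and> mat_sum d d N R = 1\<^sub>m d"

text \<open>Writing each POVM element as S* S, normalisation bounds the entries of the S's by 1, which gives compactness.\<close>

lemma resolution_attains_max:
  assumes N: "N > 0" and \<omega>: "\<And>j. j < N \<Longrightarrow> dim_row (\<omega> j) = d \<and> dim_col (\<omega> j) = d"
  shows "\<exists>R. resolution N d R \<and> (\<forall>R'. resolution N d R' \<longrightarrow>
    (\<Sum>j<N. Re (mtrace (R' j * \<omega> j))) \<le> (\<Sum>j<N. Re (mtrace (R j * \<omega> j))))"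
proof -
  define I where "I = {..<N} \<times> {..<d} \<times> {..<d}"
  define A where "A = {s :: nat \<times> nat \<times> nat \<Rightarrow> complex. \<forall>a<d. \<forall>b<d.
    (\<Sum>j<N. \<Sum>k<d. cnj (s (j,k,a)) * s (j,k,b)) = (if a = b then 1 else 0)}"
  define \<phi> where "\<phi> s = (\<Sum>j<N. Re (\<Sum>a<d. \<Sum>b<d. (\<Sum>k<d. cnj (s (j,k,a)) * s (j,k,b)) * \<omega> j $$ (b,a)))"
    for s :: "nat \<times> nat \<times> nat \<Rightarrow> complex"
  define S where "S s j = mat d d (\<lambda>(k,a). s (j,k,a))" for s :: "nat \<times> nat \<times> nat \<Rightarrow> complex" and j
  have dS: "dim_row (S s j) = d" "dim_col (S s j) = d" for s j by (auto simp: S_def)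
  have SS: "(adj (S s j) * S s j) $$ (a,b) = (\<Sum>k<d. cnj (s (j,k,a)) * s (j,k,b))" if "a < d" "b < d" for s j a b
    using that by (simp add: index_mat_mult dS del: index_mult_mat(1)) (simp add: S_def)
  have resS: "resolution N d (\<lambda>j. adj (S s j) * S s j) \<longleftrightarrow> s \<in> A" for s
  proof -
    have "mat_sum d d N (\<lambda>j. adj (S s j) * S s j) = 1\<^sub>m d \<longleftrightarrow> s \<in> A"
    proof
      assume *: "mat_sum d d N (\<lambda>j. adj (S s j) * S s j) = 1\<^sub>m d"
      show "s \<in> A" unfolding A_def
      proof (intro CollectI allI impI)
        fix a b assume ab: "a < d" "b < d"
        show "(\<Sum>j<N. \<Sum>k<d. cnj (s (j,k,a)) * s (j,k,b)) = (if a = b then 1 else 0)"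
          using arg_cong[OF *, of "\<lambda>M. M $$ (a,b)"] ab by (simp add: SS del: index_mult_mat(1))
      qed
    next
      assume "s \<in> A"
      thus "mat_sum d d N (\<lambda>j. adj (S s j) * S s j) = 1\<^sub>m d"
        unfolding A_def by (intro eq_matI) (auto simp: SS simp del: index_mult_mat(1))
    qed
    thus ?thesis unfolding resolution_def using psd_adj_mult[OF dS(2)] by blast
  qed
  have score: "(\<Sum>j<N. Re (mtrace (adj (S s j) * S s j * \<omega> j))) = \<phi> s" for s
    unfolding \<phi>_def using \<omega>
    by (intro sum.cong) (auto simp: mtrace_mult dS SS simp del: index_mult_mat(1))
  have "\<exists>s\<in>A. \<forall>t\<in>A. \<phi> t \<le> \<phi> s"
  proof (rule attains_max_bounded_coordinates[of I _ 1])
    show "finite I" by (simp add: I_def)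
    \<comment> \<open>The feasible point with identity as factor 0 and all other factors zero; index
      0 exists because N > 0.\<close>
    have "(\<lambda>(j,k,a). if j = 0 \<and> k = a then 1 else 0) \<in> A"
    proof -
      have "(\<Sum>j<N. \<Sum>k<d. cnj (if j = 0 \<and> k = a then 1 else 0) * (if j = 0 \<and> k = b then 1 else 0))
          = (if a = b then 1 else (0::complex))" if ab: "a < d" "b < d" for a b
      proof -
        have "(\<Sum>j<N. \<Sum>k<d. cnj (if j = 0 \<and> k = a then 1 else 0) * (if j = 0 \<and> k = b then 1 else 0))
          = (\<Sum>j<N. \<Sum>k<d. if k = a then (if j = 0 then if a = b then 1 else 0 else (0::complex)) else 0)"
          by (intro sum.cong) auto
        also have "\<dots> = (\<Sum>j<N. if j = 0 then if a = b then 1 else 0 else 0)"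
          using ab by simp
        also have "\<dots> = (if a = b then 1 else 0)" using N by simp
        finally show ?thesis .
      qed
      thus ?thesis by (simp add: A_def)
    qed
    thus "A \<noteq> {}" by blast
  next
    fix s i assume s: "s \<in> A" and "i \<in> I"
    then obtain j k a where i: "i = (j,k,a)" "j < N" "k < d" "a < d" by (auto simp: I_def)
    have "(\<Sum>j<N. \<Sum>k<d. cnj (s (j,k,a)) * s (j,k,a)) = 1"
      using s i by (simp add: A_def)
    hence "complex_of_real (\<Sum>j<N. \<Sum>k<d. (cmod (s (j,k,a)))\<^sup>2) = complex_of_real 1"
      by (simp add: complex_norm_square mult.commute del: of_real_power)
    hence 1: "(\<Sum>j<N. \<Sum>k<d. (cmod (s (j,k,a)))\<^sup>2) = 1" by (simp only: of_real_eq_iff)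
    have "(cmod (s (j,k,a)))\<^sup>2 \<le> (\<Sum>k<d. (cmod (s (j,k,a)))\<^sup>2)"
      using i by (intro member_le_sum) auto
    also have "\<dots> \<le> (\<Sum>j<N. \<Sum>k<d. (cmod (s (j,k,a)))\<^sup>2)"
      using i by (intro member_le_sum[of j _ "\<lambda>j. \<Sum>k<d. (cmod (s (j,k,a)))\<^sup>2"]) (auto intro: sum_nonneg)
    finally have "(cmod (s (j,k,a)))\<^sup>2 \<le> 1\<^sup>2" unfolding 1 by simp
    thus "cmod (s i) \<le> 1" unfolding i by (rule power2_le_imp_le) simp
  next
    fix f :: "nat \<Rightarrow> nat \<times> nat \<times> nat \<Rightarrow> complex" and s
    assume f: "\<And>m. f m \<in> A" and lim: "\<And>i. i \<in> I \<Longrightarrow> (\<lambda>m. f m i) \<longlonglongrightarrow> s i"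
    show "s \<in> A" unfolding A_def
    proof (intro CollectI allI impI)
      fix a b assume ab: "a < d" "b < d"
      have "(\<lambda>m. \<Sum>j<N. \<Sum>k<d. cnj (f m (j,k,a)) * f m (j,k,b)) \<longlonglongrightarrow> (\<Sum>j<N. \<Sum>k<d. cnj (s (j,k,a)) * s (j,k,b))"
        using ab by (intro tendsto_sum tendsto_mult tendsto_cnj lim) (auto simp: I_def)
      moreover have "(\<Sum>j<N. \<Sum>k<d. cnj (f m (j,k,a)) * f m (j,k,b)) = (if a = b then 1 else 0)" for m
        using f[of m] ab by (auto simp: A_def)
      ultimately have "(\<lambda>m. if a = b then 1 else 0) \<longlonglongrightarrow> (\<Sum>j<N. \<Sum>k<d. cnj (s (j,k,a)) * s (j,k,b))"
        by simp
      from LIMSEQ_unique[OF this tendsto_const]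
      show "(\<Sum>j<N. \<Sum>k<d. cnj (s (j,k,a)) * s (j,k,b)) = (if a = b then 1 else 0)" .
    qed
  next
    fix f :: "nat \<Rightarrow> nat \<times> nat \<times> nat \<Rightarrow> complex" and s
    assume lim: "\<And>i. i \<in> I \<Longrightarrow> (\<lambda>m. f m i) \<longlonglongrightarrow> s i"
    show "(\<lambda>m. \<phi> (f m)) \<longlonglongrightarrow> \<phi> s" unfolding \<phi>_def
      by (intro tendsto_sum tendsto_Re tendsto_mult tendsto_cnj tendsto_const lim) (auto simp: I_def)
  qed
  then obtain s where s: "s \<in> A" "\<And>t. t \<in> A \<Longrightarrow> \<phi> t \<le> \<phi> s" by blast
  show ?thesis
  proof (intro exI[of _ "\<lambda>j. adj (S s j) * S s j"] conjI allI impI)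
    show "resolution N d (\<lambda>j. adj (S s j) * S s j)" using resS s by blast
    fix R' assume R': "resolution N d R'"
    have "\<forall>j. \<exists>B. j < N \<longrightarrow> dim_row B = d \<and> dim_col B = d \<and> R' j = adj B * B"
      using R' psd_factor unfolding resolution_def by metis
    then obtain B where B: "\<And>j. j < N \<Longrightarrow> dim_row (B j) = d \<and> dim_col (B j) = d \<and> R' j = adj (B j) * B j"
      by metis
    \<comment> \<open>Every competitor comes from a point of \<open>A\<close> through factors of its
      elements, so maximality over \<open>A\<close> covers all resolutions.\<close>
    define t where "t = (\<lambda>(j,k,a). B j $$ (k,a))"
    have St: "S t j = B j" if "j < N" for j
      using B[OF that] by (intro eq_matI) (auto simp: S_def t_def)
    have eq: "adj (S t j) * S t j = R' j" if "j < N" for j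
      using B[OF that] St[OF that] by simp
    have "mat_sum d d N (\<lambda>j. adj (S t j) * S t j) = mat_sum d d N R'"
      by (rule mat_sum_cong) (rule eq)
    hence "resolution N d (\<lambda>j. adj (S t j) * S t j)"
      using R' eq by (simp add: resolution_def)
    hence "\<phi> t \<le> \<phi> s" using resS s by blast
    thus "(\<Sum>j<N. Re (mtrace (R' j * \<omega> j))) \<le> (\<Sum>j<N. Re (mtrace (adj (S s j) * S s j * \<omega> j)))"
      unfolding score[symmetric] by (simp add: eq)
  qed
qed

section \<open>Two-sided bounds between fidelity and guessing score\<close>

context projective_measurement
begin

lemma fidelity_pin_le:
  assumes X: "dim_row X = n" "dim_col X = d" and N: "N > 0" and \<sigma>: "density n \<sigma>"
  shows "\<exists>R. resolution N d R \<and>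
    fidelity (X * adj X) (pin \<sigma>) \<le> (\<Sum>j<N. Re (mtrace (R j * (adj X * P j * X))))"
proof -
  note d\<sigma> = densityD[OF \<sigma>] and p\<sigma> = densityD[OF density_pin[OF \<sigma>]]
  define T where "T = sqrtm (pin \<sigma>)"
  have T: "dim_row T = n" "dim_col T = n" "adj T = T"
    using hermitianD[OF sqrtm_hermitian[OF p\<sigma>(1)]] by (auto simp: T_def)
  have TT: "T * T = pin \<sigma>" unfolding T_def by (rule sqrtm_mult_self[OF p\<sigma>(1)])
  have Tcomm: "P j * T = T * P j" if "j < N" for j
    unfolding T_def sqrtm_def by (rule matfun_pin_commute[OF d\<sigma>(1) that])
  obtain K where K: "dim_row K = n" "dim_col K = d"
    "mtrace (K * (adj X * T)) = mtrace (sqrtm (adj (adj X * T) * (adj X * T)))" "psd d (1\<^sub>m d - adj K * K)"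
    using trace_norm_attained[of "adj X * T"] X T by auto
  define M where "M = K * adj X"
  have M: "dim_row M = n" "dim_col M = n" by (auto simp: M_def K X)
  define R where "R j = adj (P j * K) * (P j * K)" for j
  have R: "psd d (R j)" if "j < N" for j
    unfolding R_def using K by (intro psd_adj_mult) auto
  define E where "E = 1\<^sub>m d - adj K * K"
  have F: "fidelity (X * adj X) (pin \<sigma>) = (Re (mtrace (pin M * T)))\<^sup>2"
  proof -
    have "fidelity (X * adj X) (pin \<sigma>) = (Re (mtrace (K * (adj X * T))))\<^sup>2"
      unfolding K(3) using fidelity_factor[OF X(1) T(1)] T TT by simp
    also have "K * (adj X * T) = M * T"
      using K X T by (simp add: M_def mat_mult_assoc)
    \<comment> \<open>\<open>T\<close> commutes with the projectors, so \<open>M\<close> may be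
      pinched at no cost to the trace; Cauchy-Schwarz then involves only the diagonal blocks of
      \<open>M\<close>.\<close>
    also have "mtrace (M * T) = mtrace (pin M * T)"
      using M T Tcomm by (intro mtrace_pin_mult[symmetric]) auto
    finally show ?thesis .
  qed
  \<comment> \<open>The other Cauchy-Schwarz factor is Tr (T T) = Tr (pin \<sigma>) = 1.\<close>
  also have "\<dots> \<le> Re (mtrace (adj (pin M) * pin M))"
  proof -
    have "mtrace (pin M * T) = mtrace (adj T * pin M)"
      using T by (subst mtrace_mult_comm) auto
    thus ?thesis
      using mtrace_cauchy_schwarz[of T "pin M"] T TT p\<sigma> by simp
  qed
  also have "mtrace (adj (pin M) * pin M) = mtrace (adj M * pin M)"
    unfolding adj_pin[OF M] using M by (intro mtrace_pin_mult) (auto simp: pin_commute)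
  also have "\<dots> = (\<Sum>j<N. mtrace (adj M * (P j * M * P j)))"
    unfolding pin_def using M dim_P by (subst mult_mat_sum) (auto simp: mtrace_mat_sum)
  also have "\<dots> = (\<Sum>j<N. mtrace (R j * (adj X * P j * X)))"
  proof (rule sum.cong)
    fix j assume "j \<in> {..<N}"
    hence j: "j < N" by simp
    have "R j * (adj X * P j * X) = adj K * (P j * P j) * K * adj X * P j * X"
      using K(1,2) X dim_P j by (simp add: R_def adj_mult adj_P mat_mult_assoc)
    also have "\<dots> = (adj K * P j * K * adj X * P j) * X"
      using P_idem[OF j] by simp
    finally have "mtrace (R j * (adj X * P j * X)) = mtrace (X * (adj K * P j * K * adj X * P j))"
      using K(1,2) X dim_P j mtrace_mult_comm[of "adj K * P j * K * adj X * P j" X] by simp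
    thus "mtrace (adj M * (P j * M * P j)) = mtrace (R j * (adj X * P j * X))"
      using K(1,2) X dim_P j by (simp add: M_def adj_mult mat_mult_assoc)
  qed simp
  finally have le: "fidelity (X * adj X) (pin \<sigma>) \<le> (\<Sum>j<N. Re (mtrace (R j * (adj X * P j * X))))"
    by simp
  have dR: "dim_row (R j) = d" "dim_col (R j) = d" if "j < N" for j
    using K by (auto simp: R_def)
  have dE: "dim_row E = d" "dim_col E = d" using K by (auto simp: E_def)
  have pE: "psd d E" unfolding E_def by (rule K(4))
  \<comment> \<open>The elements \<open>R j\<close> sum to \<open>adj K * K\<close>, so the defect
    \<open>E\<close> is added to element 0. This cannot lower the score, since \<open>E\<close> and
    \<open>adj X * P 0 * X\<close> are both positive.\<close>
  define R' where "R' j = (if j = 0 then R j + E else R j)" for j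
  have "resolution N d R'"
    unfolding resolution_def
  proof (intro conjI allI impI)
    fix j assume "j < N"
    thus "psd d (R' j)" using R pE by (simp add: R'_def psd_add)
  next
    have "mat_sum d d N R = mat_sum d d N (\<lambda>j. adj K * P j * K)"
      using K(1,2) dim_P P_idem by (intro mat_sum_cong)
        (simp add: R_def adj_mult adj_P mat_mult_assoc, simp add: mat_mult_assoc[symmetric])
    also have "\<dots> = adj K * mat_sum n n N P * K"
      using K(1,2) dim_P by (subst mult_mat_sum, simp, simp, simp, subst mat_sum_mult) auto
    also have "\<dots> = adj K * K" using sum_P K by simp
    finally have sR: "mat_sum d d N R = adj K * K" .
    show "mat_sum d d N R' = 1\<^sub>m d"
    proof (rule eq_matI)
      fix a b assume "a < dim_row (1\<^sub>m d :: complex mat)" "b < dim_col (1\<^sub>m d :: complex mat)"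
      hence ab: "a < d" "b < d" by auto
      have "(\<Sum>j<N. R' j $$ (a,b)) = (\<Sum>j<N. R j $$ (a,b) + (if j = 0 then E $$ (a,b) else 0))"
        using ab dE by (intro sum.cong) (auto simp: R'_def)
      also have "\<dots> = mat_sum d d N R $$ (a,b) + E $$ (a,b)"
        using N ab by (simp add: sum.distrib)
      also have "\<dots> = 1\<^sub>m d $$ (a,b)"
        unfolding sR E_def using ab K(1,2) by simp
      finally show "mat_sum d d N R' $$ (a,b) = 1\<^sub>m d $$ (a,b)" using ab by simp
    qed auto
  qed
  moreover have "Re (mtrace (R j * (adj X * P j * X))) \<le> Re (mtrace (R' j * (adj X * P j * X)))" if j: "j < N" for j
  proof (cases "j = 0")
    case True
    have "adj X * P j * X = adj (P j * X) * (P j * X)"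
    proof -
      have "adj (P j * X) * (P j * X) = adj X * (P j * P j) * X"
        using X dim_P j by (simp add: adj_mult adj_P mat_mult_assoc)
      thus ?thesis using P_idem j by simp
    qed
    hence "psd d (adj X * P j * X)" using psd_adj_mult[of "P j * X" d] X by simp
    hence "Re (mtrace (E * (adj X * P j * X))) \<ge> 0" using pE by (intro mtrace_psd_mult_nonneg)
    moreover have "(R j + E) * (adj X * P j * X) = R j * (adj X * P j * X) + E * (adj X * P j * X)"
      using dR[OF j] dE X dim_P j by (intro add_mult_distrib_mat[of _ d d _ _ d]) auto
    ultimately show ?thesis using True X dR[OF j] dE by (simp add: R'_def mtrace_add)
  qed (simp add: R'_def)
  ultimately show ?thesis using le
    by (intro exI[of _ R']) (auto intro: order_trans[OF le] sum_mono)
qed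

text \<open>With g the score, the square root of the fidelity is the trace norm of
  \<open>adj X * V\<close>, and testing it against the isometry \<open>K\<close> gives sqrt g.
  Positivity of g is what permits normalising the state.\<close>

lemma fidelity_pin_ge:
  assumes X: "dim_row X = n" "dim_col X = d" and R: "resolution N d R"
    and pos: "(\<Sum>j<N. Re (mtrace (R j * (adj X * P j * X)))) > 0"
  shows "\<exists>\<sigma>. density n \<sigma> \<and> (\<Sum>j<N. Re (mtrace (R j * (adj X * P j * X)))) \<le> fidelity (X * adj X) (pin \<sigma>)"
proof -
  define g where "g = (\<Sum>j<N. Re (mtrace (R j * (adj X * P j * X))))"
  have "\<forall>j. \<exists>B. j < N \<longrightarrow> dim_row B = d \<and> dim_col B = d \<and> R j = adj B * B"
    using R psd_factor unfolding resolution_def by metis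
  then obtain S where S: "\<And>j. j < N \<Longrightarrow> dim_row (S j) = d" "\<And>j. j < N \<Longrightarrow> dim_col (S j) = d"
    and RS: "\<And>j. j < N \<Longrightarrow> R j = adj (S j) * S j"
    by metis
  \<comment> \<open>The factors S_j enter both \<open>Y\<close> and \<open>K\<close> so that
    \<open>Y * K\<close> collapses to the sum of P_j X R_j, whose trace against \<open>adj X\<close>
    is g. Normalisation of the POVM says exactly that the column of blocks \<open>K\<close> is an
    isometry.\<close>
  define Y where "Y = hcat n d N (\<lambda>j. P j * X * adj (S j))"
  define K where "K = adj (hcat d d N (\<lambda>j. adj (S j)))"
  \<comment> \<open>The trace of \<open>Y * adj Y\<close> is also g, so this factor makes
    \<open>V * adj V\<close> a state.\<close>
  define c where "c = complex_of_real (1 / sqrt g)"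
  have dY: "dim_row Y = n" "dim_col Y = N * d" by (auto simp: Y_def)
  have dK: "dim_row K = N * d" "dim_col K = d" by (auto simp: K_def)
  have KK: "adj K * K = 1\<^sub>m d"
  proof -
    have "adj K * K = mat_sum d d N (\<lambda>j. adj (S j) * adj (adj (S j)))"
      unfolding K_def adj_adj using S by (subst hcat_mult_adj_hcat) auto
    also have "\<dots> = mat_sum d d N R"
      using RS by (intro mat_sum_cong) auto
    finally show ?thesis using R by (simp add: resolution_def)
  qed
  have YY: "Y * adj Y = mat_sum n n N (\<lambda>j. P j * (X * R j * adj X) * P j)"
  proof -
    have "Y * adj Y = mat_sum n n N (\<lambda>j. P j * X * adj (S j) * adj (P j * X * adj (S j)))"
      unfolding Y_def using S dim_P by (subst hcat_mult_adj_hcat) auto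
    also have "\<dots> = mat_sum n n N (\<lambda>j. P j * (X * R j * adj X) * P j)"
      using S dim_P X RS by (intro mat_sum_cong) (simp add: adj_mult adj_P mat_mult_assoc)
    finally show ?thesis .
  qed
  have dR: "dim_row (R j) = d" "dim_col (R j) = d" if "j < N" for j
    using RS S that by auto
  have trj: "mtrace (P j * (X * R j * adj X) * P j) = mtrace (R j * (adj X * P j * X))" if j: "j < N" for j
  proof -
    have "mtrace (P j * (X * R j * adj X) * P j) = mtrace (P j * (P j * X * R j * adj X))"
      using j dim_P X dR by (subst mtrace_mult_comm) (auto simp: mat_mult_assoc)
    also have "P j * (P j * X * R j * adj X) = (P j * P j) * X * R j * adj X"
      using j dim_P X dR by (simp add: mat_mult_assoc)
    also have "\<dots> = (P j * X) * (R j * adj X)"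
      using P_idem[OF j] j dim_P X dR by (simp add: mat_mult_assoc)
    also have "mtrace \<dots> = mtrace ((R j * adj X) * (P j * X))"
      using j dim_P X dR by (intro mtrace_mult_comm) auto
    finally show ?thesis using j dim_P X dR by (simp add: mat_mult_assoc)
  qed
  have trYY: "mtrace (Y * adj Y) = complex_of_real g"
  proof -
    have "mtrace (Y * adj Y) = (\<Sum>j<N. mtrace (R j * (adj X * P j * X)))"
      unfolding YY using dim_P trj by (subst mtrace_mat_sum) auto
    hence "Re (mtrace (Y * adj Y)) = g" by (simp add: g_def)
    moreover have "\<exists>x. mtrace (Y * adj Y) = complex_of_real x"
      using mtrace_adj_mult[of "adj Y"] unfolding adj_adj by blast
    ultimately show ?thesis by auto
  qed
  define V where "V = c \<cdot>\<^sub>m Y"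
  have dV: "dim_row V = n" "dim_col V = N * d" by (auto simp: V_def dY)
  have cc: "c * cnj c = complex_of_real (1 / g)"
    using pos by (simp add: c_def g_def[symmetric] flip: of_real_mult of_real_divide)
  have VV: "V * adj V = complex_of_real (1 / g) \<cdot>\<^sub>m (Y * adj Y)"
  proof (rule eq_matI)
    fix i j assume "i < dim_row (complex_of_real (1 / g) \<cdot>\<^sub>m (Y * adj Y))" "j < dim_col (complex_of_real (1 / g) \<cdot>\<^sub>m (Y * adj Y))"
    hence ij: "i < n" "j < n" by (auto simp: dY)
    have "(V * adj V) $$ (i,j) = (\<Sum>k<N * d. (c * cnj c) * (Y $$ (i,k) * cnj (Y $$ (j,k))))"
      using ij by (simp add: index_mat_mult dV dY V_def mult_ac del: index_mult_mat(1))
    also have "\<dots> = (c * cnj c) * (\<Sum>k<N * d. Y $$ (i,k) * cnj (Y $$ (j,k)))"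
      by (rule sum_distrib_left[symmetric])
    also have "\<dots> = complex_of_real (1 / g) * (Y * adj Y) $$ (i,j)"
      unfolding cc using ij by (simp add: index_mat_mult dY del: index_mult_mat(1))
    finally show "(V * adj V) $$ (i,j) = (complex_of_real (1 / g) \<cdot>\<^sub>m (Y * adj Y)) $$ (i,j)"
      using ij dY by simp
  qed (auto simp: dV dY)
  have dens: "density n (V * adj V)"
    unfolding density_def using psd_mult_adj[OF dV(1)] trYY pos
    by (simp add: VV mtrace_smult dY g_def[symmetric])
  have comm: "P j * (V * adj V) = (V * adj V) * P j" if j: "j < N" for j
  proof -
    have "P j * (Y * adj Y) = (Y * adj Y) * P j"
      unfolding YY using j X dR by (intro block_sum_commute) auto
    moreover have "P j * (a \<cdot>\<^sub>m (Y * adj Y)) = a \<cdot>\<^sub>m (P j * (Y * adj Y))" for a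
      by (rule mult_smult_distrib) (use dim_P[OF j] dY in \<open>auto intro: carrier_matI\<close>)
    moreover have "a \<cdot>\<^sub>m (Y * adj Y) * P j = a \<cdot>\<^sub>m ((Y * adj Y) * P j)" for a
      by (rule mult_smult_assoc_mat) (use dim_P[OF j] dY in \<open>auto intro: carrier_matI\<close>)
    ultimately show ?thesis unfolding VV by simp
  qed
  have pinV: "pin (V * adj V) = V * adj V"
    using comm dV by (intro pin_of_commuting) auto
  have "Re (mtrace (K * (adj X * V))) = sqrt g"
  proof -
    have "mtrace (K * (adj X * V)) = mtrace (adj X * V * K)"
      using dK dV X by (intro mtrace_mult_comm) auto
    also have "adj X * V * K = c \<cdot>\<^sub>m (adj X * (Y * K))"
    proof (rule eq_matI)
      fix i j assume "i < dim_row (c \<cdot>\<^sub>m (adj X * (Y * K)))" "j < dim_col (c \<cdot>\<^sub>m (adj X * (Y * K)))"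
      hence ij: "i < d" "j < d" by (auto simp: X dK)
      show "(adj X * V * K) $$ (i,j) = (c \<cdot>\<^sub>m (adj X * (Y * K))) $$ (i,j)"
        using ij X dV dK dY
        by (simp add: mat_mult_assoc index_mat_mult V_def sum_distrib_left mult_ac del: index_mult_mat(1))
    qed (auto simp: X dK)
    also have "mtrace \<dots> = c * mtrace (adj X * (Y * K))"
      using X dK by (simp add: mtrace_smult)
    also have "Y * K = mat_sum n d N (\<lambda>j. P j * X * adj (S j) * adj (adj (S j)))"
      unfolding Y_def K_def using S dim_P by (subst hcat_mult_adj_hcat) auto
    also have "\<dots> = mat_sum n d N (\<lambda>j. P j * X * R j)"
      using S dim_P X RS by (intro mat_sum_cong) (simp add: mat_mult_assoc)
    also have "mtrace (adj X * \<dots>) = (\<Sum>j<N. mtrace (adj X * (P j * X * R j)))"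
      using dR dim_P X by (subst mult_mat_sum) (auto simp: mtrace_mat_sum)
    also have "\<dots> = (\<Sum>j<N. mtrace (R j * (adj X * P j * X)))"
    proof (rule sum.cong)
      fix j assume "j \<in> {..<N}"
      hence j: "j < N" by simp
      have "adj X * (P j * X * R j) = (adj X * P j * X) * R j"
        using dR[OF j] dim_P[OF j] X by (simp add: mat_mult_assoc)
      thus "mtrace (adj X * (P j * X * R j)) = mtrace (R j * (adj X * P j * X))"
        using dR[OF j] X mtrace_mult_comm[of "adj X * P j * X" "R j"] by simp
    qed simp
    finally have "Re (mtrace (K * (adj X * V))) = 1 / sqrt g * g"
      by (simp add: c_def g_def)
    thus ?thesis using pos by (simp add: g_def[symmetric] real_div_sqrt)
  qed
  moreover have "Re (mtrace (K * (adj X * V))) \<le> Re (mtrace (sqrtm (adj (adj X * V) * (adj X * V))))"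
    using KK dK dV X by (intro trace_norm_ge_isometry) auto
  ultimately have "sqrt g \<le> Re (mtrace (sqrtm (adj (adj X * V) * (adj X * V))))" by simp
  hence "(sqrt g)\<^sup>2 \<le> fidelity (X * adj X) (pin (V * adj V))"
    unfolding pinV fidelity_factor[OF X(1) dV(1)] using pos by (intro power_mono) (auto simp: g_def[symmetric])
  thus ?thesis using dens pos by (auto simp: g_def[symmetric])
qed

end

section \<open>Tripartite pure states\<close>

lemma (in projective_measurement) fidelity_pin_max:
  assumes X: "dim_row X = n" "dim_col X = d" and tr: "mtrace (X * adj X) = 1"
  obtains R \<sigma> where "resolution N d R" "density n \<sigma>"
    "\<And>R'. resolution N d R' \<Longrightarrow>
       (\<Sum>j<N. Re (mtrace (R' j * (adj X * P j * X)))) \<le> (\<Sum>j<N. Re (mtrace (R j * (adj X * P j * X))))"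
    "\<And>\<sigma>'. density n \<sigma>' \<Longrightarrow>
       fidelity (X * adj X) (pin \<sigma>') \<le> (\<Sum>j<N. Re (mtrace (R j * (adj X * P j * X))))"
    "fidelity (X * adj X) (pin \<sigma>) = (\<Sum>j<N. Re (mtrace (R j * (adj X * P j * X))))"
proof -
  let ?s = "\<lambda>R. \<Sum>j<N. Re (mtrace (R j * (adj X * P j * X)))"
  have "(\<Sum>j<N. mtrace (adj X * P j * X)) = mtrace (adj X * mat_sum n n N P * X)"
    using X dim_P by (subst mult_mat_sum, simp, simp, simp, subst mat_sum_mult) (auto simp: mtrace_mat_sum)
  also have "\<dots> = mtrace (adj X * X)" using X by (simp add: sum_P)
  also have "\<dots> = 1" using tr mtrace_mult_comm[of X "adj X"] by simp
  finally have "(\<Sum>j<N. Re (mtrace (adj X * P j * X))) = 1" by (metis Re_sum one_complex.sel(1))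
  then obtain k where k: "k < N" "Re (mtrace (adj X * P k * X)) > 0"
    by (metis lessThan_iff not_one_le_zero not_less sum_nonpos)
  obtain R where R: "resolution N d R" "\<And>R'. resolution N d R' \<Longrightarrow> ?s R' \<le> ?s R"
    using resolution_attains_max[of N "\<lambda>j. adj X * P j * X" d] k(1) X by auto
  have pos: "?s R > 0"
  proof -
    \<comment> \<open>Always guessing an outcome k of positive probability already gives a positive
      score, so the optimal score is positive and the lower bound on fidelity applies to the optimal
      R.\<close>
    define Q where "Q j = (if j = k then 1\<^sub>m d else 0\<^sub>m d d :: complex mat)" for j :: nat
    have "resolution N d Q"
      unfolding resolution_def
    proof (intro conjI allI impI)
      fix j
      have "Q j = adj (Q j) * Q j" by (auto simp: Q_def)
      thus "psd d (Q j)" using psd_adj_mult[of "Q j" d] by (simp add: Q_def split: if_splits)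
      show "mat_sum d d N Q = 1\<^sub>m d"
        using mat_sum_single[OF k(1), of Q d d] by (simp add: Q_def)
    qed
    hence "?s Q \<le> ?s R" by (rule R(2))
    moreover have "?s Q = (\<Sum>j<N. if j = k then Re (mtrace (adj X * P k * X)) else 0)"
    proof (rule sum.cong)
      fix j
      have "0\<^sub>m d d * (adj X * P j * X) = 0\<^sub>m d d"
        by (rule left_mult_zero_mat) (use X in \<open>auto intro: carrier_matI\<close>)
      moreover have "mtrace (0\<^sub>m d d) = 0" by (simp add: mtrace_def)
      ultimately show "Re (mtrace (Q j * (adj X * P j * X))) = (if j = k then Re (mtrace (adj X * P k * X)) else 0)"
        using X by (simp add: Q_def)
    qed simp
    ultimately show ?thesis using k by simp
  qed
  obtain \<sigma> where \<sigma>: "density n \<sigma>" "?s R \<le> fidelity (X * adj X) (pin \<sigma>)"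
    using fidelity_pin_ge[OF X R(1) pos] by blast
  have le: "fidelity (X * adj X) (pin \<sigma>') \<le> ?s R" if "density n \<sigma>'" for \<sigma>'
  proof -
    have "N > 0" using k(1) by simp
    then obtain R' where "resolution N d R'" "fidelity (X * adj X) (pin \<sigma>') \<le> ?s R'"
      using fidelity_pin_le[OF X _ \<open>density n \<sigma>'\<close>] by blast
    thus ?thesis using R(2) order_trans by blast
  qed
  show ?thesis using that[OF R(1) \<sigma>(1) R(2) le] \<sigma> le[OF \<sigma>(1)] by simp
qed

section \<open>Composite indices and Kronecker products\<close>

lemma sum_lessThan_mult_index:
  fixes F :: "nat \<Rightarrow> 'a::comm_monoid_add"
  shows "(\<Sum>q<N * d. F q) = (\<Sum>j<N. \<Sum>c<d. F (j * d + c))"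
  using sum_lessThan_mult[of "\<lambda>j c. F (j * d + c)" d N] by simp

lemma pair_index_less:
  fixes a b m k :: nat
  assumes "a < m" "b < k"
  shows "a * k + b < m * k"
proof -
  have "a * k + b < Suc a * k" using assms by simp
  also have "\<dots> \<le> m * k" using assms by (intro mult_le_mono1) simp
  finally show ?thesis .
qed

lemma pair_index_div_mod:
  fixes b k :: nat
  assumes "b < k"
  shows "(a * k + b) div k = a" "(a * k + b) mod k = b"
  using assms by simp_all

lemma div_index_less: "i < m * k \<Longrightarrow> i div k < (m::nat)"
  by (simp add: less_mult_imp_div_less)

lemma mod_index_less: "i < m * k \<Longrightarrow> i mod k < (k::nat)"
  by (cases k) auto

lemma dim_kron [simp]:
  "dim_row (kron A B) = dim_row A * dim_row B" "dim_col (kron A B) = dim_col A * dim_col B"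
  by (simp_all add: kron_def)

lemma index_kron:
  "i < dim_row A * dim_row B \<Longrightarrow> j < dim_col A * dim_col B \<Longrightarrow>
    kron A B $$ (i,j) = A $$ (i div dim_row B, j div dim_col B) * B $$ (i mod dim_row B, j mod dim_col B)"
  by (simp add: kron_def)

lemma kron_mult:
  assumes "dim_col A = dim_row C" "dim_col B = dim_row D"
  shows "kron A B * kron C D = kron (A * C) (B * D)"
proof (rule eq_matI)
  fix i j assume "i < dim_row (kron (A * C) (B * D))" "j < dim_col (kron (A * C) (B * D))"
  hence ij: "i < dim_row A * dim_row B" "j < dim_col C * dim_col D" by auto
  let ?f = "\<lambda>a b. (A $$ (i div dim_row B, a) * B $$ (i mod dim_row B, b)) * (C $$ (a, j div dim_col D) * D $$ (b, j mod dim_col D))"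
  have "(kron A B * kron C D) $$ (i,j) = (\<Sum>q<dim_row C * dim_row D. ?f (q div dim_row D) (q mod dim_row D))"
    using ij assms by (simp add: index_mat_mult index_kron del: index_mult_mat(1))
  also have "\<dots> = (\<Sum>a<dim_row C. \<Sum>b<dim_row D. ?f a b)" by (rule sum_lessThan_mult)
  also have "\<dots> = (\<Sum>a<dim_row C. A $$ (i div dim_row B, a) * C $$ (a, j div dim_col D))
      * (\<Sum>b<dim_row D. B $$ (i mod dim_row B, b) * D $$ (b, j mod dim_col D))"
    by (simp add: sum_product mult_ac)
  also have "\<dots> = kron (A * C) (B * D) $$ (i,j)"
    using ij assms div_index_less mod_index_less
    by (simp add: index_mat_mult index_kron del: index_mult_mat(1))
  finally show "(kron A B * kron C D) $$ (i,j) = kron (A * C) (B * D) $$ (i,j)" .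
qed auto

lemma adj_kron: "adj (kron A B) = kron (adj A) (adj B)"
  by (intro eq_matI) (auto simp: index_kron div_index_less mod_index_less)

text \<open>\<open>V_Z\<close> nests its products to the left, whereas the projector on AB groups
  \<open>Z ! k\<close> with the identity on B; this regroups one into the other.\<close>

lemma kron_assoc: "kron (kron A B) C = kron A (kron B C)"
proof (rule eq_matI)
  have *: "i div c div b = i div (b * c)" "i div c mod b = i mod (b * c) div c" "i mod c = i mod (b * c) mod c" for i b c :: nat
    by (cases "c = 0"; simp add: div_mult2_eq mult.commute[of b c] mod_mult2_eq)+
  fix i j assume "i < dim_row (kron A (kron B C))" "j < dim_col (kron A (kron B C))"
  hence ij: "i < dim_row A * (dim_row B * dim_row C)" "j < dim_col A * (dim_col B * dim_col C)" by auto
  have ij': "i div dim_row C < dim_row A * dim_row B" "j div dim_col C < dim_col A * dim_col B"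
    using ij by (auto intro!: div_index_less simp: mult.assoc)
  have "kron (kron A B) C $$ (i,j) = A $$ (i div dim_row C div dim_row B, j div dim_col C div dim_col B)
     * B $$ (i div dim_row C mod dim_row B, j div dim_col C mod dim_col B) * C $$ (i mod dim_row C, j mod dim_col C)"
    using ij ij' by (simp add: index_kron mult.assoc)
  also have "\<dots> = kron A (kron B C) $$ (i,j)"
    unfolding *[of i "dim_row C" "dim_row B"] *[of j "dim_col C" "dim_col B"]
    using ij by (simp add: index_kron mod_index_less mult.assoc)
  finally show "kron (kron A B) C $$ (i,j) = kron A (kron B C) $$ (i,j)" .
qed (simp_all add: mult.assoc)

lemma kron_one: "kron (1\<^sub>m m) (1\<^sub>m k) = 1\<^sub>m (m * k)"
proof (rule eq_matI)
  fix i j assume "i < dim_row (1\<^sub>m (m * k) :: complex mat)" "j < dim_col (1\<^sub>m (m * k) :: complex mat)"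
  hence ij: "i < m * k" "j < m * k" by auto
  have "i = j \<longleftrightarrow> i div k = j div k \<and> i mod k = j mod k" by (metis div_mult_mod_eq)
  thus "kron (1\<^sub>m m) (1\<^sub>m k) $$ (i,j) = 1\<^sub>m (m * k) $$ (i,j)"
    using ij by (auto simp: index_kron div_index_less mod_index_less)
qed auto

lemma type_info_projective_measurement:
  assumes "type_info dA Z"
  shows "projective_measurement (dA * dB) (length Z) (\<lambda>j. kron (Z ! j) (1\<^sub>m dB))"
proof
  have Z: "dim_row (Z ! j) = dA" "dim_col (Z ! j) = dA" "adj (Z ! j) = Z ! j" "Z ! j * Z ! j = Z ! j"
    if "j < length Z" for j
    using assms that hermitianD[of dA "Z ! j"] unfolding type_info_def projector_def by auto
  have orth: "Z ! j * Z ! k = 0\<^sub>m dA dA" if "j < length Z" "k < length Z" "j \<noteq> k" for j k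
    using assms that unfolding type_info_def by auto
  fix j assume j: "j < length Z"
  show "dim_row (kron (Z ! j) (1\<^sub>m dB)) = dA * dB" "dim_col (kron (Z ! j) (1\<^sub>m dB)) = dA * dB"
    "adj (kron (Z ! j) (1\<^sub>m dB)) = kron (Z ! j) (1\<^sub>m dB)"
    "kron (Z ! j) (1\<^sub>m dB) * kron (Z ! j) (1\<^sub>m dB) = kron (Z ! j) (1\<^sub>m dB)"
    using Z[OF j] by (simp_all add: adj_kron kron_mult)
  fix k assume k: "k < length Z" "j \<noteq> k"
  have "kron (0\<^sub>m dA dA) (1\<^sub>m dB) = 0\<^sub>m (dA * dB) (dA * dB)"
    by (intro eq_matI) (auto simp: index_kron div_index_less)
  thus "kron (Z ! j) (1\<^sub>m dB) * kron (Z ! k) (1\<^sub>m dB) = 0\<^sub>m (dA * dB) (dA * dB)"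
    using Z[OF j] Z[OF k(1)] orth[OF j k] by (simp add: kron_mult)
next
  have Z: "dim_row (Z ! j) = dA" "dim_col (Z ! j) = dA" if "j < length Z" for j
    using assms that hermitianD[of dA "Z ! j"] unfolding type_info_def projector_def by auto
  have sum: "mat_sum dA dA (length Z) (\<lambda>j. Z ! j) = 1\<^sub>m dA"
    using assms unfolding type_info_def msum_eq_mat_sum by auto
  have "mat_sum (dA * dB) (dA * dB) (length Z) (\<lambda>j. kron (Z ! j) (1\<^sub>m dB))
      = kron (mat_sum dA dA (length Z) (\<lambda>j. Z ! j)) (1\<^sub>m dB)"
    using Z by (intro eq_matI) (auto simp: index_kron div_index_less mod_index_less sum_distrib_right)
  thus "mat_sum (dA * dB) (dA * dB) (length Z) (\<lambda>j. kron (Z ! j) (1\<^sub>m dB)) = 1\<^sub>m (dA * dB)"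
    unfolding sum by (simp add: kron_one)
qed

section \<open>The three systems through the coefficient matrix\<close>

locale tripartite_pure_state =
  fixes dA dB dC :: nat and Z :: "complex mat list" and \<psi> :: "complex vec"
  assumes \<psi>: "\<psi> \<in> carrier_vec (dA * dB * dC)" and norm_\<psi>: "(\<Sum>i<dA * dB * dC. (cmod (\<psi> $ i))\<^sup>2) = 1"
    and Z: "type_info dA Z"
begin

abbreviation "n \<equiv> dA * dB"
abbreviation "N \<equiv> length Z"
abbreviation "\<rho> \<equiv> outer \<psi> \<psi>"

definition P :: "nat \<Rightarrow> complex mat" where "P j = kron (Z ! j) (1\<^sub>m dB)"

definition X :: "complex mat" where "X = mat n dC (\<lambda>(i,c). \<psi> $ (i * dC + c))"

definition Y :: "complex mat" where "Y = hcat n dC N (\<lambda>j. P j * X)"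

sublocale projective_measurement n N P
  unfolding P_def by (rule type_info_projective_measurement[OF Z])

lemma dim_X [simp]: "dim_row X = n" "dim_col X = dC"
  by (simp_all add: X_def)

lemma index_X [simp]: "i < n \<Longrightarrow> c < dC \<Longrightarrow> X $$ (i,c) = \<psi> $ (i * dC + c)"
  by (simp add: X_def)

lemma dim_Z: "j < N \<Longrightarrow> dim_row (Z ! j) = dA" "j < N \<Longrightarrow> dim_col (Z ! j) = dA"
  using Z hermitianD[of dA "Z ! j"] unfolding type_info_def projector_def by auto

lemma index_\<rho>: "i < n * dC \<Longrightarrow> j < n * dC \<Longrightarrow> \<rho> $$ (i,j) = \<psi> $ i * cnj (\<psi> $ j)"
  using \<psi> by (simp add: outer_def)

lemma rho_AB_eq: "rho_AB dA dB dC \<rho> = X * adj X"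
proof (rule eq_matI)
  fix i j assume "i < dim_row (X * adj X)" "j < dim_col (X * adj X)"
  hence ij: "i < n" "j < n" by auto
  have "rho_AB dA dB dC \<rho> $$ (i,j) = (\<Sum>k<dC. \<rho> $$ (i * dC + k, j * dC + k))"
    using ij by (simp add: rho_AB_def ptrace_mid_def)
  also have "\<dots> = (X * adj X) $$ (i,j)"
    using ij by (simp add: index_mat_mult index_\<rho> pair_index_less del: index_mult_mat(1))
  finally show "rho_AB dA dB dC \<rho> $$ (i,j) = (X * adj X) $$ (i,j)" .
qed (auto simp: rho_AB_def ptrace_mid_def)

text \<open>The state conjugates its column index and \<open>adj X * X\<close> its row index, hence
  the transpose.\<close>

lemma rho_C_eq: "rho_C dA dB dC \<rho> = (adj X * X)\<^sup>T"
proof (rule eq_matI)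
  fix i j assume "i < dim_row ((adj X * X)\<^sup>T)" "j < dim_col ((adj X * X)\<^sup>T)"
  hence ij: "i < dC" "j < dC" by auto
  have "rho_C dA dB dC \<rho> $$ (i,j) = (\<Sum>k<n. \<rho> $$ (k * dC + i, k * dC + j))"
    using ij by (simp add: rho_C_def ptrace_mid_def)
  also have "\<dots> = (adj X * X)\<^sup>T $$ (i,j)"
    using ij by (simp add: index_mat_mult index_\<rho> pair_index_less mult.commute[of "cnj _"] del: index_mult_mat(1))
  finally show "rho_C dA dB dC \<rho> $$ (i,j) = (adj X * X)\<^sup>T $$ (i,j)" .
qed (auto simp: rho_C_def ptrace_mid_def)

lemma index_V_Z:
  assumes "j < N" "i < n" "c < dC" "i' < n" "c' < dC"
  shows "V_Z dA dB dC Z $$ ((j * n + i) * dC + c, i' * dC + c') = (if c = c' then P j $$ (i,i') else 0)"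
proof -
  have ji: "j * n + i < N * n" using assms by (intro pair_index_less)
  have r: "(j * n + i) * dC + c < N * n * dC" using ji assms by (intro pair_index_less)
  have q: "i' * dC + c' < n * dC" using assms by (intro pair_index_less)
  have entry: "kron (kron (kron (ket N k) (Z ! k)) (1\<^sub>m dB)) (1\<^sub>m dC) $$ ((j * n + i) * dC + c, i' * dC + c')
      = (if k = j then (if c = c' then P j $$ (i,i') else 0) else 0)" if k: "k < N" for k
  proof -
    have "kron (kron (kron (ket N k) (Z ! k)) (1\<^sub>m dB)) (1\<^sub>m dC) = kron (kron (ket N k) (P k)) (1\<^sub>m dC)"
      by (simp add: kron_assoc P_def)
    moreover have "kron (kron (ket N k) (P k)) (1\<^sub>m dC) $$ ((j * n + i) * dC + c, i' * dC + c')
        = kron (ket N k) (P k) $$ (j * n + i, i') * 1\<^sub>m dC $$ (c, c')"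
      using r q assms dim_P[OF k] by (simp add: index_kron ket_def)
    moreover have "kron (ket N k) (P k) $$ (j * n + i, i') = ket N k $$ (j, 0) * P k $$ (i, i')"
    proof -
      have "(j * n + i) div n = j" "(j * n + i) mod n = i"
        using pair_index_div_mod[OF assms(2)] by blast+
      thus ?thesis using ji assms dim_P[OF k] by (simp add: index_kron ket_def)
    qed
    ultimately show ?thesis using assms k by (auto simp: ket_def)
  qed
  have "V_Z dA dB dC Z $$ ((j * n + i) * dC + c, i' * dC + c')
      = (\<Sum>k<N. kron (kron (kron (ket N k) (Z ! k)) (1\<^sub>m dB)) (1\<^sub>m dC) $$ ((j * n + i) * dC + c, i' * dC + c'))"
    using r q by (simp add: V_Z_def Let_def mult.assoc)
  also have "\<dots> = (\<Sum>k<N. if k = j then (if c = c' then P j $$ (i,i') else 0) else 0)"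
    by (intro sum.cong) (auto simp: entry)
  finally show ?thesis using assms by simp
qed

lemma dim_V_Z: "dim_row (V_Z dA dB dC Z) = N * n * dC" "dim_col (V_Z dA dB dC Z) = n * dC"
  by (simp_all add: V_Z_def Let_def mult.assoc)

text \<open>The amplitude of the state after applying \<open>V_Z\<close>, at register value j, is an
  entry of the j-th block of \<open>Y\<close>.\<close>

lemma V_Z_apply:
  assumes "j < N" "i < n" "c < dC"
  shows "(\<Sum>q<n * dC. V_Z dA dB dC Z $$ ((j * n + i) * dC + c, q) * \<psi> $ q) = (P j * X) $$ (i,c)"
proof -
  have "(\<Sum>q<n * dC. V_Z dA dB dC Z $$ ((j * n + i) * dC + c, q) * \<psi> $ q)
      = (\<Sum>i'<n. \<Sum>c'<dC. V_Z dA dB dC Z $$ ((j * n + i) * dC + c, i' * dC + c') * \<psi> $ (i' * dC + c'))"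
    by (rule sum_lessThan_mult_index)
  also have "\<dots> = (\<Sum>i'<n. \<Sum>c'<dC. if c' = c then P j $$ (i,i') * \<psi> $ (i' * dC + c') else 0)"
    using assms by (intro sum.cong) (auto simp: index_V_Z)
  also have "\<dots> = (P j * X) $$ (i,c)"
    using assms dim_P by (simp add: index_mat_mult del: index_mult_mat(1))
  finally show ?thesis .
qed

lemma dim_Y [simp]: "dim_row Y = n" "dim_col Y = N * dC"
  by (simp_all add: Y_def)

lemma rho_MZC_eq: "rho_MZC dA dB dC Z \<rho> = (adj Y * Y)\<^sup>T"
proof (rule eq_matI)
  let ?V = "V_Z dA dB dC Z"
  define \<phi> where "\<phi> r = (\<Sum>q<n * dC. ?V $$ (r, q) * \<psi> $ q)" for r
  \<comment> \<open>The enlarged state is still rank one, with amplitudes \<open>\<phi>\<close>;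
    tracing out AB sums over the rows of \<open>Y\<close>.\<close>
  have M: "(?V * \<rho> * adj ?V) $$ (r,s) = \<phi> r * cnj (\<phi> s)" if "r < N * n * dC" "s < N * n * dC" for r s
  proof -
    have "(?V * \<rho> * adj ?V) $$ (r,s) = (\<Sum>q'<n * dC. (\<Sum>q<n * dC. ?V $$ (r,q) * \<rho> $$ (q,q')) * cnj (?V $$ (s,q')))"
      using that \<psi> by (simp add: index_mat_mult dim_V_Z outer_def del: index_mult_mat(1))
    also have "\<dots> = (\<Sum>q'<n * dC. \<phi> r * (cnj (\<psi> $ q') * cnj (?V $$ (s,q'))))"
    proof (rule sum.cong)
      fix q' assume "q' \<in> {..<n * dC}"
      hence "(\<Sum>q<n * dC. ?V $$ (r,q) * \<rho> $$ (q,q')) = (\<Sum>q<n * dC. ?V $$ (r,q) * \<psi> $ q * cnj (\<psi> $ q'))"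
        by (intro sum.cong) (auto simp: index_\<rho>)
      also have "\<dots> = \<phi> r * cnj (\<psi> $ q')"
        unfolding \<phi>_def by (rule sum_distrib_right[symmetric])
      finally show "(\<Sum>q<n * dC. ?V $$ (r,q) * \<rho> $$ (q,q')) * cnj (?V $$ (s,q'))
        = \<phi> r * (cnj (\<psi> $ q') * cnj (?V $$ (s,q')))" by simp
    qed simp
    also have "\<dots> = \<phi> r * cnj (\<phi> s)"
      unfolding sum_distrib_left[symmetric] by (simp add: \<phi>_def mult.commute)
    finally show ?thesis .
  qed
  fix i j assume "i < dim_row ((adj Y * Y)\<^sup>T)" "j < dim_col ((adj Y * Y)\<^sup>T)"
  hence ij: "i < N * dC" "j < N * dC" by auto
  have b: "i div dC < N" "i mod dC < dC" "j div dC < N" "j mod dC < dC"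
    using ij div_index_less mod_index_less by blast+
  have "rho_MZC dA dB dC Z \<rho> $$ (i,j) = (\<Sum>k<n. (?V * \<rho> * adj ?V) $$
     ((i div dC * n + k) * dC + i mod dC, (j div dC * n + k) * dC + j mod dC))"
    using ij by (simp add: rho_MZC_def ptrace_mid_def del: index_mult_mat(1))
  also have "\<dots> = (\<Sum>k<n. Y $$ (k,i) * cnj (Y $$ (k,j)))"
  proof (rule sum.cong)
    fix k assume "k \<in> {..<n}"
    hence k: "k < n" by simp
    have "(?V * \<rho> * adj ?V) $$ ((i div dC * n + k) * dC + i mod dC, (j div dC * n + k) * dC + j mod dC)
        = \<phi> ((i div dC * n + k) * dC + i mod dC) * cnj (\<phi> ((j div dC * n + k) * dC + j mod dC))"
      using b k by (intro M pair_index_less)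
    also have "\<dots> = Y $$ (k,i) * cnj (Y $$ (k,j))"
      unfolding \<phi>_def V_Z_apply[OF b(1) k b(2)] V_Z_apply[OF b(3) k b(4)] Y_def hcat_def
      using ij k by (simp del: index_mult_mat(1))
    finally show "(?V * \<rho> * adj ?V) $$ ((i div dC * n + k) * dC + i mod dC, (j div dC * n + k) * dC + j mod dC)
      = Y $$ (k,i) * cnj (Y $$ (k,j))" .
  qed simp
  also have "\<dots> = (adj Y * Y)\<^sup>T $$ (i,j)"
    using ij by (simp add: index_mat_mult mult.commute del: index_mult_mat(1))
  finally show "rho_MZC dA dB dC Z \<rho> $$ (i,j) = (adj Y * Y)\<^sup>T $$ (i,j)" .
qed (auto simp: rho_MZC_def ptrace_mid_def)

lemma weighted_cond_state_eq:
  assumes j: "j < N"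
  shows "weighted_cond_state dA dB dC Z \<rho> j = (adj X * P j * X)\<^sup>T"
proof (rule eq_matI)
  fix c c' assume "c < dim_row ((adj X * P j * X)\<^sup>T)" "c' < dim_col ((adj X * P j * X)\<^sup>T)"
  hence c: "c < dC" "c' < dC" by auto
  let ?W = "kron (Z ! j) (1\<^sub>m dC)" and ?AC = "rho_AC dA dB dC \<rho>"
  have AC: "?AC $$ (a * dC + c, k * dC + c') = (\<Sum>b<dB. X $$ (a * dB + b, c) * cnj (X $$ (k * dB + b, c')))"
    if "a < dA" "k < dA" for a k
  proof -
    have "a * dC + c < dA * dC" "k * dC + c' < dA * dC" using that c by (intro pair_index_less; simp)+
    hence "?AC $$ (a * dC + c, k * dC + c') = (\<Sum>b<dB. \<rho> $$ ((a * dB + b) * dC + c, (k * dB + b) * dC + c'))"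
      using c by (simp add: rho_AC_def ptrace_mid_def)
    also have "\<dots> = (\<Sum>b<dB. X $$ (a * dB + b, c) * cnj (X $$ (k * dB + b, c')))"
      using that c by (intro sum.cong) (auto simp: index_\<rho> pair_index_less)
    finally show ?thesis .
  qed
  have dAC: "dim_row ?AC = dA * dC" "dim_col ?AC = dA * dC" by (auto simp: rho_AC_def ptrace_mid_def)
  have W: "(?W * ?AC) $$ (k * dC + c, k * dC + c')
      = (\<Sum>a<dA. Z ! j $$ (k,a) * (\<Sum>b<dB. X $$ (a * dB + b, c) * cnj (X $$ (k * dB + b, c'))))" if k: "k < dA" for k
  proof -
    have kb: "k * dC + c < dA * dC" "k * dC + c' < dA * dC" using k c by (intro pair_index_less; simp)+
    have "(?W * ?AC) $$ (k * dC + c, k * dC + c') = (\<Sum>q<dA * dC. ?W $$ (k * dC + c, q) * ?AC $$ (q, k * dC + c'))"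
      using kb dim_Z[OF j] dAC by (simp add: index_mat_mult del: index_mult_mat(1))
    also have "\<dots> = (\<Sum>a<dA. \<Sum>e<dC. ?W $$ (k * dC + c, a * dC + e) * ?AC $$ (a * dC + e, k * dC + c'))"
      by (rule sum_lessThan_mult_index)
    also have "\<dots> = (\<Sum>a<dA. \<Sum>e<dC. if e = c then Z ! j $$ (k,a) * ?AC $$ (a * dC + e, k * dC + c') else 0)"
      using kb c dim_Z[OF j] by (intro sum.cong) (auto simp: index_kron pair_index_less)
    also have "\<dots> = (\<Sum>a<dA. Z ! j $$ (k,a) * ?AC $$ (a * dC + c, k * dC + c'))"
      using c by simp
    also have "\<dots> = (\<Sum>a<dA. Z ! j $$ (k,a) * (\<Sum>b<dB. X $$ (a * dB + b, c) * cnj (X $$ (k * dB + b, c'))))"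
      using k by (intro sum.cong) (auto simp: AC)
    finally show ?thesis .
  qed
  have PX: "(P j * X) $$ (k * dB + b, c) = (\<Sum>a<dA. Z ! j $$ (k,a) * X $$ (a * dB + b, c))"
    if "k < dA" "b < dB" for k b
  proof -
    have kb: "k * dB + b < n" using that by (rule pair_index_less)
    have "(P j * X) $$ (k * dB + b, c) = (\<Sum>q<n. P j $$ (k * dB + b, q) * X $$ (q, c))"
      using kb c dim_P[OF j] by (subst index_mat_mult) auto
    also have "\<dots> = (\<Sum>a<dA. \<Sum>e<dB. P j $$ (k * dB + b, a * dB + e) * X $$ (a * dB + e, c))"
      by (rule sum_lessThan_mult_index)
    also have "\<dots> = (\<Sum>a<dA. \<Sum>e<dB. if e = b then Z ! j $$ (k,a) * X $$ (a * dB + e, c) else 0)"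
      using kb that dim_Z[OF j] unfolding P_def
      by (intro sum.cong) (auto simp: index_kron pair_index_less simp del: index_X)
    also have "\<dots> = (\<Sum>a<dA. Z ! j $$ (k,a) * X $$ (a * dB + b, c))"
      using that by simp
    finally show ?thesis .
  qed
  have "weighted_cond_state dA dB dC Z \<rho> j $$ (c,c') = (\<Sum>k<dA. (?W * ?AC) $$ (k * dC + c, k * dC + c'))"
    using c by (simp add: weighted_cond_state_def ptrace_mid_def del: index_mult_mat(1))
  also have "\<dots> = (\<Sum>k<dA. \<Sum>a<dA. Z ! j $$ (k,a) * (\<Sum>b<dB. X $$ (a * dB + b, c) * cnj (X $$ (k * dB + b, c'))))"
    by (intro sum.cong) (auto simp: W)
  also have "\<dots> = (\<Sum>k<dA. \<Sum>a<dA. \<Sum>b<dB. cnj (X $$ (k * dB + b, c')) * (Z ! j $$ (k,a) * X $$ (a * dB + b, c)))"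
    by (simp add: sum_distrib_left mult_ac del: index_X)
  \<comment> \<open>B was traced out inside \<open>rho_AC\<close> and A afterwards. Bringing the sum
    over b outside that over a joins (k, b) into one row index of \<open>X\<close> and leaves an
    entry of \<open>P j * X\<close>.\<close>
  also have "\<dots> = (\<Sum>k<dA. \<Sum>b<dB. \<Sum>a<dA. cnj (X $$ (k * dB + b, c')) * (Z ! j $$ (k,a) * X $$ (a * dB + b, c)))"
    by (intro sum.cong refl sum.swap)
  also have "\<dots> = (\<Sum>k<dA. \<Sum>b<dB. cnj (X $$ (k * dB + b, c')) * (P j * X) $$ (k * dB + b, c))"
    by (intro sum.cong refl) (simp add: PX sum_distrib_left del: index_X index_mult_mat(1))
  also have "\<dots> = (\<Sum>i<n. cnj (X $$ (i, c')) * (P j * X) $$ (i, c))"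
    by (rule sum_lessThan_mult_index[symmetric])
  also have "\<dots> = (adj X * (P j * X)) $$ (c', c)"
    using c dim_P[OF j] by (subst index_mat_mult) auto
  also have "\<dots> = (adj X * P j * X)\<^sup>T $$ (c,c')"
    using c dim_P[OF j] by (simp add: mat_mult_assoc del: index_mult_mat(1))
  finally show "weighted_cond_state dA dB dC Z \<rho> j $$ (c,c') = (adj X * P j * X)\<^sup>T $$ (c,c')" .
qed (auto simp: weighted_cond_state_def ptrace_mid_def)

lemma pinch_eq: "pinch dA dB Z \<sigma> = pin \<sigma>"
  unfolding pinch_def pin_def msum_eq_mat_sum by (intro eq_matI) (auto simp: P_def)

lemma Y_mult_adj: "Y * adj Y = pin (X * adj X)"
proof -
  have "Y * adj Y = mat_sum n n N (\<lambda>j. P j * X * adj (P j * X))"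
    unfolding Y_def using dim_P by (subst hcat_mult_adj_hcat) auto
  also have "\<dots> = pin (X * adj X)"
    unfolding pin_def using dim_P by (intro mat_sum_cong) (simp add: adj_mult adj_P mat_mult_assoc)
  finally show ?thesis .
qed

lemma density_X: "density n (X * adj X)"
proof -
  have "mtrace (adj X * X) = complex_of_real (\<Sum>c<dC. \<Sum>i<n. (cmod (X $$ (i,c)))\<^sup>2)"
    using mtrace_adj_mult[of X] by simp
  also have "(\<Sum>c<dC. \<Sum>i<n. (cmod (X $$ (i,c)))\<^sup>2) = (\<Sum>i<n. \<Sum>c<dC. (cmod (X $$ (i,c)))\<^sup>2)"
    by (rule sum.swap)
  also have "\<dots> = (\<Sum>q<n * dC. (cmod (\<psi> $ q))\<^sup>2)"
    unfolding sum_lessThan_mult_index[of _ n dC] by simp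
  finally have "mtrace (adj X * X) = 1" using norm_\<psi> by simp
  thus ?thesis unfolding density_def
    using psd_mult_adj[of X n] mtrace_mult_comm[of X "adj X"] by simp
qed

lemma cond_entropy_eq: "cond_entropy dA dB dC Z \<rho> = vN_entropy (pin (X * adj X)) - vN_entropy (X * adj X)"
proof -
  have "vN_entropy ((adj M * M)\<^sup>T) = vN_entropy (M * adj M)" for M
    using vN_entropy_transpose[OF psd_hermitian[OF psd_adj_mult[OF refl]], of M] vN_entropy_swap[of M] by simp
  thus ?thesis unfolding cond_entropy_def rho_MZC_eq rho_C_eq by (simp add: Y_mult_adj)
qed

lemma cond_entropy_Q_eq:
  "cond_entropy_Q dA dB dC Z \<rho> = Re (mtrace (X * adj X * (X * adj X)))
     - Re (mtrace (pin (X * adj X) * pin (X * adj X)))"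
proof -
  have "mtrace ((adj M * M)\<^sup>T * (adj M * M)\<^sup>T) = mtrace (M * adj M * (M * adj M))" for M
  proof -
    have "mtrace ((adj M * M)\<^sup>T * (adj M * M)\<^sup>T) = mtrace ((adj M * M * (adj M * M))\<^sup>T)"
      by (subst (3) transpose_mat_mult) auto
    also have "\<dots> = mtrace (adj M * (M * (adj M * M)))"
      by (subst mtrace_transpose) (auto simp: mat_mult_assoc)
    also have "\<dots> = mtrace (M * (adj M * M) * adj M)"
      by (rule mtrace_mult_comm) auto
    finally show ?thesis by (simp add: mat_mult_assoc)
  qed
  thus ?thesis unfolding cond_entropy_Q_def rho_MZC_eq rho_C_eq by (simp add: Y_mult_adj)
qed

text \<open>Transposing every element maps POVMs to resolutions and back and absorbs the transpose
  in the conditional states. As the optimum is attained, the supremum defining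
  \<open>p_guess\<close> is a maximum.\<close>

lemma p_guess_eq:
  assumes R: "resolution N dC R"
    and max: "\<And>R'. resolution N dC R' \<Longrightarrow>
       (\<Sum>j<N. Re (mtrace (R' j * (adj X * P j * X)))) \<le> (\<Sum>j<N. Re (mtrace (R j * (adj X * P j * X))))"
  shows "p_guess dA dB dC Z \<rho> = (\<Sum>j<N. Re (mtrace (R j * (adj X * P j * X))))"
proof -
  let ?s = "\<lambda>R. \<Sum>j<N. Re (mtrace (R j * (adj X * P j * X)))"
  let ?g = "\<lambda>Q. \<Sum>j<N. Re (mtrace (Q ! j * weighted_cond_state dA dB dC Z \<rho> j))"
  have s: "?g Q = ?s (\<lambda>j. (Q ! j)\<^sup>T)" if Q: "\<And>j. j < N \<Longrightarrow> dim_row (Q ! j) = dC" "\<And>j. j < N \<Longrightarrow> dim_col (Q ! j) = dC" for Q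
  proof (rule sum.cong)
    fix j assume "j \<in> {..<N}"
    hence j: "j < N" by simp
    have "mtrace (Q ! j * (adj X * P j * X)\<^sup>T) = mtrace ((adj X * P j * X * (Q ! j)\<^sup>T)\<^sup>T)"
      using Q[OF j] by (subst (2) transpose_mat_mult) auto
    also have "\<dots> = mtrace (adj X * P j * X * (Q ! j)\<^sup>T)"
      using Q[OF j] by (intro mtrace_transpose) auto
    also have "\<dots> = mtrace ((Q ! j)\<^sup>T * (adj X * P j * X))"
      using Q[OF j] by (intro mtrace_mult_comm) auto
    finally show "Re (mtrace (Q ! j * weighted_cond_state dA dB dC Z \<rho> j)) = Re (mtrace ((Q ! j)\<^sup>T * (adj X * P j * X)))"
      by (simp add: weighted_cond_state_eq[OF j])
  qed simp
  have dR: "dim_row (R j) = dC" "dim_col (R j) = dC" if "j < N" for j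
    using R that hermitianD[OF psd_hermitian, of dC "R j"] by (auto simp: resolution_def)
  define Q where "Q = map (\<lambda>j. (R j)\<^sup>T) [0..<N]"
  have Qj: "Q ! j = (R j)\<^sup>T" if "j < N" for j using that by (simp add: Q_def)
  have sum_T: "mat_sum dC dC N (\<lambda>j. (F j)\<^sup>T) = (mat_sum dC dC N F)\<^sup>T"
    if "\<And>j. j < N \<Longrightarrow> dim_row (F j) = dC" "\<And>j. j < N \<Longrightarrow> dim_col (F j) = dC" for F
    using that by (intro eq_matI) auto
  have povmQ: "povm N dC Q"
    unfolding povm_def
  proof (intro conjI allI impI)
    show "length Q = N" by (simp add: Q_def)
    show "psd dC (Q ! j)" if "j < N" for j
      using R that by (simp add: Qj resolution_def psd_transpose)
    have "msum dC Q = mat_sum dC dC N (\<lambda>j. (R j)\<^sup>T)"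
      unfolding msum_eq_mat_sum \<open>length Q = N\<close> by (intro mat_sum_cong Qj)
    also have "\<dots> = (mat_sum dC dC N R)\<^sup>T" using dR by (intro sum_T)
    finally show "msum dC Q = 1\<^sub>m dC" using R by (simp add: resolution_def)
  qed
  have gQ: "?g Q = ?s R"
    using s[of Q] dR by (simp add: Qj)
  have le: "?g Q' \<le> ?s R" if Q': "povm N dC Q'" for Q'
  proof -
    have p: "psd dC (Q' ! j)" if "j < N" for j using Q' that by (simp add: povm_def)
    note d = hermitianD[OF psd_hermitian[OF p]]
    have "mat_sum dC dC N (\<lambda>j. (Q' ! j)\<^sup>T) = (mat_sum dC dC N (\<lambda>j. Q' ! j))\<^sup>T"
      using d by (intro sum_T)
    also have "mat_sum dC dC N (\<lambda>j. Q' ! j) = 1\<^sub>m dC"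
      using Q' by (auto simp: povm_def msum_eq_mat_sum)
    finally have "resolution N dC (\<lambda>j. (Q' ! j)\<^sup>T)"
      unfolding resolution_def using psd_transpose[OF p] by simp
    from max[OF this] show ?thesis using s[of Q'] d by simp
  qed
  show ?thesis
    unfolding p_guess_def
  proof (rule cSup_eq_maximum)
    show "?s R \<in> {?g Q |Q. povm N dC Q}" using povmQ gQ[symmetric] by blast
    show "x \<le> ?s R" if "x \<in> {?g Q |Q. povm N dC Q}" for x using that le by blast
  qed
qed

end

theorem theorem1:
  fixes dA dB dC :: nat and \<rho> :: "complex mat" and Z :: "complex mat list"
  assumes "pure_state (dA * dB * dC) \<rho>"
    and "type_info dA Z"
  shows "((\<exists>\<sigma>. density (dA * dB) \<sigma> \<and>
              rel_entropy (rho_AB dA dB dC \<rho>) (pinch dA dB Z \<sigma>) = ereal (cond_entropy dA dB dC Z \<rho>))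
          \<and> (\<forall>\<sigma>. density (dA * dB) \<sigma> \<longrightarrow>
              ereal (cond_entropy dA dB dC Z \<rho>) \<le> rel_entropy (rho_AB dA dB dC \<rho>) (pinch dA dB Z \<sigma>)))
       \<and> ((\<exists>\<sigma>. density (dA * dB) \<sigma> \<and>
              hs_dist (rho_AB dA dB dC \<rho>) (pinch dA dB Z \<sigma>) = cond_entropy_Q dA dB dC Z \<rho>)
          \<and> (\<forall>\<sigma>. density (dA * dB) \<sigma> \<longrightarrow>
              cond_entropy_Q dA dB dC Z \<rho> \<le> hs_dist (rho_AB dA dB dC \<rho>) (pinch dA dB Z \<sigma>)))
       \<and> ((\<exists>\<sigma>. density (dA * dB) \<sigma> \<and>
              fidelity (rho_AB dA dB dC \<rho>) (pinch dA dB Z \<sigma>) = p_guess dA dB dC Z \<rho>)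
          \<and> (\<forall>\<sigma>. density (dA * dB) \<sigma> \<longrightarrow>
              fidelity (rho_AB dA dB dC \<rho>) (pinch dA dB Z \<sigma>) \<le> p_guess dA dB dC Z \<rho>))"
proof -
  obtain \<psi> where \<psi>: "\<psi> \<in> carrier_vec (dA * dB * dC)" "(\<Sum>i<dA * dB * dC. (cmod (\<psi> $ i))\<^sup>2) = 1"
    and \<rho>: "\<rho> = outer \<psi> \<psi>"
    using assms(1) by (auto simp: pure_state_def)
  interpret T: tripartite_pure_state dA dB dC Z \<psi>
    using \<psi> assms(2) by unfold_locales
  let ?\<rho> = "T.X * adj T.X"
  note D = T.density_X
  obtain R \<sigma> where R: "resolution (length Z) dC R" and \<sigma>: "density (dA * dB) \<sigma>"
    and max: "\<And>R'. resolution (length Z) dC R' \<Longrightarrow>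
       (\<Sum>j<length Z. Re (mtrace (R' j * (adj T.X * T.P j * T.X)))) \<le> (\<Sum>j<length Z. Re (mtrace (R j * (adj T.X * T.P j * T.X))))"
    and le: "\<And>\<sigma>'. density (dA * dB) \<sigma>' \<Longrightarrow>
       fidelity ?\<rho> (T.pin \<sigma>') \<le> (\<Sum>j<length Z. Re (mtrace (R j * (adj T.X * T.P j * T.X))))"
    and eq: "fidelity ?\<rho> (T.pin \<sigma>) = (\<Sum>j<length Z. Re (mtrace (R j * (adj T.X * T.P j * T.X))))"
    by (rule T.fidelity_pin_max[OF T.dim_X densityD(2)[OF D]]) blast
  note g = T.p_guess_eq[OF R max]
  have hs: "hs_dist ?\<rho> (T.pin \<sigma>) = cond_entropy_Q dA dB dC Z \<rho> + hs_dist (T.pin ?\<rho>) (T.pin \<sigma>)"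
    if "density (dA * dB) \<sigma>" for \<sigma>
    using T.pinching_hs_dist[OF densityD(3)[OF D] densityD(3)[OF that]] unfolding \<rho> T.cond_entropy_Q_eq by simp
  have hs0: "hs_dist (T.pin ?\<rho>) (T.pin ?\<rho>) = 0"
    using hs_dist_expand[of "T.pin ?\<rho>" "dA * dB" "T.pin ?\<rho>"] by simp
  have hsge: "hs_dist (T.pin ?\<rho>) (T.pin \<sigma>) \<ge> 0" if "density (dA * dB) \<sigma>" for \<sigma>
    using densityD(3)[OF T.density_pin[OF D]] densityD(3)[OF T.density_pin[OF that]] by (rule hs_dist_nonneg)
  show ?thesis
    unfolding T.pinch_eq T.rho_AB_eq[folded \<rho>]
  proof (intro conjI allI impI)
    \<comment> \<open>The state on AB itself is the witness here and for the Hilbert-Schmidt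
      distance; the fidelity uses the state built from an optimal POVM.\<close>
    show "\<exists>\<sigma>. density (dA * dB) \<sigma> \<and> rel_entropy ?\<rho> (T.pin \<sigma>) = ereal (cond_entropy dA dB dC Z \<rho>)"
      using T.pin_entropy_eq[OF D] D unfolding \<rho> T.cond_entropy_eq by blast
    show "\<exists>\<sigma>. density (dA * dB) \<sigma> \<and> hs_dist ?\<rho> (T.pin \<sigma>) = cond_entropy_Q dA dB dC Z \<rho>"
      using hs[OF D] hs0 D by auto
    show "\<exists>\<sigma>. density (dA * dB) \<sigma> \<and> fidelity ?\<rho> (T.pin \<sigma>) = p_guess dA dB dC Z \<rho>"
      using \<sigma> eq g unfolding \<rho> by auto
    fix \<sigma>' assume d: "density (dA * dB) \<sigma>'"
    show "ereal (cond_entropy dA dB dC Z \<rho>) \<le> rel_entropy ?\<rho> (T.pin \<sigma>')"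
      using T.pin_entropy_ge[OF D d] unfolding \<rho> T.cond_entropy_eq .
    show "cond_entropy_Q dA dB dC Z \<rho> \<le> hs_dist ?\<rho> (T.pin \<sigma>')"
      using hs[OF d] hsge[OF d] by simp
    show "fidelity ?\<rho> (T.pin \<sigma>') \<le> p_guess dA dB dC Z \<rho>"
      using le[OF d] g unfolding \<rho> by simp
  qed
qed

end
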